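(* Let $G$ be a group acting on a monoidal triangulated category $\mathbf{K}$. Let $\mathbf{I}$ be a $G$-ideal of $\mathbf{K}$ and $\mathbf{J}$ a thick ideal of $\mathbf{K}\rtimes G$. Then: (1) $\mathbf{I}\rtimes G$ is a thick ideal of $\mathbf{K}\rtimes G$; (2) $\mathbf{J}\cap\mathbf{K}$ is a $G$-ideal of $\mathbf{K}$; (3) the maps given by (1) and (2) define a bijection between $G$-ideals of $\mathbf{K}$ and thick ideals of $\mathbf{K}\rtimes G$, that is, $(\mathbf{I}\rtimes G)\cap\mathbf{K}=\mathbf{I}$ and $(\mathbf{J}\cap\mathbf{K})\rtimes G=\mathbf{J}$; (4) a $G$-ideal $\mathbf{Q}$ of $\mathbf{K}$ is a $G$-prime of $\mathbf{K}$ if and only if $\mathbf{Q}\rtimes G$ is a prime ideal of $\mathbf{K}\rtimes G$; (5) the bijection from (3) restricts to a homeomorphism $\operatorname{Spc}(\mathbf{K}\rtimes G)\cong G\text{-}\operatorname{Spc}\mathbf{K}$.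
   Context: A monoidal triangulated category is a triangulated category $\mathbf{K}$ with a monoidal structure $(\otimes,\mathbf{1})$ such that $\otimes$ is exact in each variable; no braiding is assumed. An action of a group $G$ (identity $e$) on $\mathbf{K}$ consists of autoequivalences of monoidal triangulated categories $T_g:\mathbf{K}\to\mathbf{K}$ (monoidal and triangulated), $g\in G$, and natural isomorphisms (of monoidal triangulated functors) $\gamma_{g,h}:T_gT_h\cong T_{gh}$ with $\gamma_{g,hk}\circ T_g\gamma_{h,k}=\gamma_{gh,k}\circ\gamma_{g,h}T_k$ for all $g,h,k\in G$. All subcategories are full and closed under isomorphism. A thick ideal is a triangulated subcategory closed under direct summands and under $\otimes$ on both sides with arbitrary objects. A prime ideal is a proper thick ideal $\mathbf{P}$ such that $\mathbf{I}\otimes\mathbf{J}\subseteq\mathbf{P}$ implies $\mathbf{I}\subseteq\mathbf{P}$ or $\mathbf{J}\subseteq\mathbf{P}$ for thick ideals $\mathbf{I},\mathbf{J}$. $\operatorname{Spc}$ of a monoidal triangulated category is the set of its prime ideals, with closed sets $V(\mathbf{S})=\{\mathbf{P}:\mathbf{S}\cap\mathbf{P}=\varnothing\}$ for collections $\mathbf{S}$ of objects. A $G$-ideal of $\mathbf{K}$ is a thick ideal $\mathbf{I}$ with $T_g\mathbf{I}\subseteq\mathbf{I}$ for all $g\in G$. A $G$-prime is a proper $G$-ideal $\mathbf{Q}$ such that for all $G$-ideals $\mathbf{I},\mathbf{J}$, $\mathbf{I}\otimes\mathbf{J}\subseteq\mathbf{Q}$ implies $\mathbf{I}\subseteq\mathbf{Q}$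 or $\mathbf{J}\subseteq\mathbf{Q}$. $G\text{-}\operatorname{Spc}\mathbf{K}$ is the set of $G$-primes with closed sets $V^G(\mathbf{S})=\{\mathbf{Q}:\mathbf{S}\cap\mathbf{Q}=\varnothing\}$. Crossed product: $\mathbf{K}\rtimes G=\bigoplus_{g\in G}\mathbf{K}$ as an additive and triangulated category. The object $A\in\mathbf{K}$ in the copy indexed by $g$ is written $A\boxtimes g$; objects are formal (finite) direct sums of such; $\operatorname{Hom}(A\boxtimes g,B\boxtimes h)$ is $\operatorname{Hom}_{\mathbf{K}}(A,B)$ if $g=h$ and $0$ otherwise. The tensor product is $(A\boxtimes g)\otimes(B\boxtimes h)=(A\otimes T_g(B))\boxtimes gh$, with unit $\mathbf{1}\boxtimes e$. For a $G$-ideal $\mathbf{I}$, $\mathbf{I}\rtimes G$ is the collection of objects of $\mathbf{K}\rtimes G$ generated additively by the objects $A\boxtimes g$ with $A\in\mathbf{I}$, $g\in G$. For a thick ideal $\mathbf{J}$ of $\mathbf{K}\rtimes G$, $\mathbf{J}\cap\mathbf{K}=\{A\in\mathbf{K}:A\boxtimes e\in\mathbf{J}\}$. *)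

theory Defs
  imports "HOL-Analysis.Abstract_Topology" "HOL-Algebra.FiniteProduct"
begin

section \<open>Categories, functors, natural isomorphisms\<close>

record ('o, 'm) cat =
  Obj :: "'o set"
  Mor :: "'m set"
  Dom :: "'m \<Rightarrow> 'o"
  Cod :: "'m \<Rightarrow> 'o"
  Ident :: "'o \<Rightarrow> 'm"
  Comp :: "'m \<Rightarrow> 'm \<Rightarrow> 'm" (infixl "\<cdot>\<index>" 75)

definition Hom :: "('o, 'm, 'z) cat_scheme \<Rightarrow> 'o \<Rightarrow> 'o \<Rightarrow> 'm set" where
  "Hom C A B = {f \<in> Mor C. Dom C f = A \<and> Cod C f = B}"

locale category =
  fixes C :: "('o, 'm, 'z) cat_scheme" (structure)
  assumes dom_cod: "f \<in> Mor C \<Longrightarrow> Dom C f \<in> Obj C \<and> Cod C f \<in> Obj C"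
    and ident: "A \<in> Obj C \<Longrightarrow> Ident C A \<in> Hom C A A"
    and comp: "f \<in> Hom C X Y \<Longrightarrow> g \<in> Hom C Y Z \<Longrightarrow> g \<cdot> f \<in> Hom C X Z"
    and comp_ident: "f \<in> Hom C X Y \<Longrightarrow> f \<cdot> Ident C X = f"
    and ident_comp: "f \<in> Hom C X Y \<Longrightarrow> Ident C Y \<cdot> f = f"
    and comp_assoc: "f \<in> Hom C W X \<Longrightarrow> g \<in> Hom C X Y \<Longrightarrow> h \<in> Hom C Y Z
      \<Longrightarrow> (h \<cdot> g) \<cdot> f = h \<cdot> (g \<cdot> f)"

definition inverse_mors :: "('o, 'm, 'z) cat_scheme \<Rightarrow> 'm \<Rightarrow> 'm \<Rightarrow> bool" where
  "inverse_mors C f g \<longleftrightarrow> f \<in> Mor C \<and> g \<in> Hom C (Cod C f) (Dom C f) \<and>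
     g \<cdot>\<^bsub>C\<^esub> f = Ident C (Dom C f) \<and> f \<cdot>\<^bsub>C\<^esub> g = Ident C (Cod C f)"

definition is_iso :: "('o, 'm, 'z) cat_scheme \<Rightarrow> 'm \<Rightarrow> bool" where
  "is_iso C f \<longleftrightarrow> (\<exists>g. inverse_mors C f g)"

definition inv_mor :: "('o, 'm, 'z) cat_scheme \<Rightarrow> 'm \<Rightarrow> 'm" where
  "inv_mor C f = (THE g. inverse_mors C f g)"

definition isomorphic :: "('o, 'm, 'z) cat_scheme \<Rightarrow> 'o \<Rightarrow> 'o \<Rightarrow> bool" where
  "isomorphic C A B \<longleftrightarrow> (\<exists>f \<in> Hom C A B. is_iso C f)"

definition zero_object :: "('o, 'm, 'z) cat_scheme \<Rightarrow> 'o \<Rightarrow> bool" where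
  "zero_object C Z \<longleftrightarrow> Z \<in> Obj C \<and>
     (\<forall>A \<in> Obj C. (\<exists>!f. f \<in> Hom C A Z) \<and> (\<exists>!f. f \<in> Hom C Z A))"

record ('o, 'm, 'p, 'n) fctr =
  fo :: "'o \<Rightarrow> 'p"
  fm :: "'m \<Rightarrow> 'n"

definition is_functor ::
    "('o, 'm, 'y) cat_scheme \<Rightarrow> ('p, 'n, 'z) cat_scheme \<Rightarrow> ('o, 'm, 'p, 'n, 'x) fctr_scheme \<Rightarrow> bool"
  where
  "is_functor C D F \<longleftrightarrow>
     (\<forall>A \<in> Obj C. fo F A \<in> Obj D \<and> fm F (Ident C A) = Ident D (fo F A)) \<and>
     (\<forall>f \<in> Mor C. fm F f \<in> Hom D (fo F (Dom C f)) (fo F (Cod C f))) \<and>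
     (\<forall>f \<in> Mor C. \<forall>g \<in> Mor C. Cod C f = Dom C g \<longrightarrow> fm F (g \<cdot>\<^bsub>C\<^esub> f) = fm F g \<cdot>\<^bsub>D\<^esub> fm F f)"

definition id_fctr :: "('o, 'm, 'o, 'm) fctr" where
  "id_fctr = \<lparr>fo = (\<lambda>A. A), fm = (\<lambda>f. f)\<rparr>"

definition comp_fctr ::
    "('p, 'n, 'q, 'l, 'y) fctr_scheme \<Rightarrow> ('o, 'm, 'p, 'n, 'x) fctr_scheme \<Rightarrow> ('o, 'm, 'q, 'l) fctr"
  where
  "comp_fctr F G = \<lparr>fo = fo F \<circ> fo G, fm = fm F \<circ> fm G\<rparr>"

definition natural_iso ::
    "('o, 'm, 'y) cat_scheme \<Rightarrow> ('p, 'n, 'z) cat_scheme \<Rightarrow> ('o, 'm, 'p, 'n, 'x) fctr_scheme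
      \<Rightarrow> ('o, 'm, 'p, 'n, 'w) fctr_scheme \<Rightarrow> ('o \<Rightarrow> 'n) \<Rightarrow> bool" where
  "natural_iso C D F G \<tau> \<longleftrightarrow>
     (\<forall>A \<in> Obj C. \<tau> A \<in> Hom D (fo F A) (fo G A) \<and> is_iso D (\<tau> A)) \<and>
     (\<forall>f \<in> Mor C. \<tau> (Cod C f) \<cdot>\<^bsub>D\<^esub> fm F f = fm G f \<cdot>\<^bsub>D\<^esub> \<tau> (Dom C f))"

definition is_equivalence ::
    "('o, 'm, 'y) cat_scheme \<Rightarrow> ('p, 'n, 'z) cat_scheme \<Rightarrow> ('o, 'm, 'p, 'n, 'x) fctr_scheme \<Rightarrow> bool"
  where
  "is_equivalence C D F \<longleftrightarrow> is_functor C D F \<and>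
     (\<exists>G :: ('p, 'n, 'o, 'm) fctr. is_functor D C G \<and>
        (\<exists>\<eta>. natural_iso C C id_fctr (comp_fctr G F) \<eta>) \<and>
        (\<exists>\<epsilon>. natural_iso D D (comp_fctr F G) id_fctr \<epsilon>))"


section \<open>Additive categories\<close>

record ('o, 'm) add_cat = "('o, 'm) cat" +
  ZeroMor :: "'o \<Rightarrow> 'o \<Rightarrow> 'm"
  AddMor :: "'m \<Rightarrow> 'm \<Rightarrow> 'm"

definition hom_group :: "('o, 'm, 'z) add_cat_scheme \<Rightarrow> 'o \<Rightarrow> 'o \<Rightarrow> 'm monoid" where
  "hom_group C A B = \<lparr>carrier = Hom C A B, monoid.mult = AddMor C, one = ZeroMor C A B\<rparr>"

definition NegMor :: "('o, 'm, 'z) add_cat_scheme \<Rightarrow> 'm \<Rightarrow> 'm" where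
  "NegMor C f = inv\<^bsub>hom_group C (Dom C f) (Cod C f)\<^esub> f"

definition is_direct_sum :: "('o, 'm, 'z) add_cat_scheme \<Rightarrow> 'o \<Rightarrow> 'o \<Rightarrow> 'o \<Rightarrow> bool" where
  "is_direct_sum C A B S \<longleftrightarrow>
     (\<exists>i1 \<in> Hom C A S. \<exists>i2 \<in> Hom C B S. \<exists>p1 \<in> Hom C S A. \<exists>p2 \<in> Hom C S B.
        p1 \<cdot>\<^bsub>C\<^esub> i1 = Ident C A \<and> p2 \<cdot>\<^bsub>C\<^esub> i2 = Ident C B \<and>
        p1 \<cdot>\<^bsub>C\<^esub> i2 = ZeroMor C B A \<and> p2 \<cdot>\<^bsub>C\<^esub> i1 = ZeroMor C A B \<and>
        AddMor C (i1 \<cdot>\<^bsub>C\<^esub> p1) (i2 \<cdot>\<^bsub>C\<^esub> p2) = Ident C S)"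

locale additive_category = category C for C :: "('o, 'm, 'z) add_cat_scheme" (structure) +
  assumes hom_group: "A \<in> Obj C \<Longrightarrow> B \<in> Obj C \<Longrightarrow> comm_group (hom_group C A B)"
    and comp_add: "f \<in> Hom C X Y \<Longrightarrow> g \<in> Hom C Y Z \<Longrightarrow> g' \<in> Hom C Y Z
      \<Longrightarrow> AddMor C g g' \<cdot> f = AddMor C (g \<cdot> f) (g' \<cdot> f)"
    and add_comp: "f \<in> Hom C X Y \<Longrightarrow> f' \<in> Hom C X Y \<Longrightarrow> g \<in> Hom C Y Z
      \<Longrightarrow> g \<cdot> AddMor C f f' = AddMor C (g \<cdot> f) (g \<cdot> f')"
    and zero_object_exists: "\<exists>Z. zero_object C Z"
    and direct_sum_exists: "A \<in> Obj C \<Longrightarrow> B \<in> Obj C \<Longrightarrow> \<exists>S \<in> Obj C. is_direct_sum C A B S"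

definition additive_functor ::
    "('o, 'm, 'y) add_cat_scheme \<Rightarrow> ('p, 'n, 'z) add_cat_scheme \<Rightarrow> ('o, 'm, 'p, 'n, 'x) fctr_scheme
      \<Rightarrow> bool" where
  "additive_functor C D F \<longleftrightarrow> is_functor C D F \<and>
     (\<forall>A \<in> Obj C. \<forall>B \<in> Obj C. \<forall>f \<in> Hom C A B. \<forall>g \<in> Hom C A B.
        fm F (AddMor C f g) = AddMor D (fm F f) (fm F g))"


section \<open>Triangulated categories\<close>

record ('o, 'm) shift_cat = "('o, 'm) add_cat" +
  Shift :: "('o, 'm, 'o, 'm) fctr"

abbreviation Sh :: "('o, 'm, 'z) shift_cat_scheme \<Rightarrow> 'o \<Rightarrow> 'o" where
  "Sh C \<equiv> fo (Shift C)"

abbreviation Shm :: "('o, 'm, 'z) shift_cat_scheme \<Rightarrow> 'm \<Rightarrow> 'm" where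
  "Shm C \<equiv> fm (Shift C)"

definition triangle :: "('o, 'm, 'z) shift_cat_scheme \<Rightarrow> 'm \<times> 'm \<times> 'm \<Rightarrow> bool" where
  "triangle C = (\<lambda>(f, g, h). f \<in> Mor C \<and> g \<in> Mor C \<and> h \<in> Mor C \<and>
     Dom C g = Cod C f \<and> Dom C h = Cod C g \<and> Cod C h = Sh C (Dom C f))"

definition isomorphic_triangles ::
    "('o, 'm, 'z) shift_cat_scheme \<Rightarrow> 'm \<times> 'm \<times> 'm \<Rightarrow> 'm \<times> 'm \<times> 'm \<Rightarrow> bool" where
  "isomorphic_triangles C = (\<lambda>(f, g, h) (f', g', h').
     triangle C (f, g, h) \<and> triangle C (f', g', h') \<and>
     (\<exists>u \<in> Hom C (Dom C f) (Dom C f'). \<exists>v \<in> Hom C (Dom C g) (Dom C g').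
      \<exists>w \<in> Hom C (Dom C h) (Dom C h').
        is_iso C u \<and> is_iso C v \<and> is_iso C w \<and>
        v \<cdot>\<^bsub>C\<^esub> f = f' \<cdot>\<^bsub>C\<^esub> u \<and> w \<cdot>\<^bsub>C\<^esub> g = g' \<cdot>\<^bsub>C\<^esub> v \<and> Shm C u \<cdot>\<^bsub>C\<^esub> h = h' \<cdot>\<^bsub>C\<^esub> w))"

record ('o, 'm) tri_cat = "('o, 'm) shift_cat" +
  Dist :: "('m \<times> 'm \<times> 'm) set"

text \<open>The shift is only required to be an additive autoequivalence, not a strict automorphism.\<close>

locale triangulated_category =
  additive_category C for C :: "('o, 'm, 'z) tri_cat_scheme" (structure) +
  assumes shift_additive: "additive_functor C C (Shift C)"
    and shift_equivalence: "is_equivalence C C (Shift C)"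
    and dist_triangle: "t \<in> Dist C \<Longrightarrow> triangle C t"
    and dist_iso: "t \<in> Dist C \<Longrightarrow> isomorphic_triangles C t t' \<Longrightarrow> t' \<in> Dist C"
    and dist_ident: "A \<in> Obj C \<Longrightarrow> zero_object C Z
      \<Longrightarrow> (Ident C A, ZeroMor C A Z, ZeroMor C Z (Sh C A)) \<in> Dist C"
    and dist_cone: "f \<in> Mor C \<Longrightarrow> \<exists>g h. (f, g, h) \<in> Dist C"
    and dist_rotate: "triangle C (f, g, h)
      \<Longrightarrow> (f, g, h) \<in> Dist C \<longleftrightarrow> (g, h, NegMor C (Shm C f)) \<in> Dist C"
    and dist_fill: "(f, g, h) \<in> Dist C \<Longrightarrow> (f', g', h') \<in> Dist C
      \<Longrightarrow> u \<in> Hom C (Dom C f) (Dom C f') \<Longrightarrow> v \<in> Hom C (Dom C g) (Dom C g')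
      \<Longrightarrow> v \<cdot> f = f' \<cdot> u
      \<Longrightarrow> \<exists>w \<in> Hom C (Dom C h) (Dom C h'). w \<cdot> g = g' \<cdot> v \<and> Shm C u \<cdot> h = h' \<cdot> w"
    and octahedron: "f \<in> Hom C X Y \<Longrightarrow> g \<in> Hom C Y Z
      \<Longrightarrow> (f, a, b) \<in> Dist C \<Longrightarrow> (g, c, d) \<in> Dist C \<Longrightarrow> (g \<cdot> f, p, q) \<in> Dist C
      \<Longrightarrow> \<exists>u \<in> Hom C (Cod C a) (Cod C p). \<exists>v \<in> Hom C (Cod C p) (Cod C c).
            (u, v, Shm C a \<cdot> d) \<in> Dist C \<and>
            u \<cdot> a = p \<cdot> g \<and> q \<cdot> u = b \<and> v \<cdot> p = c \<and> d \<cdot> v = Shm C f \<cdot> q"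

text \<open>An exact functor comes with a comparison \<open>\<xi> A : F (\<Sigma> A) \<rightarrow> \<Sigma> (F A)\<close>.\<close>

definition exact_functor ::
    "('o, 'm, 'y) tri_cat_scheme \<Rightarrow> ('p, 'n, 'z) tri_cat_scheme \<Rightarrow> ('o, 'm, 'p, 'n, 'x) fctr_scheme
      \<Rightarrow> ('o \<Rightarrow> 'n) \<Rightarrow> bool" where
  "exact_functor C D F \<xi> \<longleftrightarrow> additive_functor C D F \<and>
     natural_iso C D (comp_fctr F (Shift C)) (comp_fctr (Shift D) F) \<xi> \<and>
     (\<forall>(f, g, h) \<in> Dist C. (fm F f, fm F g, \<xi> (Dom C f) \<cdot>\<^bsub>D\<^esub> fm F h) \<in> Dist D)"


section \<open>Monoidal triangulated categories\<close>

record ('o, 'm) mt_cat = "('o, 'm) tri_cat" +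
  TensObj :: "'o \<Rightarrow> 'o \<Rightarrow> 'o" (infixl "\<boxdot>\<index>" 80)
  TensMor :: "'m \<Rightarrow> 'm \<Rightarrow> 'm" (infixl "\<star>\<index>" 80)
  TUnit :: "'o"
  Assoc :: "'o \<Rightarrow> 'o \<Rightarrow> 'o \<Rightarrow> 'm"
  LUnit :: "'o \<Rightarrow> 'm"
  RUnit :: "'o \<Rightarrow> 'm"

definition tens_left :: "('o, 'm, 'z) mt_cat_scheme \<Rightarrow> 'o \<Rightarrow> ('o, 'm, 'o, 'm) fctr" where
  "tens_left K A = \<lparr>fo = (\<lambda>B. A \<boxdot>\<^bsub>K\<^esub> B), fm = (\<lambda>f. Ident K A \<star>\<^bsub>K\<^esub> f)\<rparr>"

definition tens_right :: "('o, 'm, 'z) mt_cat_scheme \<Rightarrow> 'o \<Rightarrow> ('o, 'm, 'o, 'm) fctr" where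
  "tens_right K A = \<lparr>fo = (\<lambda>B. B \<boxdot>\<^bsub>K\<^esub> A), fm = (\<lambda>f. f \<star>\<^bsub>K\<^esub> Ident K A)\<rparr>"

locale monoidal_triangulated_category =
  triangulated_category K for K :: "('o, 'm, 'z) mt_cat_scheme" (structure) +
  assumes tens_obj: "A \<in> Obj K \<Longrightarrow> B \<in> Obj K \<Longrightarrow> A \<boxdot> B \<in> Obj K"
    and tens_mor: "f \<in> Hom K A B \<Longrightarrow> g \<in> Hom K A' B' \<Longrightarrow> f \<star> g \<in> Hom K (A \<boxdot> A') (B \<boxdot> B')"
    and tens_ident: "A \<in> Obj K \<Longrightarrow> B \<in> Obj K \<Longrightarrow> Ident K A \<star> Ident K B = Ident K (A \<boxdot> B)"
    and tens_comp: "f \<in> Hom K X Y \<Longrightarrow> g \<in> Hom K Y Z \<Longrightarrow> f' \<in> Hom K X' Y' \<Longrightarrow> g' \<in> Hom K Y' Z'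
      \<Longrightarrow> (g \<cdot> f) \<star> (g' \<cdot> f') = (g \<star> g') \<cdot> (f \<star> f')"
    and unit_obj: "TUnit K \<in> Obj K"
    and assoc_iso: "A \<in> Obj K \<Longrightarrow> B \<in> Obj K \<Longrightarrow> C \<in> Obj K
      \<Longrightarrow> Assoc K A B C \<in> Hom K ((A \<boxdot> B) \<boxdot> C) (A \<boxdot> (B \<boxdot> C)) \<and> is_iso K (Assoc K A B C)"
    and assoc_natural: "f \<in> Hom K A A' \<Longrightarrow> g \<in> Hom K B B' \<Longrightarrow> h \<in> Hom K C C'
      \<Longrightarrow> Assoc K A' B' C' \<cdot> ((f \<star> g) \<star> h) = (f \<star> (g \<star> h)) \<cdot> Assoc K A B C"
    and lunit_natural: "natural_iso K K (tens_left K (TUnit K)) id_fctr (LUnit K)"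
    and runit_natural: "natural_iso K K (tens_right K (TUnit K)) id_fctr (RUnit K)"
    and pentagon: "A \<in> Obj K \<Longrightarrow> B \<in> Obj K \<Longrightarrow> C \<in> Obj K \<Longrightarrow> D \<in> Obj K
      \<Longrightarrow> Assoc K A B (C \<boxdot> D) \<cdot> Assoc K (A \<boxdot> B) C D =
          ((Ident K A \<star> Assoc K B C D) \<cdot> Assoc K A (B \<boxdot> C) D) \<cdot> (Assoc K A B C \<star> Ident K D)"
    and unit_triangle: "A \<in> Obj K \<Longrightarrow> B \<in> Obj K
      \<Longrightarrow> (Ident K A \<star> LUnit K B) \<cdot> Assoc K A (TUnit K) B = RUnit K A \<star> Ident K B"
    and tens_left_exact: "A \<in> Obj K \<Longrightarrow> \<exists>\<xi>. exact_functor K K (tens_left K A) \<xi>"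
    and tens_right_exact: "A \<in> Obj K \<Longrightarrow> \<exists>\<xi>. exact_functor K K (tens_right K A) \<xi>"

text \<open>
  A (strong) monoidal triangulated functor carries comparisons
  \<open>Fmult F A B : F A \<otimes> F B \<rightarrow> F (A \<otimes> B)\<close>, \<open>Funit F : 1 \<rightarrow> F 1\<close> and
  \<open>Fshift F A : F (\<Sigma> A) \<rightarrow> \<Sigma> (F A)\<close>.
\<close>

record ('o, 'm, 'p, 'n) mt_fctr = "('o, 'm, 'p, 'n) fctr" +
  Fmult :: "'o \<Rightarrow> 'o \<Rightarrow> 'n"
  Funit :: "'n"
  Fshift :: "'o \<Rightarrow> 'n"

definition monoidal_functor ::
    "('o, 'm, 'y) mt_cat_scheme \<Rightarrow> ('p, 'n, 'z) mt_cat_scheme \<Rightarrow> ('o, 'm, 'p, 'n, 'x) mt_fctr_scheme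
      \<Rightarrow> bool" where
  "monoidal_functor K L F \<longleftrightarrow> is_functor K L F \<and>
     (\<forall>A \<in> Obj K. \<forall>B \<in> Obj K.
        Fmult F A B \<in> Hom L (fo F A \<boxdot>\<^bsub>L\<^esub> fo F B) (fo F (A \<boxdot>\<^bsub>K\<^esub> B)) \<and> is_iso L (Fmult F A B)) \<and>
     (\<forall>f \<in> Mor K. \<forall>g \<in> Mor K.
        Fmult F (Cod K f) (Cod K g) \<cdot>\<^bsub>L\<^esub> (fm F f \<star>\<^bsub>L\<^esub> fm F g) =
        fm F (f \<star>\<^bsub>K\<^esub> g) \<cdot>\<^bsub>L\<^esub> Fmult F (Dom K f) (Dom K g)) \<and>
     Funit F \<in> Hom L (TUnit L) (fo F (TUnit K)) \<and> is_iso L (Funit F) \<and>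
     (\<forall>A \<in> Obj K. \<forall>B \<in> Obj K. \<forall>C \<in> Obj K.
        (Fmult F A (B \<boxdot>\<^bsub>K\<^esub> C) \<cdot>\<^bsub>L\<^esub> (Ident L (fo F A) \<star>\<^bsub>L\<^esub> Fmult F B C)) \<cdot>\<^bsub>L\<^esub>
          Assoc L (fo F A) (fo F B) (fo F C) =
        (fm F (Assoc K A B C) \<cdot>\<^bsub>L\<^esub> Fmult F (A \<boxdot>\<^bsub>K\<^esub> B) C) \<cdot>\<^bsub>L\<^esub>
          (Fmult F A B \<star>\<^bsub>L\<^esub> Ident L (fo F C))) \<and>
     (\<forall>A \<in> Obj K.
        (fm F (LUnit K A) \<cdot>\<^bsub>L\<^esub> Fmult F (TUnit K) A) \<cdot>\<^bsub>L\<^esub> (Funit F \<star>\<^bsub>L\<^esub> Ident L (fo F A)) =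
          LUnit L (fo F A) \<and>
        (fm F (RUnit K A) \<cdot>\<^bsub>L\<^esub> Fmult F A (TUnit K)) \<cdot>\<^bsub>L\<^esub> (Ident L (fo F A) \<star>\<^bsub>L\<^esub> Funit F) =
          RUnit L (fo F A))"

definition mt_functor ::
    "('o, 'm, 'y) mt_cat_scheme \<Rightarrow> ('p, 'n, 'z) mt_cat_scheme \<Rightarrow> ('o, 'm, 'p, 'n, 'x) mt_fctr_scheme
      \<Rightarrow> bool" where
  "mt_functor K L F \<longleftrightarrow> monoidal_functor K L F \<and> exact_functor K L F (Fshift F)"

definition mt_autoequivalence ::
    "('o, 'm, 'y) mt_cat_scheme \<Rightarrow> ('o, 'm, 'o, 'm, 'x) mt_fctr_scheme \<Rightarrow> bool" where
  "mt_autoequivalence K F \<longleftrightarrow> mt_functor K K F \<and> is_equivalence K K F"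

definition comp_mt_fctr ::
    "('q, 'l, 'z) mt_cat_scheme \<Rightarrow> ('p, 'n, 'q, 'l, 'y) mt_fctr_scheme
      \<Rightarrow> ('o, 'm, 'p, 'n, 'x) mt_fctr_scheme \<Rightarrow> ('o, 'm, 'q, 'l) mt_fctr" where
  "comp_mt_fctr M F G = \<lparr>fo = fo F \<circ> fo G, fm = fm F \<circ> fm G,
     Fmult = (\<lambda>A B. fm F (Fmult G A B) \<cdot>\<^bsub>M\<^esub> Fmult F (fo G A) (fo G B)),
     Funit = fm F (Funit G) \<cdot>\<^bsub>M\<^esub> Funit F,
     Fshift = (\<lambda>A. Fshift F (fo G A) \<cdot>\<^bsub>M\<^esub> fm F (Fshift G A))\<rparr>"

definition mt_natural_iso ::
    "('o, 'm, 'y) mt_cat_scheme \<Rightarrow> ('p, 'n, 'z) mt_cat_scheme \<Rightarrow> ('o, 'm, 'p, 'n, 'x) mt_fctr_scheme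
      \<Rightarrow> ('o, 'm, 'p, 'n, 'w) mt_fctr_scheme \<Rightarrow> ('o \<Rightarrow> 'n) \<Rightarrow> bool" where
  "mt_natural_iso K L F G \<tau> \<longleftrightarrow> natural_iso K L F G \<tau> \<and>
     (\<forall>A \<in> Obj K. \<forall>B \<in> Obj K.
        \<tau> (A \<boxdot>\<^bsub>K\<^esub> B) \<cdot>\<^bsub>L\<^esub> Fmult F A B = Fmult G A B \<cdot>\<^bsub>L\<^esub> (\<tau> A \<star>\<^bsub>L\<^esub> \<tau> B)) \<and>
     \<tau> (TUnit K) \<cdot>\<^bsub>L\<^esub> Funit F = Funit G \<and>
     (\<forall>A \<in> Obj K. Shm L (\<tau> A) \<cdot>\<^bsub>L\<^esub> Fshift F A = Fshift G A \<cdot>\<^bsub>L\<^esub> \<tau> (Sh K A))"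

locale mt_group_action =
  monoidal_triangulated_category K + group G
  for K :: "('o, 'm, 'z) mt_cat_scheme" and G :: "('g, 'w) monoid_scheme" +
  fixes T :: "'g \<Rightarrow> ('o, 'm, 'o, 'm) mt_fctr"
    and \<gamma> :: "'g \<Rightarrow> 'g \<Rightarrow> 'o \<Rightarrow> 'm"
  assumes autoequivalence: "g \<in> carrier G \<Longrightarrow> mt_autoequivalence K (T g)"
    and gamma_iso: "g \<in> carrier G \<Longrightarrow> h \<in> carrier G
      \<Longrightarrow> mt_natural_iso K K (comp_mt_fctr K (T g) (T h)) (T (g \<otimes>\<^bsub>G\<^esub> h)) (\<gamma> g h)"
    and gamma_cocycle: "g \<in> carrier G \<Longrightarrow> h \<in> carrier G \<Longrightarrow> k \<in> carrier G \<Longrightarrow> A \<in> Obj K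
      \<Longrightarrow> \<gamma> g (h \<otimes>\<^bsub>G\<^esub> k) A \<cdot>\<^bsub>K\<^esub> fm (T g) (\<gamma> h k A) =
          \<gamma> (g \<otimes>\<^bsub>G\<^esub> h) k A \<cdot>\<^bsub>K\<^esub> \<gamma> g h (fo (T k) A)"


section \<open>Thick ideals, primes, spectra\<close>

definition triangulated_subcategory :: "('o, 'm, 'z) tri_cat_scheme \<Rightarrow> 'o set \<Rightarrow> bool" where
  "triangulated_subcategory K S \<longleftrightarrow> S \<subseteq> Obj K \<and>
     (\<forall>A \<in> S. \<forall>B \<in> Obj K. isomorphic K A B \<longrightarrow> B \<in> S) \<and>
     (\<forall>Z. zero_object K Z \<longrightarrow> Z \<in> S) \<and>
     (\<forall>A \<in> Obj K. Sh K A \<in> S \<longleftrightarrow> A \<in> S) \<and>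
     (\<forall>(f, g, h) \<in> Dist K. Dom K f \<in> S \<and> Cod K f \<in> S \<longrightarrow> Cod K g \<in> S)"

definition thick_ideal :: "('o, 'm, 'z) mt_cat_scheme \<Rightarrow> 'o set \<Rightarrow> bool" where
  "thick_ideal K I \<longleftrightarrow> triangulated_subcategory K I \<and>
     (\<forall>A \<in> Obj K. \<forall>B \<in> Obj K. \<forall>S \<in> I. is_direct_sum K A B S \<longrightarrow> A \<in> I \<and> B \<in> I) \<and>
     (\<forall>A \<in> I. \<forall>B \<in> Obj K. A \<boxdot>\<^bsub>K\<^esub> B \<in> I \<and> B \<boxdot>\<^bsub>K\<^esub> A \<in> I)"

definition tens_set :: "('o, 'm, 'z) mt_cat_scheme \<Rightarrow> 'o set \<Rightarrow> 'o set \<Rightarrow> 'o set" where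
  "tens_set K I J = {A \<boxdot>\<^bsub>K\<^esub> B | A B. A \<in> I \<and> B \<in> J}"

definition prime_ideal :: "('o, 'm, 'z) mt_cat_scheme \<Rightarrow> 'o set \<Rightarrow> bool" where
  "prime_ideal K P \<longleftrightarrow> thick_ideal K P \<and> P \<noteq> Obj K \<and>
     (\<forall>I J. thick_ideal K I \<and> thick_ideal K J \<and> tens_set K I J \<subseteq> P \<longrightarrow> I \<subseteq> P \<or> J \<subseteq> P)"

definition G_ideal ::
    "('o, 'm, 'z) mt_cat_scheme \<Rightarrow> ('g, 'w) monoid_scheme \<Rightarrow> ('g \<Rightarrow> ('o, 'm, 'o, 'm) mt_fctr)
      \<Rightarrow> 'o set \<Rightarrow> bool" where
  "G_ideal K G T I \<longleftrightarrow> thick_ideal K I \<and> (\<forall>g \<in> carrier G. fo (T g) ` I \<subseteq> I)"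

definition G_prime ::
    "('o, 'm, 'z) mt_cat_scheme \<Rightarrow> ('g, 'w) monoid_scheme \<Rightarrow> ('g \<Rightarrow> ('o, 'm, 'o, 'm) mt_fctr)
      \<Rightarrow> 'o set \<Rightarrow> bool" where
  "G_prime K G T Q \<longleftrightarrow> G_ideal K G T Q \<and> Q \<noteq> Obj K \<and>
     (\<forall>I J. G_ideal K G T I \<and> G_ideal K G T J \<and> tens_set K I J \<subseteq> Q \<longrightarrow> I \<subseteq> Q \<or> J \<subseteq> Q)"

text \<open>
  The topology on a set \<open>X\<close> of ideals whose closed sets are the
  \<open>{P \<in> X. S \<inter> P = {}}\<close> for collections \<open>S\<close> of objects.
\<close>

definition ideal_topology :: "'o set \<Rightarrow> 'o set set \<Rightarrow> 'o set topology" where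
  "ideal_topology Ob X = topology (\<lambda>U. \<exists>S \<subseteq> Ob. U = X - {P \<in> X. S \<inter> P = {}})"

text \<open>
  These sets do form a topology as soon as all members of \<open>X\<close> share an object (the zero object)
  and finite unions of closed sets can be computed by direct sums of objects.
\<close>

lemma istopology_ideals:
  assumes zero: "\<exists>z \<in> Ob. \<forall>P \<in> X. z \<in> P"
    and sum: "\<And>a b. a \<in> Ob \<Longrightarrow> b \<in> Ob \<Longrightarrow> \<exists>s \<in> Ob. \<forall>P \<in> X. s \<in> P \<longleftrightarrow> a \<in> P \<and> b \<in> P"
  shows "istopology (\<lambda>U. \<exists>S \<subseteq> Ob. U = X - {P \<in> X. S \<inter> P = {}})"
    and "topspace (ideal_topology Ob X) = X"
    and "closedin (ideal_topology Ob X) Z \<longleftrightarrow> (\<exists>S \<subseteq> Ob. Z = {P \<in> X. S \<inter> P = {}})"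
proof -
  let ?L = "\<lambda>U. \<exists>S \<subseteq> Ob. U = X - {P \<in> X. S \<inter> P = {}}"
  show top: "istopology ?L"
    unfolding istopology_def
  proof (intro conjI allI impI)
    fix U V assume "?L U" "?L V"
    then obtain S R where S: "S \<subseteq> Ob" "U = X - {P \<in> X. S \<inter> P = {}}"
      and R: "R \<subseteq> Ob" "V = X - {P \<in> X. R \<inter> P = {}}" by blast
    define W where "W = {s \<in> Ob. \<exists>a \<in> S. \<exists>b \<in> R. \<forall>P \<in> X. s \<in> P \<longleftrightarrow> a \<in> P \<and> b \<in> P}"
    have "U \<inter> V = X - {P \<in> X. W \<inter> P = {}}"
    proof (intro subset_antisym subsetI)
      fix P assume "P \<in> U \<inter> V"
      then obtain a b where P: "P \<in> X" and a: "a \<in> S" "a \<in> P" and b: "b \<in> R" "b \<in> P"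
        using S R by blast
      obtain s where "s \<in> Ob" "\<forall>P \<in> X. s \<in> P \<longleftrightarrow> a \<in> P \<and> b \<in> P"
        using sum[of a b] a b S(1) R(1) by blast
      then have "s \<in> W \<inter> P" using a b P unfolding W_def by blast
      then show "P \<in> X - {P \<in> X. W \<inter> P = {}}" using P by blast
    next
      fix P assume "P \<in> X - {P \<in> X. W \<inter> P = {}}"
      then show "P \<in> U \<inter> V" unfolding W_def S(2) R(2) by blast
    qed
    moreover have "W \<subseteq> Ob" by (auto simp: W_def)
    ultimately show "?L (U \<inter> V)" by blast
  next
    fix \<U> assume "\<forall>U \<in> \<U>. ?L U"
    then have "\<forall>U \<in> \<U>. \<exists>S. S \<subseteq> Ob \<and> U = X - {P \<in> X. S \<inter> P = {}}" by blast
    from bchoice[OF this] obtain S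
      where S: "\<forall>U \<in> \<U>. S U \<subseteq> Ob \<and> U = X - {P \<in> X. S U \<inter> P = {}}" ..
    have "(\<Union>U \<in> \<U>. U) = (\<Union>U \<in> \<U>. X - {P \<in> X. S U \<inter> P = {}})"
      by (rule SUP_cong[OF refl]) (use S in blast)
    then have "\<Union>\<U> = (\<Union>U \<in> \<U>. X - {P \<in> X. S U \<inter> P = {}})" by simp
    also have "\<dots> = X - {P \<in> X. (\<Union>U \<in> \<U>. S U) \<inter> P = {}}" by blast
    finally have "\<Union>\<U> = X - {P \<in> X. (\<Union>U \<in> \<U>. S U) \<inter> P = {}}" .
    moreover have "(\<Union>U \<in> \<U>. S U) \<subseteq> Ob" using S by blast
    ultimately show "?L (\<Union>\<U>)" by blast
  qed
  then have op: "openin (ideal_topology Ob X) = ?L"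
    unfolding ideal_topology_def by (rule topology_inverse')
  have "?L X" using zero by (intro exI[of _ Ob]) blast
  moreover have "U \<subseteq> X" if "?L U" for U using that by blast
  ultimately show ts: "topspace (ideal_topology Ob X) = X"
    unfolding topspace_def op by (intro subset_antisym Sup_least Sup_upper) simp_all
  have key: "Z \<subseteq> X \<and> X - Z = X - {P \<in> X. S \<inter> P = {}} \<longleftrightarrow> Z = {P \<in> X. S \<inter> P = {}}" for S
    by blast
  show "closedin (ideal_topology Ob X) Z \<longleftrightarrow> (\<exists>S \<subseteq> Ob. Z = {P \<in> X. S \<inter> P = {}})"
    unfolding closedin_def ts op key[symmetric] by blast
qed

definition Spc :: "('o, 'm, 'z) mt_cat_scheme \<Rightarrow> 'o set topology" where
  "Spc K = ideal_topology (Obj K) {P. prime_ideal K P}"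

definition G_Spc ::
    "('o, 'm, 'z) mt_cat_scheme \<Rightarrow> ('g, 'w) monoid_scheme \<Rightarrow> ('g \<Rightarrow> ('o, 'm, 'o, 'm) mt_fctr)
      \<Rightarrow> 'o set topology" where
  "G_Spc K G T = ideal_topology (Obj K) {Q. G_prime K G T Q}"


section \<open>The crossed product\<close>

text \<open>
  An object of \<open>K \<rtimes> G\<close> is a formal finite direct sum, encoded as the list of its summands:
  \<open>[(A\<^sub>0, g\<^sub>0), \<dots>, (A\<^sub>n, g\<^sub>n)]\<close> stands for \<open>A\<^sub>0 \<boxtimes> g\<^sub>0 \<oplus> \<dots> \<oplus> A\<^sub>n \<boxtimes> g\<^sub>n\<close>, the empty list for \<open>0\<close>.
  A morphism \<open>(X, Y, M)\<close> from \<open>X\<close> to \<open>Y\<close> is a matrix \<open>M\<close> with entry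
  \<open>M (i, j)\<close> from the \<open>j\<close>-th summand of \<open>X\<close> to the \<open>i\<close>-th summand of \<open>Y\<close>.
  The group \<open>Hom (A \<boxtimes> g) (B \<boxtimes> h) = 0\<close> for \<open>g \<noteq> h\<close> is represented by \<open>{0 : A \<rightarrow> B}\<close>.
\<close>

type_synonym ('o, 'g) cp_obj = "('o \<times> 'g) list"
type_synonym ('o, 'm, 'g) cp_mor = "('o, 'g) cp_obj \<times> ('o, 'g) cp_obj \<times> (nat \<times> nat \<Rightarrow> 'm)"

definition box :: "'o \<Rightarrow> 'g \<Rightarrow> ('o, 'g) cp_obj" (infix "\<boxtimes>" 65) where
  "A \<boxtimes> g = [(A, g)]"

definition cp_entry_hom :: "('o, 'm, 'z) add_cat_scheme \<Rightarrow> 'o \<times> 'g \<Rightarrow> 'o \<times> 'g \<Rightarrow> 'm set" where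
  "cp_entry_hom K = (\<lambda>(A, g) (B, h). if g = h then Hom K A B else {ZeroMor K A B})"

definition cp_mat ::
    "('o, 'g) cp_obj \<Rightarrow> ('o, 'g) cp_obj \<Rightarrow> (nat \<Rightarrow> nat \<Rightarrow> 'm) \<Rightarrow> ('o, 'm, 'g) cp_mor" where
  "cp_mat X Y M = (X, Y, restrict (\<lambda>(i, j). M i j) ({..<length Y} \<times> {..<length X}))"

abbreviation cp_at :: "('o, 'm, 'g) cp_mor \<Rightarrow> nat \<Rightarrow> nat \<Rightarrow> 'm" where
  "cp_at f i j \<equiv> snd (snd f) (i, j)"

text \<open>The zero entry in position \<open>(i, j)\<close> of a matrix from \<open>X\<close> to \<open>Y\<close>.\<close>

abbreviation cp_zero ::
    "('o, 'm, 'z) add_cat_scheme \<Rightarrow> ('o, 'g) cp_obj \<Rightarrow> ('o, 'g) cp_obj \<Rightarrow> nat \<Rightarrow> nat \<Rightarrow> 'm" where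
  "cp_zero K X Y i j \<equiv> ZeroMor K (fst (X ! j)) (fst (Y ! i))"

text \<open>The direct sum of homogeneous morphisms \<open>f \<boxtimes> g\<close>, as a diagonal matrix.\<close>

definition cp_diag ::
    "('o, 'm, 'z) add_cat_scheme \<Rightarrow> ('m \<times> 'g) list \<Rightarrow> ('o, 'm, 'g) cp_mor" where
  "cp_diag K fs =
     (let X = map (\<lambda>(f, g). (Dom K f, g)) fs; Y = map (\<lambda>(f, g). (Cod K f, g)) fs
      in cp_mat X Y (\<lambda>i j. if i = j then fst (fs ! i) else cp_zero K X Y i j))"

definition cp_shift_cat ::
    "('o, 'm, 'z) shift_cat_scheme \<Rightarrow> ('g, 'w) monoid_scheme
      \<Rightarrow> (('o, 'g) cp_obj, ('o, 'm, 'g) cp_mor) shift_cat" where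
  "cp_shift_cat K G = \<lparr>
     Obj = lists (Obj K \<times> carrier G),
     Mor = {(X, Y, M). X \<in> lists (Obj K \<times> carrier G) \<and> Y \<in> lists (Obj K \<times> carrier G) \<and>
              M \<in> (\<Pi>\<^sub>E (i, j) \<in> {..<length Y} \<times> {..<length X}. cp_entry_hom K (X ! j) (Y ! i))},
     Dom = (\<lambda>(X, Y, M). X),
     Cod = (\<lambda>(X, Y, M). Y),
     Ident = (\<lambda>X. cp_diag K (map (\<lambda>(A, g). (Ident K A, g)) X)),
     Comp = (\<lambda>(Y', Z, N) (X, Y, M). cp_mat X Z (\<lambda>i j.
               finprod (hom_group K (fst (X ! j)) (fst (Z ! i)))
                 (\<lambda>k. N (i, k) \<cdot>\<^bsub>K\<^esub> M (k, j)) {..<length Y})),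
     ZeroMor = (\<lambda>X Y. cp_mat X Y (cp_zero K X Y)),
     AddMor = (\<lambda>(X, Y, M) (X', Y', N). cp_mat X Y (\<lambda>i j. AddMor K (M (i, j)) (N (i, j)))),
     Shift = (let sh = map (\<lambda>(A, g). (Sh K A, g)) in
       \<lparr>fo = sh, fm = (\<lambda>(X, Y, M). cp_mat (sh X) (sh Y) (\<lambda>i j. Shm K (M (i, j))))\<rparr>)\<rparr>"

text \<open>
  Distinguished triangles: those isomorphic to a finite direct sum of triangles \<open>t \<boxtimes> g\<close> with
  \<open>t\<close> distinguished in \<open>K\<close>.
\<close>

definition cp_dist ::
    "('o, 'm, 'z) tri_cat_scheme \<Rightarrow> ('g, 'w) monoid_scheme
      \<Rightarrow> (('o, 'm, 'g) cp_mor \<times> ('o, 'm, 'g) cp_mor \<times> ('o, 'm, 'g) cp_mor) set" where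
  "cp_dist K G = {t. \<exists>ts \<in> lists (Dist K \<times> carrier G).
     isomorphic_triangles (cp_shift_cat K G) t
       (cp_diag K (map (\<lambda>((f, g, h), x). (f, x)) ts),
        cp_diag K (map (\<lambda>((f, g, h), x). (g, x)) ts),
        cp_diag K (map (\<lambda>((f, g, h), x). (h, x)) ts))}"

definition cp_tens_obj ::
    "('o, 'm, 'z) mt_cat_scheme \<Rightarrow> ('g, 'w) monoid_scheme \<Rightarrow> ('g \<Rightarrow> ('o, 'm, 'o, 'm) mt_fctr)
      \<Rightarrow> ('o, 'g) cp_obj \<Rightarrow> ('o, 'g) cp_obj \<Rightarrow> ('o, 'g) cp_obj" where
  "cp_tens_obj K G T X Y = [(A \<boxdot>\<^bsub>K\<^esub> fo (T g) B, g \<otimes>\<^bsub>G\<^esub> h). (A, g) \<leftarrow> X, (B, h) \<leftarrow> Y]"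

text \<open>
  The summand of \<open>X \<otimes> Y\<close> coming from the \<open>k\<close>-th summand of \<open>X\<close> and the \<open>l\<close>-th summand of \<open>Y\<close> has
  index \<open>k * length Y + l\<close>. On homogeneous morphisms
  \<open>(a \<boxtimes> g) \<otimes> (b \<boxtimes> h) = (a \<otimes> T g b) \<boxtimes> (g h)\<close>.
\<close>

definition cp_tens_mor ::
    "('o, 'm, 'z) mt_cat_scheme \<Rightarrow> ('g, 'w) monoid_scheme \<Rightarrow> ('g \<Rightarrow> ('o, 'm, 'o, 'm) mt_fctr)
      \<Rightarrow> ('o, 'm, 'g) cp_mor \<Rightarrow> ('o, 'm, 'g) cp_mor \<Rightarrow> ('o, 'm, 'g) cp_mor" where
  "cp_tens_mor K G T = (\<lambda>(X, X', M) (Y, Y', N).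
     let Z = cp_tens_obj K G T X Y; Z' = cp_tens_obj K G T X' Y' in
     cp_mat Z Z' (\<lambda>p q.
       let i = p div length Y'; j = p mod length Y'; k = q div length Y; l = q mod length Y in
       if snd (X ! k) = snd (X' ! i) then M (i, k) \<star>\<^bsub>K\<^esub> fm (T (snd (X ! k))) (N (j, l))
       else cp_zero K Z Z' p q))"

text \<open>The isomorphism \<open>T\<^sub>e A \<rightarrow> A\<close> determined by \<open>\<gamma>\<^sub>e\<^sub>,\<^sub>e : T\<^sub>e T\<^sub>e \<rightarrow> T\<^sub>e\<close>, as \<open>T\<^sub>e\<close> is fully faithful.\<close>

definition T_one_iso ::
    "('o, 'm, 'z) mt_cat_scheme \<Rightarrow> ('g, 'w) monoid_scheme \<Rightarrow> ('g \<Rightarrow> ('o, 'm, 'o, 'm) mt_fctr)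
      \<Rightarrow> ('g \<Rightarrow> 'g \<Rightarrow> 'o \<Rightarrow> 'm) \<Rightarrow> 'o \<Rightarrow> 'm" where
  "T_one_iso K G T \<gamma> A = (THE u. u \<in> Hom K (fo (T \<one>\<^bsub>G\<^esub>) A) A \<and> fm (T \<one>\<^bsub>G\<^esub>) u = \<gamma> \<one>\<^bsub>G\<^esub> \<one>\<^bsub>G\<^esub> A)"

text \<open>
  The homogeneous component of the associator,
  \<open>(A \<otimes> T\<^sub>g B) \<otimes> T\<^sub>g\<^sub>h C \<rightarrow> A \<otimes> (T\<^sub>g B \<otimes> T\<^sub>g\<^sub>h C) \<rightarrow> A \<otimes> (T\<^sub>g B \<otimes> T\<^sub>g T\<^sub>h C) \<rightarrow> A \<otimes> T\<^sub>g (B \<otimes> T\<^sub>h C)\<close>.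
\<close>

definition cp_assoc ::
    "('o, 'm, 'z) mt_cat_scheme \<Rightarrow> ('g, 'w) monoid_scheme \<Rightarrow> ('g \<Rightarrow> ('o, 'm, 'o, 'm) mt_fctr)
      \<Rightarrow> ('g \<Rightarrow> 'g \<Rightarrow> 'o \<Rightarrow> 'm) \<Rightarrow> 'o \<Rightarrow> 'g \<Rightarrow> 'o \<Rightarrow> 'g \<Rightarrow> 'o \<Rightarrow> 'm" where
  "cp_assoc K G T \<gamma> A g B h C =
     ((Ident K A \<star>\<^bsub>K\<^esub> Fmult (T g) B (fo (T h) C)) \<cdot>\<^bsub>K\<^esub>
      (Ident K A \<star>\<^bsub>K\<^esub> (Ident K (fo (T g) B) \<star>\<^bsub>K\<^esub> inv_mor K (\<gamma> g h C)))) \<cdot>\<^bsub>K\<^esub>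
     Assoc K A (fo (T g) B) (fo (T (g \<otimes>\<^bsub>G\<^esub> h)) C)"

definition crossed_product ::
    "('o, 'm, 'z) mt_cat_scheme \<Rightarrow> ('g, 'w) monoid_scheme \<Rightarrow> ('g \<Rightarrow> ('o, 'm, 'o, 'm) mt_fctr)
      \<Rightarrow> ('g \<Rightarrow> 'g \<Rightarrow> 'o \<Rightarrow> 'm) \<Rightarrow> (('o, 'g) cp_obj, ('o, 'm, 'g) cp_mor) mt_cat" where
  "crossed_product K G T \<gamma> = (let S = cp_shift_cat K G in \<lparr>
     Obj = Obj S, Mor = Mor S, Dom = Dom S, Cod = Cod S, Ident = Ident S, Comp = Comp S,
     ZeroMor = ZeroMor S, AddMor = AddMor S, Shift = Shift S,
     Dist = cp_dist K G,
     TensObj = cp_tens_obj K G T,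
     TensMor = cp_tens_mor K G T,
     TUnit = TUnit K \<boxtimes> \<one>\<^bsub>G\<^esub>,
     Assoc = (\<lambda>X Y Z. cp_diag K
       [(cp_assoc K G T \<gamma> A g B h C, (g \<otimes>\<^bsub>G\<^esub> h) \<otimes>\<^bsub>G\<^esub> k). (A, g) \<leftarrow> X, (B, h) \<leftarrow> Y, (C, k) \<leftarrow> Z]),
     LUnit = (\<lambda>X. cp_diag K
       [(T_one_iso K G T \<gamma> A \<cdot>\<^bsub>K\<^esub> LUnit K (fo (T \<one>\<^bsub>G\<^esub>) A), g). (A, g) \<leftarrow> X]),
     RUnit = (\<lambda>X. cp_diag K
       [(RUnit K A \<cdot>\<^bsub>K\<^esub> (Ident K A \<star>\<^bsub>K\<^esub> inv_mor K (Funit (T g))), g). (A, g) \<leftarrow> X])\<rparr>)"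

text \<open>
  \<open>I \<rtimes> G\<close>, as a full isomorphism-closed subcategory: the objects isomorphic to a finite direct
  sum of objects \<open>A \<boxtimes> g\<close> with \<open>A \<in> I\<close>.
\<close>

definition ideal_crossed ::
    "('o, 'm, 'z) mt_cat_scheme \<Rightarrow> ('g, 'w) monoid_scheme \<Rightarrow> ('g \<Rightarrow> ('o, 'm, 'o, 'm) mt_fctr)
      \<Rightarrow> ('g \<Rightarrow> 'g \<Rightarrow> 'o \<Rightarrow> 'm) \<Rightarrow> 'o set \<Rightarrow> ('o, 'g) cp_obj set" where
  "ideal_crossed K G T \<gamma> I = {X \<in> Obj (crossed_product K G T \<gamma>).
     \<exists>Y \<in> lists (I \<times> carrier G). isomorphic (crossed_product K G T \<gamma>) X Y}"

definition ideal_restrict ::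
    "('o, 'm, 'z) mt_cat_scheme \<Rightarrow> ('g, 'w) monoid_scheme \<Rightarrow> ('o, 'g) cp_obj set \<Rightarrow> 'o set" where
  "ideal_restrict K G J = {A \<in> Obj K. A \<boxtimes> \<one>\<^bsub>G\<^esub> \<in> J}"

end

theory Submission
  imports Defs
begin

text \<open>
  The idea is that a thick ideal of \<open>K \<rtimes> G\<close> cannot see the grading. An object of \<open>K \<rtimes> G\<close> is a
  list of homogeneous summands \<open>A \<boxtimes> g\<close>. A thick ideal \<open>J\<close> contains a list iff it contains each
  summand (\<open>thick_mem_iff\<close>), and since tensoring with \<open>1 \<boxtimes> h\<close> shifts degrees, it contains
  \<open>A \<boxtimes> g\<close> iff it contains \<open>A \<boxtimes> e\<close> (\<open>box_regrade\<close>). Hence \<open>J\<close> consists of exactly the lists with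
  entries in \<open>(J \<inter> K) \<times> G\<close> (\<open>crossed_restrict\<close>).

  Conversely, \<open>I \<rtimes> G\<close> is by definition the closure under isomorphism of the set of lists with
  entries in \<open>I \<times> G\<close>, and that set is already closed (\<open>ideal_crossed_eq\<close>). The reason is that if
  a list \<open>X\<close> is a retract of a list \<open>Y\<close>, then a diagonal entry of the matrix identity expresses
  the identity of a summand \<open>A\<close> of \<open>X\<close> as a finite sum of composites \<open>A \<rightarrow> B\<^sub>k \<rightarrow> A\<close> through the
  summands of \<open>Y\<close> (\<open>retract_entries\<close>). So \<open>A\<close> is a retract of a direct sum of objects of \<open>I\<close>, and
  a retract in a triangulated category is a direct summand (\<open>split_mono_complement\<close>). This
  reduces every closure property of \<open>I \<rtimes> G\<close> to the one for \<open>I\<close>, the action entering only in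
  \<open>(B \<boxtimes> g) \<otimes> (A \<boxtimes> h) = (B \<otimes> T\<^sub>g A) \<boxtimes> gh\<close>, and \<open>(I \<rtimes> G) \<inter> K = I\<close> becomes evident.

  The two maps preserve inclusion, and \<open>I \<otimes> J \<subseteq> Q\<close> holds iff
  \<open>(I \<rtimes> G) \<otimes> (J \<rtimes> G) \<subseteq> Q \<rtimes> G\<close> (\<open>tens_set_crossed\<close>), which gives the statement on primes. Both maps
  are continuous: \<open>A \<in> J \<inter> K\<close> means \<open>A \<boxtimes> e \<in> J\<close>, and \<open>X \<in> Q \<rtimes> G\<close> means that the direct sum in \<open>K\<close>
  of all entries of \<open>X\<close> lies in \<open>Q\<close> (\<open>total_sum_exists\<close>).
\<close>

section \<open>Isomorphisms and additive categories\<close>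

lemma isomorphicI:
  assumes "f \<in> Hom C A B" "g \<in> Hom C B A" "g \<cdot>\<^bsub>C\<^esub> f = Ident C A" "f \<cdot>\<^bsub>C\<^esub> g = Ident C B"
  shows "isomorphic C A B"
proof -
  have "inverse_mors C f g" using assms unfolding inverse_mors_def by (simp add: Hom_def)
  then show ?thesis using assms(1) unfolding isomorphic_def is_iso_def by blast
qed

lemma is_isoE:
  assumes "is_iso C f" "f \<in> Hom C A B"
  obtains g where "g \<in> Hom C B A" "g \<cdot>\<^bsub>C\<^esub> f = Ident C A" "f \<cdot>\<^bsub>C\<^esub> g = Ident C B"
proof -
  obtain g where "inverse_mors C f g" using assms(1) unfolding is_iso_def by blast
  with assms(2) that[of g] show thesis by (simp add: inverse_mors_def Hom_def)
qed

lemma isomorphicE: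
  assumes "isomorphic C A B"
  obtains f g where "f \<in> Hom C A B" "g \<in> Hom C B A"
    "g \<cdot>\<^bsub>C\<^esub> f = Ident C A" "f \<cdot>\<^bsub>C\<^esub> g = Ident C B"
proof -
  obtain f where "f \<in> Hom C A B" "is_iso C f" using assms unfolding isomorphic_def by blast
  then show thesis using that is_isoE[of C f A B] by metis
qed

lemma isomorphic_sym: "isomorphic C A B \<Longrightarrow> isomorphic C B A"
  by (erule isomorphicE) (rule isomorphicI)

lemma functor_obj: "is_functor C D F \<Longrightarrow> A \<in> Obj C \<Longrightarrow> fo F A \<in> Obj D"
  by (simp add: is_functor_def)

lemma functor_ident: "is_functor C D F \<Longrightarrow> A \<in> Obj C \<Longrightarrow> fm F (Ident C A) = Ident D (fo F A)"
  by (simp add: is_functor_def)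

lemma functor_mor: "is_functor C D F \<Longrightarrow> f \<in> Hom C A B \<Longrightarrow> fm F f \<in> Hom D (fo F A) (fo F B)"
  by (auto simp add: is_functor_def Hom_def)

lemma functor_comp:
  "is_functor C D F \<Longrightarrow> f \<in> Hom C X Y \<Longrightarrow> g \<in> Hom C Y Z
    \<Longrightarrow> fm F (g \<cdot>\<^bsub>C\<^esub> f) = fm F g \<cdot>\<^bsub>D\<^esub> fm F f"
  by (auto simp add: is_functor_def Hom_def)

context category
begin

lemma Hom_Obj: "f \<in> Hom C A B \<Longrightarrow> A \<in> Obj C \<and> B \<in> Obj C"
  using dom_cod by (auto simp: Hom_def)

lemma comp_assoc4:
  assumes "f \<in> Hom C V W" "g \<in> Hom C W X" "h \<in> Hom C X Y" "k \<in> Hom C Y Z"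
  shows "(k \<cdot> h) \<cdot> (g \<cdot> f) = k \<cdot> ((h \<cdot> g) \<cdot> f)"
  using comp_assoc[OF comp[OF assms(1,2)] assms(3,4)] comp_assoc[OF assms(1-3)] by simp

lemma isomorphic_trans:
  assumes "isomorphic C X Y" "isomorphic C Y Z"
  shows "isomorphic C X Z"
proof -
  obtain f f' where f: "f \<in> Hom C X Y" "f' \<in> Hom C Y X" "f' \<cdot> f = Ident C X" "f \<cdot> f' = Ident C Y"
    using assms(1) by (rule isomorphicE)
  obtain g g' where g: "g \<in> Hom C Y Z" "g' \<in> Hom C Z Y" "g' \<cdot> g = Ident C Y" "g \<cdot> g' = Ident C Z"
    using assms(2) by (rule isomorphicE)
  show ?thesis
  proof (rule isomorphicI)
    show "g \<cdot> f \<in> Hom C X Z" "f' \<cdot> g' \<in> Hom C Z X"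
      by (rule comp[OF f(1) g(1)] comp[OF g(2) f(2)])+
    have "(f' \<cdot> g') \<cdot> (g \<cdot> f) = f' \<cdot> ((g' \<cdot> g) \<cdot> f)"
      using comp_assoc4[OF f(1) g(1,2) f(2)] .
    then show "(f' \<cdot> g') \<cdot> (g \<cdot> f) = Ident C X" using f g by (simp add: ident_comp)
    have "(g \<cdot> f) \<cdot> (f' \<cdot> g') = g \<cdot> ((f \<cdot> f') \<cdot> g')"
      using comp_assoc4[OF g(2) f(2,1) g(1)] .
    then show "(g \<cdot> f) \<cdot> (f' \<cdot> g') = Ident C Z" using f g by (simp add: ident_comp)
  qed
qed

lemma functor_isomorphic:
  assumes F: "is_functor C D F" and iso: "isomorphic C A B"
  shows "isomorphic D (fo F A) (fo F B)"
proof -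
  obtain f g where fg: "f \<in> Hom C A B" "g \<in> Hom C B A" "g \<cdot> f = Ident C A" "f \<cdot> g = Ident C B"
    using iso by (rule isomorphicE)
  show ?thesis
  proof (rule isomorphicI)
    show "fm F f \<in> Hom D (fo F A) (fo F B)" by (rule functor_mor[OF F fg(1)])
    show "fm F g \<in> Hom D (fo F B) (fo F A)" by (rule functor_mor[OF F fg(2)])
    show "fm F g \<cdot>\<^bsub>D\<^esub> fm F f = Ident D (fo F A)" "fm F f \<cdot>\<^bsub>D\<^esub> fm F g = Ident D (fo F B)"
      using functor_comp[OF F fg(1,2)] functor_comp[OF F fg(2,1)] functor_ident[OF F] fg(3,4)
        Hom_Obj[OF fg(1)] by simp_all
  qed
qed

end

lemma natural_iso_isomorphic:
  "natural_iso C D F G \<tau> \<Longrightarrow> A \<in> Obj C \<Longrightarrow> isomorphic D (fo F A) (fo G A)"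
  by (auto simp: natural_iso_def isomorphic_def)

context additive_category
begin

lemma zero_mor: "A \<in> Obj C \<Longrightarrow> B \<in> Obj C \<Longrightarrow> ZeroMor C A B \<in> Hom C A B"
  using group.is_monoid[OF comm_group.axioms(2)[OF hom_group], THEN monoid.one_closed]
  by (simp add: hom_group_def)

lemma add_mor:
  assumes "f \<in> Hom C A B" "g \<in> Hom C A B" shows "AddMor C f g \<in> Hom C A B"
proof -
  interpret H: comm_group "hom_group C A B" using hom_group Hom_Obj[OF assms(1)] by simp
  show ?thesis using H.m_closed[of f g] assms by (simp add: hom_group_def)
qed

lemma add_commute:
  assumes "f \<in> Hom C A B" "g \<in> Hom C A B" shows "AddMor C f g = AddMor C g f"
proof -
  interpret H: comm_group "hom_group C A B" using hom_group Hom_Obj[OF assms(1)] by simp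
  show ?thesis using H.m_comm[of f g] assms by (simp add: hom_group_def)
qed

lemma add_zero [simp]:
  assumes "f \<in> Hom C A B" shows "AddMor C f (ZeroMor C A B) = f" "AddMor C (ZeroMor C A B) f = f"
proof -
  interpret H: comm_group "hom_group C A B" using hom_group Hom_Obj[OF assms(1)] by simp
  show "AddMor C f (ZeroMor C A B) = f" "AddMor C (ZeroMor C A B) f = f"
    using H.r_one[of f] H.l_one[of f] assms by (simp_all add: hom_group_def)
qed

lemma add_cancel:
  assumes "f \<in> Hom C A B" "g \<in> Hom C A B" "AddMor C f g = f" shows "g = ZeroMor C A B"
proof -
  interpret H: comm_group "hom_group C A B" using hom_group Hom_Obj[OF assms(1)] by simp
  show ?thesis using H.l_cancel_one[of f g] assms by (simp add: hom_group_def)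
qed

lemma add_cancel_left:
  assumes "f \<in> Hom C A B" "g \<in> Hom C A B" "h \<in> Hom C A B" "AddMor C f g = AddMor C f h"
  shows "g = h"
proof -
  interpret H: comm_group "hom_group C A B" using hom_group Hom_Obj[OF assms(1)] by simp
  show ?thesis using H.Units_l_cancel[of f g h] H.Units_eq assms by (simp add: hom_group_def)
qed

lemma neg_mor:
  assumes "f \<in> Hom C A B"
  shows "NegMor C f \<in> Hom C A B" "AddMor C f (NegMor C f) = ZeroMor C A B"
proof -
  interpret H: comm_group "hom_group C A B" using hom_group Hom_Obj[OF assms(1)] by simp
  have "NegMor C f = inv\<^bsub>hom_group C A B\<^esub> f" using assms by (auto simp: NegMor_def Hom_def)
  then show "NegMor C f \<in> Hom C A B" "AddMor C f (NegMor C f) = ZeroMor C A B"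
    using H.inv_closed[of f] H.r_inv[of f] assms by (simp_all add: hom_group_def)
qed

text \<open>
  The difference \<open>g - f\<close>, given by the equation that it satisfies: biadditivity of composition
  applies to this equation directly.
\<close>

lemma difference_exists:
  assumes "f \<in> Hom C A B" "g \<in> Hom C A B"
  obtains e where "e \<in> Hom C A B" "AddMor C f e = g"
proof -
  interpret H: comm_group "hom_group C A B" using hom_group Hom_Obj[OF assms(1)] by simp
  let ?e = "inv\<^bsub>hom_group C A B\<^esub> f \<otimes>\<^bsub>hom_group C A B\<^esub> g"
  have c: "f \<in> carrier (hom_group C A B)" "g \<in> carrier (hom_group C A B)"
    using assms by (simp_all add: hom_group_def)
  have "?e \<in> carrier (hom_group C A B)" using c by simp
  moreover have "f \<otimes>\<^bsub>hom_group C A B\<^esub> ?e = g"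
    using c by (simp add: H.m_assoc[symmetric])
  ultimately show thesis using that[of ?e] by (simp add: hom_group_def)
qed

lemma comp_zero [simp]:
  assumes "g \<in> Hom C Y Z" "X \<in> Obj C" shows "g \<cdot> ZeroMor C X Y = ZeroMor C X Z"
proof -
  let ?z = "ZeroMor C X Y"
  have z: "?z \<in> Hom C X Y" using zero_mor[OF assms(2)] Hom_Obj[OF assms(1)] by simp
  have "g \<cdot> ?z = AddMor C (g \<cdot> ?z) (g \<cdot> ?z)" using add_comp[OF z z assms(1)] z by simp
  then show ?thesis using add_cancel[of "g \<cdot> ?z" X Z] comp[OF z assms(1)] by simp
qed

lemma zero_comp [simp]:
  assumes "f \<in> Hom C X Y" "Z \<in> Obj C" shows "ZeroMor C Y Z \<cdot> f = ZeroMor C X Z"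
proof -
  let ?z = "ZeroMor C Y Z"
  have z: "?z \<in> Hom C Y Z" using zero_mor[OF _ assms(2)] Hom_Obj[OF assms(1)] by simp
  have "?z \<cdot> f = AddMor C (?z \<cdot> f) (?z \<cdot> f)" using comp_add[OF assms(1) z z] z by simp
  then show ?thesis using add_cancel[of "?z \<cdot> f" X Z] comp[OF assms(1) z] by simp
qed

lemma zero_object_iff: "zero_object C Z \<longleftrightarrow> Z \<in> Obj C \<and> Ident C Z = ZeroMor C Z Z"
proof
  assume "zero_object C Z"
  then show "Z \<in> Obj C \<and> Ident C Z = ZeroMor C Z Z"
    unfolding zero_object_def using ident[of Z] zero_mor[of Z Z] by metis
next
  assume Z: "Z \<in> Obj C \<and> Ident C Z = ZeroMor C Z Z"
  show "zero_object C Z" unfolding zero_object_def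
  proof (intro conjI ballI)
    fix A assume A: "A \<in> Obj C"
    have "f = ZeroMor C A Z" if "f \<in> Hom C A Z" for f
      using ident_comp[OF that] zero_comp[OF that] Z by simp
    then show "\<exists>!f. f \<in> Hom C A Z" using zero_mor A Z by blast
    have "f = ZeroMor C Z A" if "f \<in> Hom C Z A" for f
      using comp_ident[OF that] comp_zero[OF that] Z by simp
    then show "\<exists>!f. f \<in> Hom C Z A" using zero_mor A Z by blast
  qed (use Z in simp)
qed

lemma zero_object_mor:
  assumes "zero_object C Z"
  shows "f \<in> Hom C A Z \<Longrightarrow> f = ZeroMor C A Z" "f \<in> Hom C Z A \<Longrightarrow> f = ZeroMor C Z A"
proof -
  have Z: "Z \<in> Obj C" "Ident C Z = ZeroMor C Z Z" using assms zero_object_iff by auto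
  show "f \<in> Hom C A Z \<Longrightarrow> f = ZeroMor C A Z"
    using ident_comp[of f A Z] zero_comp[of f A Z Z] Z by simp
  show "f \<in> Hom C Z A \<Longrightarrow> f = ZeroMor C Z A"
    using comp_ident[of f Z A] comp_zero[of f Z A Z] Z by simp
qed

lemma additive_functor_zero:
  assumes F: "additive_functor C C F" and A: "A \<in> Obj C" and B: "B \<in> Obj C"
  shows "fm F (ZeroMor C A B) = ZeroMor C (fo F A) (fo F B)"
proof -
  let ?z = "ZeroMor C A B"
  have z: "?z \<in> Hom C A B" by (rule zero_mor[OF A B])
  have fz: "fm F ?z \<in> Hom C (fo F A) (fo F B)"
    using F unfolding additive_functor_def by (intro functor_mor[OF _ z]) simp
  have "fm F (AddMor C ?z ?z) = AddMor C (fm F ?z) (fm F ?z)"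
    using F A B z unfolding additive_functor_def by blast
  then have "AddMor C (fm F ?z) (fm F ?z) = fm F ?z" using z by simp
  then show ?thesis using add_cancel[OF fz fz] by simp
qed

end

section \<open>Retracts in triangulated categories\<close>

context triangulated_category
begin

lemma shift_functor: "is_functor C C (Shift C)"
  using shift_equivalence by (simp add: is_equivalence_def)

lemma shift_obj: "A \<in> Obj C \<Longrightarrow> Sh C A \<in> Obj C"
  by (rule functor_obj[OF shift_functor])

lemma shift_zero_object:
  assumes "zero_object C Z" shows "zero_object C (Sh C Z)"
proof -
  have "Z \<in> Obj C" "Ident C Z = ZeroMor C Z Z" using assms zero_object_iff by auto
  then show ?thesis using additive_functor_zero[OF shift_additive, of Z Z]
      functor_ident[OF shift_functor, of Z] shift_obj zero_object_iff by simp
qed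

lemma dist_homs:
  assumes "(f, g, h) \<in> Dist C"
  shows "f \<in> Hom C (Dom C f) (Cod C f)" "g \<in> Hom C (Cod C f) (Cod C g)"
    "h \<in> Hom C (Cod C g) (Sh C (Dom C f))"
  using dist_triangle[OF assms] by (auto simp: triangle_def Hom_def)

lemma dist_rotated: "(f, g, h) \<in> Dist C \<Longrightarrow> (g, h, NegMor C (Shm C f)) \<in> Dist C"
  using dist_rotate[OF dist_triangle] by simp

text \<open>
  This is the distinguished triangle of an identity, rotated backwards; its third morphism has to
  be recognised as a zero morphism, which holds because it starts at a zero object.
\<close>

lemma dist_zero_ident:
  assumes "W \<in> Obj C" "zero_object C Z"
  shows "(ZeroMor C Z W, Ident C W, ZeroMor C W (Sh C Z)) \<in> Dist C"
proof -
  have Z: "Z \<in> Obj C" using assms zero_object_iff by blast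
  have z: "ZeroMor C Z W \<in> Hom C Z W" by (rule zero_mor[OF Z assms(1)])
  have "NegMor C (Shm C (ZeroMor C Z W)) \<in> Hom C (Sh C Z) (Sh C W)"
    by (rule neg_mor(1)[OF functor_mor[OF shift_functor z]])
  then have "NegMor C (Shm C (ZeroMor C Z W)) = ZeroMor C (Sh C Z) (Sh C W)"
    by (rule zero_object_mor(2)[OF shift_zero_object[OF assms(2)]])
  then have "(Ident C W, ZeroMor C W (Sh C Z), NegMor C (Shm C (ZeroMor C Z W))) \<in> Dist C"
    using dist_ident[OF assms(1) shift_zero_object[OF assms(2)]] by simp
  moreover have "triangle C (ZeroMor C Z W, Ident C W, ZeroMor C W (Sh C Z))"
    using z ident[OF assms(1)] zero_mor[OF assms(1) shift_obj[OF Z]]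
    by (auto simp: triangle_def Hom_def)
  ultimately show ?thesis using dist_rotate by simp
qed

text \<open>
  Compare the triangle of the identity of the source of \<open>f\<close> with the given one: \<open>g \<cdot> f\<close> then factors
  through the third object of the former, which is zero.
\<close>

lemma dist_comp_zero:
  assumes t: "(f, g, h) \<in> Dist C"
  shows "g \<cdot> f = ZeroMor C (Dom C f) (Cod C g)"
proof -
  note d = dist_homs[OF t]
  define A where "A = Dom C f"
  have A: "A \<in> Obj C" and f: "f \<in> Hom C A (Cod C f)" using d(1) Hom_Obj[OF d(1)] by (simp_all add: A_def)
  obtain Z where Z: "zero_object C Z" using zero_object_exists by blast
  then have ZO: "Z \<in> Obj C" using zero_object_iff by blast
  have i: "Ident C A \<in> Hom C A A" and z: "ZeroMor C A Z \<in> Hom C A Z"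
    and z': "ZeroMor C Z (Sh C A) \<in> Hom C Z (Sh C A)"
    by (rule ident[OF A] zero_mor[OF A ZO] zero_mor[OF ZO shift_obj[OF A]])+
  have u: "Ident C A \<in> Hom C (Dom C (Ident C A)) (Dom C f)"
    using i by (auto simp: Hom_def A_def)
  have v: "f \<in> Hom C (Dom C (ZeroMor C A Z)) (Dom C g)"
    using f z d(2) by (auto simp: Hom_def)
  obtain w where w: "w \<in> Hom C (Dom C (ZeroMor C Z (Sh C A))) (Dom C h)"
      "w \<cdot> ZeroMor C A Z = g \<cdot> f"
    using dist_fill[OF dist_ident[OF A Z] t u v refl] by blast
  have "w \<in> Hom C Z (Cod C g)" using w(1) z' d(3) by (auto simp: Hom_def)
  then show ?thesis using w(2) A by (simp add: A_def)
qed

text \<open>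
  A morphism \<open>x\<close> that kills \<open>f\<close> gives a morphism to the triangle \<open>Z \<rightarrow> W = W \<rightarrow> \<Sigma> Z\<close> with \<open>Z\<close> zero, and
  its third component is the factorisation of \<open>x\<close> through \<open>g\<close>.
\<close>

lemma weak_cokernel:
  assumes t: "(f, g, h) \<in> Dist C" and x: "x \<in> Hom C (Cod C f) W"
    and xf: "x \<cdot> f = ZeroMor C (Dom C f) W"
  obtains y where "y \<in> Hom C (Cod C g) W" "y \<cdot> g = x"
proof -
  note d = dist_homs[OF t]
  define A where "A = Dom C f"
  have A: "A \<in> Obj C" using d(1) Hom_Obj[OF d(1)] by (simp_all add: A_def)
  have W: "W \<in> Obj C" using Hom_Obj[OF x] by simp
  obtain Z where Z: "zero_object C Z" using zero_object_exists by blast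
  then have ZO: "Z \<in> Obj C" using zero_object_iff by blast
  have z: "ZeroMor C Z W \<in> Hom C Z W" and i: "Ident C W \<in> Hom C W W"
    and z': "ZeroMor C W (Sh C Z) \<in> Hom C W (Sh C Z)" and u0: "ZeroMor C A Z \<in> Hom C A Z"
    by (rule ident[OF W] zero_mor[OF A ZO] zero_mor[OF ZO W] zero_mor[OF W shift_obj[OF ZO]])+
  have u: "ZeroMor C A Z \<in> Hom C (Dom C f) (Dom C (ZeroMor C Z W))"
    using u0 z by (auto simp: Hom_def A_def)
  have v: "x \<in> Hom C (Dom C g) (Dom C (Ident C W))"
    using x i d(2) by (auto simp: Hom_def)
  have e: "x \<cdot> f = ZeroMor C Z W \<cdot> ZeroMor C A Z" using xf u0 W A z by (simp add: A_def)
  obtain w where w: "w \<in> Hom C (Dom C h) (Dom C (ZeroMor C W (Sh C Z)))"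
      "w \<cdot> g = Ident C W \<cdot> x"
    using dist_fill[OF t dist_zero_ident[OF W Z] u v e] by blast
  have "w \<in> Hom C (Cod C g) W" using w(1) z' d(3) by (auto simp: Hom_def)
  then show ?thesis using that w(2) ident_comp[OF x] by simp
qed

text \<open>
  The complement of a retract is the cone \<open>D\<close> of \<open>i\<close>. As \<open>\<Sigma> i \<cdot> h = 0\<close> and \<open>\<Sigma> i\<close> is split mono, the
  connecting morphism \<open>h : D \<rightarrow> \<Sigma> A\<close> vanishes, so \<open>g\<close> is epi; and \<open>1 - i \<cdot> p\<close> kills \<open>i\<close>, hence factors
  through \<open>g\<close> by a morphism \<open>s\<close>, which is a section of \<open>g\<close>. The triangle is kept in the conclusion
  because it shows that a thick ideal is closed under direct sums.
\<close>

lemma split_mono_complement: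
  assumes i: "i \<in> Hom C A S" and p: "p \<in> Hom C S A" and pi: "p \<cdot> i = Ident C A"
  obtains D g h s where "(i, g, h) \<in> Dist C" "g \<in> Hom C S D" "s \<in> Hom C D S"
    "g \<cdot> s = Ident C D" "p \<cdot> s = ZeroMor C D A"
    "AddMor C (i \<cdot> p) (s \<cdot> g) = Ident C S" "g \<cdot> i = ZeroMor C A D"
proof -
  have Ob: "A \<in> Obj C" "S \<in> Obj C" using Hom_Obj[OF i] by simp_all
  have im: "i \<in> Mor C" "Dom C i = A" "Cod C i = S" using i by (auto simp: Hom_def)
  obtain g h where t: "(i, g, h) \<in> Dist C" using dist_cone im by blast
  define D where "D = Cod C g"
  have g: "g \<in> Hom C S D" and h: "h \<in> Hom C D (Sh C A)" using dist_homs[OF t] im by (auto simp: D_def)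
  have DO: "D \<in> Obj C" using Hom_Obj[OF g] by simp
  have gi: "g \<cdot> i = ZeroMor C A D" using dist_comp_zero[OF t] im by (simp add: D_def)
  have Si: "Shm C i \<in> Hom C (Sh C A) (Sh C S)" and Sp: "Shm C p \<in> Hom C (Sh C S) (Sh C A)"
    by (rule functor_mor[OF shift_functor i] functor_mor[OF shift_functor p])+
  have t2: "(h, NegMor C (Shm C i), NegMor C (Shm C g)) \<in> Dist C"
    using dist_rotated[OF dist_rotated[OF t]] .
  have N: "NegMor C (Shm C i) \<in> Hom C (Sh C A) (Sh C S)" by (rule neg_mor(1)[OF Si])
  have nh: "NegMor C (Shm C i) \<cdot> h = ZeroMor C D (Sh C S)"
    using dist_comp_zero[OF t2] h N by (auto simp: Hom_def)
  have "Shm C i \<cdot> h = AddMor C (Shm C i \<cdot> h) (NegMor C (Shm C i) \<cdot> h)"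
    using nh comp[OF h Si] by simp
  also have "\<dots> = AddMor C (Shm C i) (NegMor C (Shm C i)) \<cdot> h" using comp_add[OF h Si N] by simp
  also have "\<dots> = ZeroMor C D (Sh C S)" using neg_mor(2)[OF Si] h shift_obj[OF Ob(2)] by simp
  finally have ih: "Shm C i \<cdot> h = ZeroMor C D (Sh C S)" .
  have "h = (Shm C p \<cdot> Shm C i) \<cdot> h"
    using pi functor_comp[OF shift_functor i p] functor_ident[OF shift_functor Ob(1)] ident_comp[OF h]
    by simp
  also have "\<dots> = Shm C p \<cdot> (Shm C i \<cdot> h)" using comp_assoc[OF h Si Sp] .
  also have "\<dots> = ZeroMor C D (Sh C A)" using ih Sp DO by simp
  finally have h0: "h = ZeroMor C D (Sh C A)" .
  have epi: "x = ZeroMor C D W" if x: "x \<in> Hom C D W" and xg: "x \<cdot> g = ZeroMor C S W" for x W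
  proof -
    have x': "x \<in> Hom C (Cod C g) W" and "x \<cdot> g = ZeroMor C (Dom C g) W"
      using x xg g by (auto simp: Hom_def)
    from weak_cokernel[OF dist_rotated[OF t] this] obtain y
      where y: "y \<in> Hom C (Cod C h) W" "y \<cdot> h = x" .
    then have "y \<in> Hom C (Sh C A) W" using h by (simp add: Hom_def)
    then show ?thesis using y(2) h0 DO by simp
  qed
  have ip: "i \<cdot> p \<in> Hom C S S" by (rule comp[OF p i])
  \<comment> \<open>\<open>e\<close> is the idempotent \<open>1 - i \<cdot> p\<close> complementary to \<open>i \<cdot> p\<close>.\<close>
  obtain e where e: "e \<in> Hom C S S" "AddMor C (i \<cdot> p) e = Ident C S"
    using difference_exists[OF ip ident[OF Ob(2)]] .
  have "AddMor C i (e \<cdot> i) = AddMor C ((i \<cdot> p) \<cdot> i) (e \<cdot> i)"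
    using comp_assoc[OF i p i] pi comp_ident[OF i] by simp
  also have "\<dots> = i" using comp_add[OF i ip e(1)] e(2) ident_comp[OF i] by simp
  finally have ei: "e \<cdot> i = ZeroMor C A S" using add_cancel[OF i comp[OF i e(1)]] by simp
  have e': "e \<in> Hom C (Cod C i) S" "e \<cdot> i = ZeroMor C (Dom C i) S" using e ei im by simp_all
  obtain s where s: "s \<in> Hom C D S" "s \<cdot> g = e" using weak_cokernel[OF t e'] by (auto simp: D_def)
  have "AddMor C p (p \<cdot> e) = AddMor C (p \<cdot> (i \<cdot> p)) (p \<cdot> e)"
    using comp_assoc[OF p i p] pi ident_comp[OF p] by simp
  also have "\<dots> = p" using add_comp[OF ip e(1) p] e(2) comp_ident[OF p] by simp
  finally have pe: "p \<cdot> e = ZeroMor C S A" using add_cancel[OF p comp[OF e(1) p]] by simp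
  have ps: "p \<cdot> s = ZeroMor C D A"
    using epi[OF comp[OF s(1) p]] comp_assoc[OF g s(1) p] s(2) pe by simp
  have gip: "g \<cdot> (i \<cdot> p) = ZeroMor C S D"
    using comp_assoc[OF p i g] gi p DO by simp
  have "g \<cdot> e = AddMor C (g \<cdot> (i \<cdot> p)) (g \<cdot> e)" using gip comp[OF e(1) g] by simp
  also have "\<dots> = g" using add_comp[OF ip e(1) g] e(2) comp_ident[OF g] by simp
  finally have ge: "g \<cdot> e = g" .
  have gs: "g \<cdot> s \<in> Hom C D D" by (rule comp[OF s(1) g])
  \<comment> \<open>\<open>x = 1 - g \<cdot> s\<close> satisfies \<open>x \<cdot> g = 0\<close>, and \<open>g\<close> is epi.\<close>
  obtain x where x: "x \<in> Hom C D D" "AddMor C (g \<cdot> s) x = Ident C D"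
    using difference_exists[OF gs ident[OF DO]] .
  have "AddMor C g (x \<cdot> g) = AddMor C ((g \<cdot> s) \<cdot> g) (x \<cdot> g)"
    using comp_assoc[OF g s(1) g] s(2) ge by simp
  also have "\<dots> = g" using comp_add[OF g gs x(1)] x(2) ident_comp[OF g] by simp
  finally have "x \<cdot> g = ZeroMor C S D" using add_cancel[OF g comp[OF g x(1)]] by simp
  then have "x = ZeroMor C D D" using epi[OF x(1)] by simp
  then have "g \<cdot> s = Ident C D" using x(2) gs by simp
  with that t g s(1) ps gi e(2) s(2) show thesis by blast
qed

end

section \<open>Thick ideals of a monoidal triangulated category\<close>

lemma thick_idealD:
  assumes "thick_ideal K I"
  shows "I \<subseteq> Obj K"
    "\<And>A B. A \<in> I \<Longrightarrow> B \<in> Obj K \<Longrightarrow> isomorphic K A B \<Longrightarrow> B \<in> I"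
    "\<And>Z. zero_object K Z \<Longrightarrow> Z \<in> I"
    "\<And>A. A \<in> Obj K \<Longrightarrow> Sh K A \<in> I \<longleftrightarrow> A \<in> I"
    "\<And>f g h. (f, g, h) \<in> Dist K \<Longrightarrow> Dom K f \<in> I \<Longrightarrow> Cod K f \<in> I \<Longrightarrow> Cod K g \<in> I"
    "\<And>A B S. is_direct_sum K A B S \<Longrightarrow> A \<in> Obj K \<Longrightarrow> B \<in> Obj K \<Longrightarrow> S \<in> I \<Longrightarrow> A \<in> I \<and> B \<in> I"
    "\<And>A B. A \<in> I \<Longrightarrow> B \<in> Obj K \<Longrightarrow> A \<boxdot>\<^bsub>K\<^esub> B \<in> I"
    "\<And>A B. A \<in> I \<Longrightarrow> B \<in> Obj K \<Longrightarrow> B \<boxdot>\<^bsub>K\<^esub> A \<in> I"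
proof -
  note I = assms[unfolded thick_ideal_def triangulated_subcategory_def]
  show "I \<subseteq> Obj K" using I by (elim conjE)
  have iso: "\<forall>A \<in> I. \<forall>B \<in> Obj K. isomorphic K A B \<longrightarrow> B \<in> I"
    and zero: "\<forall>Z. zero_object K Z \<longrightarrow> Z \<in> I"
    and shift: "\<forall>A \<in> Obj K. Sh K A \<in> I \<longleftrightarrow> A \<in> I"
    and sum: "\<forall>A \<in> Obj K. \<forall>B \<in> Obj K. \<forall>S \<in> I. is_direct_sum K A B S \<longrightarrow> A \<in> I \<and> B \<in> I"
    and tens: "\<forall>A \<in> I. \<forall>B \<in> Obj K. A \<boxdot>\<^bsub>K\<^esub> B \<in> I \<and> B \<boxdot>\<^bsub>K\<^esub> A \<in> I"
    using I by - (elim conjE, assumption)+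
  show "\<And>A B. A \<in> I \<Longrightarrow> B \<in> Obj K \<Longrightarrow> isomorphic K A B \<Longrightarrow> B \<in> I"
    using iso by blast
  show "\<And>Z. zero_object K Z \<Longrightarrow> Z \<in> I" using zero by blast
  show "\<And>A. A \<in> Obj K \<Longrightarrow> Sh K A \<in> I \<longleftrightarrow> A \<in> I" using shift by blast
  show "\<And>A B S. is_direct_sum K A B S \<Longrightarrow> A \<in> Obj K \<Longrightarrow> B \<in> Obj K \<Longrightarrow> S \<in> I \<Longrightarrow> A \<in> I \<and> B \<in> I"
    using sum by blast
  show "\<And>A B. A \<in> I \<Longrightarrow> B \<in> Obj K \<Longrightarrow> A \<boxdot>\<^bsub>K\<^esub> B \<in> I"
    "\<And>A B. A \<in> I \<Longrightarrow> B \<in> Obj K \<Longrightarrow> B \<boxdot>\<^bsub>K\<^esub> A \<in> I"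
    using tens by blast+
  show "Cod K g \<in> I" if "(f, g, h) \<in> Dist K" "Dom K f \<in> I" "Cod K f \<in> I" for f g h
  proof -
    have "\<forall>(f, g, h) \<in> Dist K. Dom K f \<in> I \<and> Cod K f \<in> I \<longrightarrow> Cod K g \<in> I" using I by (elim conjE)
    from bspec[OF this that(1)] that show ?thesis by simp
  qed
qed

lemma thick_idealI:
  assumes "I \<subseteq> Obj K"
    "\<And>A B. A \<in> I \<Longrightarrow> B \<in> Obj K \<Longrightarrow> isomorphic K A B \<Longrightarrow> B \<in> I"
    "\<And>Z. zero_object K Z \<Longrightarrow> Z \<in> I"
    "\<And>A. A \<in> Obj K \<Longrightarrow> Sh K A \<in> I \<longleftrightarrow> A \<in> I"
    "\<And>f g h. (f, g, h) \<in> Dist K \<Longrightarrow> Dom K f \<in> I \<Longrightarrow> Cod K f \<in> I \<Longrightarrow> Cod K g \<in> I"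
    "\<And>A B S. is_direct_sum K A B S \<Longrightarrow> A \<in> Obj K \<Longrightarrow> B \<in> Obj K \<Longrightarrow> S \<in> I \<Longrightarrow> A \<in> I \<and> B \<in> I"
    "\<And>A B. A \<in> I \<Longrightarrow> B \<in> Obj K \<Longrightarrow> A \<boxdot>\<^bsub>K\<^esub> B \<in> I \<and> B \<boxdot>\<^bsub>K\<^esub> A \<in> I"
  shows "thick_ideal K I"
  unfolding thick_ideal_def triangulated_subcategory_def
proof (intro conjI ballI allI impI)
  fix t assume "t \<in> Dist K"
  moreover obtain f g h where "t = (f, g, h)" by (cases t) auto
  ultimately show "case t of (f, g, h) \<Rightarrow> Dom K f \<in> I \<and> Cod K f \<in> I \<longrightarrow> Cod K g \<in> I"
    using assms(5)[of f g h] by simp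
next
  fix A B S assume *: "A \<in> Obj K" "B \<in> Obj K" "S \<in> I" "is_direct_sum K A B S"
  show "A \<in> I" "B \<in> I" using assms(6)[OF *(4) *(1-3)] by simp_all
next
  fix A B assume *: "A \<in> I" "B \<in> Obj K"
  show "A \<boxdot>\<^bsub>K\<^esub> B \<in> I" "B \<boxdot>\<^bsub>K\<^esub> A \<in> I" using assms(7)[OF *] by simp_all
next
  fix A B assume *: "A \<in> I" "B \<in> Obj K" "isomorphic K A B"
  show "B \<in> I" using assms(2)[OF *] .
qed (use assms(1,3,4) in \<open>assumption | simp\<close>)+

context monoidal_triangulated_category
begin

lemma thick_retract:
  assumes I: "thick_ideal K I" and S: "S \<in> I"
    and i: "i \<in> Hom K A S" and p: "p \<in> Hom K S A" and pi: "p \<cdot> i = Ident K A"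
  shows "A \<in> I"
proof -
  obtain D g h s where D: "g \<in> Hom K S D" "s \<in> Hom K D S" "g \<cdot> s = Ident K D"
      "p \<cdot> s = ZeroMor K D A" "AddMor K (i \<cdot> p) (s \<cdot> g) = Ident K S" "g \<cdot> i = ZeroMor K A D"
    using split_mono_complement[OF i p pi] by (metis (no_types))
  have "is_direct_sum K A D S" unfolding is_direct_sum_def using i p pi D by blast
  then show ?thesis using thick_idealD(6)[OF I] S Hom_Obj[OF i] Hom_Obj[OF D(1)] by blast
qed

text \<open>
  The cone of the inclusion \<open>A \<rightarrow> S\<close> is isomorphic to \<open>B\<close>, since both are images of the same
  idempotent of \<open>S\<close>. Rotating the triangle twice exhibits \<open>\<Sigma> S\<close> as the cone of a morphism from
  this cone to \<open>\<Sigma> A\<close>.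
\<close>

lemma thick_direct_sum:
  assumes I: "thick_ideal K I" and A: "A \<in> I" and B: "B \<in> I" and sum: "is_direct_sum K A B S"
  shows "S \<in> I"
proof -
  obtain i1 i2 p1 p2 where i: "i1 \<in> Hom K A S" "i2 \<in> Hom K B S" and p: "p1 \<in> Hom K S A" "p2 \<in> Hom K S B"
    and e: "p1 \<cdot> i1 = Ident K A" "p2 \<cdot> i2 = Ident K B" "p1 \<cdot> i2 = ZeroMor K B A"
      "p2 \<cdot> i1 = ZeroMor K A B" "AddMor K (i1 \<cdot> p1) (i2 \<cdot> p2) = Ident K S"
    using sum unfolding is_direct_sum_def by blast
  obtain D g h s where t: "(i1, g, h) \<in> Dist K" and D: "g \<in> Hom K S D" "s \<in> Hom K D S"
      "g \<cdot> s = Ident K D" "p1 \<cdot> s = ZeroMor K D A" "AddMor K (i1 \<cdot> p1) (s \<cdot> g) = Ident K S"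
      "g \<cdot> i1 = ZeroMor K A D"
    using split_mono_complement[OF i(1) p(1) e(1)] .
  have Ob: "S \<in> Obj K" "A \<in> Obj K" "B \<in> Obj K" "D \<in> Obj K"
    using Hom_Obj[OF i(1)] Hom_Obj[OF i(2)] Hom_Obj[OF D(1)] by simp_all
  have sg: "s \<cdot> g = i2 \<cdot> p2"
    using add_cancel_left[OF comp[OF p(1) i(1)] comp[OF D(1,2)] comp[OF p(2) i(2)]] e(5) D(5) by simp
  have h: "h \<in> Hom K D (Sh K A)" using dist_homs[OF t] i(1) D(1) by (simp add: Hom_def)
  have "isomorphic K B D"
  proof (rule isomorphicI)
    show "g \<cdot> i2 \<in> Hom K B D" "p2 \<cdot> s \<in> Hom K D B" by (rule comp[OF i(2) D(1)] comp[OF D(2) p(2)])+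
    have "(p2 \<cdot> s) \<cdot> (g \<cdot> i2) = p2 \<cdot> ((s \<cdot> g) \<cdot> i2)"
      using comp_assoc4[OF i(2) D(1,2) p(2)] .
    also have "\<dots> = (p2 \<cdot> i2) \<cdot> (p2 \<cdot> i2)"
      using sg comp_assoc4[OF i(2) p(2) i(2) p(2)] by simp
    finally show "(p2 \<cdot> s) \<cdot> (g \<cdot> i2) = Ident K B" using e ident_comp[OF ident[OF Ob(3)]] by simp
    have "(g \<cdot> i2) \<cdot> (p2 \<cdot> s) = g \<cdot> ((i2 \<cdot> p2) \<cdot> s)"
      using comp_assoc4[OF D(2) p(2) i(2) D(1)] .
    also have "\<dots> = (g \<cdot> s) \<cdot> (g \<cdot> s)"
      using sg comp_assoc4[OF D(2,1,2,1)] by simp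
    finally show "(g \<cdot> i2) \<cdot> (p2 \<cdot> s) = Ident K D"
      using D(3) ident_comp[OF ident[OF Ob(4)]] by simp
  qed
  then have "D \<in> I" using thick_idealD(2)[OF I B] Ob by blast
  moreover have "Sh K A \<in> I" using thick_idealD(4)[OF I] A Ob by blast
  moreover have "Shm K i1 \<in> Hom K (Sh K A) (Sh K S)" using functor_mor[OF shift_functor i(1)] .
  then have N: "NegMor K (Shm K i1) \<in> Hom K (Sh K A) (Sh K S)" by (rule neg_mor(1))
  ultimately have "Sh K S \<in> I"
    using thick_idealD(5)[OF I dist_rotated[OF dist_rotated[OF t]]] h by (simp add: Hom_def)
  then show ?thesis using thick_idealD(4)[OF I] Ob by blast
qed

lemma thick_direct_sum_iff:
  assumes "thick_ideal K I" "is_direct_sum K A B S"  "A \<in> Obj K" "B \<in> Obj K"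
  shows "S \<in> I \<longleftrightarrow> A \<in> I \<and> B \<in> I"
  using thick_direct_sum[OF assms(1) _ _ assms(2)] thick_idealD(6)[OF assms] by blast

text \<open>
  The finite sum of composites through the \<open>B k\<close> is a single composite through their direct sum,
  which is built one summand at a time.
\<close>

lemma thick_sum_retract:
  fixes n :: nat
  assumes I: "thick_ideal K I" and A: "A \<in> Obj K"
    and B: "\<And>k. k < n \<Longrightarrow> B k \<in> I"
    and r: "\<And>k. k < n \<Longrightarrow> r k \<in> Hom K A (B k)" and q: "\<And>k. k < n \<Longrightarrow> q k \<in> Hom K (B k) A"
    and sum: "finprod (hom_group K A A) (\<lambda>k. q k \<cdot> r k) {..<n} = Ident K A"
  shows "A \<in> I"
proof -
  interpret H: comm_group "hom_group K A A" using hom_group A by blast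
  have "\<exists>S \<in> I. \<exists>i \<in> Hom K A S. \<exists>p \<in> Hom K S A.
      p \<cdot> i = finprod (hom_group K A A) (\<lambda>k. q k \<cdot> r k) {..<m}" if "m \<le> n" for m
    using that
  proof (induction m)
    case 0
    obtain Z where Z: "zero_object K Z" using zero_object_exists by blast
    then have ZO: "Z \<in> Obj K" by (simp add: zero_object_iff)
    have "ZeroMor K Z A \<cdot> ZeroMor K A Z = ZeroMor K A A"
      using zero_comp[OF zero_mor[OF A ZO] A] .
    then have "ZeroMor K Z A \<cdot> ZeroMor K A Z = finprod (hom_group K A A) (\<lambda>k. q k \<cdot> r k) {..<0}"
      unfolding lessThan_0 H.finprod_empty by (simp add: hom_group_def)
    then show ?case using zero_mor[OF A ZO] zero_mor[OF ZO A] thick_idealD(3)[OF I Z] by blast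
  next
    case (Suc m)
    then obtain S i p where S: "S \<in> I" and i: "i \<in> Hom K A S" and p: "p \<in> Hom K S A"
      and pi: "p \<cdot> i = finprod (hom_group K A A) (\<lambda>k. q k \<cdot> r k) {..<m}" by auto
    have m: "m < n" using Suc by simp
    have Ob: "S \<in> Obj K" "B m \<in> Obj K" using S B[OF m] thick_idealD(1)[OF I] by blast+
    obtain S' where "S' \<in> Obj K" and sum: "is_direct_sum K S (B m) S'"
      using direct_sum_exists[OF Ob] by blast
    obtain i1 i2 p1 p2 where ii: "i1 \<in> Hom K S S'" "i2 \<in> Hom K (B m) S'"
      and pp: "p1 \<in> Hom K S' S" "p2 \<in> Hom K S' (B m)"
      and e: "p1 \<cdot> i1 = Ident K S" "p2 \<cdot> i2 = Ident K (B m)" "p1 \<cdot> i2 = ZeroMor K (B m) S"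
        "p2 \<cdot> i1 = ZeroMor K S (B m)"
      using sum unfolding is_direct_sum_def by blast
    note rq = r[OF m] q[OF m]
    define j where "j = AddMor K (i1 \<cdot> i) (i2 \<cdot> r m)"
    define s where "s = AddMor K (p \<cdot> p1) (q m \<cdot> p2)"
    have h: "i1 \<cdot> i \<in> Hom K A S'" "i2 \<cdot> r m \<in> Hom K A S'" "p \<cdot> p1 \<in> Hom K S' A" "q m \<cdot> p2 \<in> Hom K S' A"
      by (rule comp[OF i ii(1)] comp[OF rq(1) ii(2)] comp[OF pp(1) p] comp[OF pp(2) rq(2)])+
    then have j: "j \<in> Hom K A S'" and s: "s \<in> Hom K S' A"
      unfolding j_def s_def by (simp_all add: add_mor)
    have "p1 \<cdot> j = AddMor K (p1 \<cdot> (i1 \<cdot> i)) (p1 \<cdot> (i2 \<cdot> r m))"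
      unfolding j_def by (rule add_comp[OF h(1,2) pp(1)])
    also have "\<dots> = AddMor K i (ZeroMor K A S)"
      using comp_assoc[OF i ii(1) pp(1)] comp_assoc[OF rq(1) ii(2) pp(1)] e ident_comp[OF i]
        zero_comp[OF rq(1) Ob(1)] by simp
    finally have p1j: "p1 \<cdot> j = i" using i by simp
    have "p2 \<cdot> j = AddMor K (p2 \<cdot> (i1 \<cdot> i)) (p2 \<cdot> (i2 \<cdot> r m))"
      unfolding j_def by (rule add_comp[OF h(1,2) pp(2)])
    also have "\<dots> = AddMor K (ZeroMor K A (B m)) (r m)"
      using comp_assoc[OF i ii(1) pp(2)] comp_assoc[OF rq(1) ii(2) pp(2)] e ident_comp[OF rq(1)]
        zero_comp[OF i Ob(2)] by simp
    finally have p2j: "p2 \<cdot> j = r m" using rq by simp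
    have "s \<cdot> j = AddMor K ((p \<cdot> p1) \<cdot> j) ((q m \<cdot> p2) \<cdot> j)"
      unfolding s_def by (rule comp_add[OF j h(3,4)])
    also have "\<dots> = AddMor K (p \<cdot> i) (q m \<cdot> r m)"
      using comp_assoc[OF j pp(1) p] comp_assoc[OF j pp(2) rq(2)] p1j p2j by simp
    also have "\<dots> = AddMor K (q m \<cdot> r m) (p \<cdot> i)"
      by (rule add_commute[OF comp[OF i p] comp[OF rq]])
    also have "\<dots> = finprod (hom_group K A A) (\<lambda>k. q k \<cdot> r k) {..<Suc m}"
    proof -
      have qr: "q k \<cdot> r k \<in> carrier (hom_group K A A)" if "k < n" for k
        using comp[OF r[OF that] q[OF that]] by (simp add: hom_group_def)
      have "finprod (hom_group K A A) (\<lambda>k. q k \<cdot> r k) (insert m {..<m}) =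
          (q m \<cdot> r m) \<otimes>\<^bsub>hom_group K A A\<^esub> finprod (hom_group K A A) (\<lambda>k. q k \<cdot> r k) {..<m}"
        by (rule H.finprod_insert) (use qr m in auto)
      then show ?thesis using pi by (simp add: lessThan_Suc hom_group_def)
    qed
    finally have "s \<cdot> j = finprod (hom_group K A A) (\<lambda>k. q k \<cdot> r k) {..<Suc m}" .
    then show ?case using j s thick_direct_sum[OF I S B[OF m] sum] by blast
  qed
  from this[of n] sum show ?thesis using thick_retract[OF I] by auto
qed

lemma tens_isomorphic:
  assumes "isomorphic K A A'" "isomorphic K B B'"
  shows "isomorphic K (A \<boxdot> B) (A' \<boxdot> B')"
proof -
  obtain f f' where f: "f \<in> Hom K A A'" "f' \<in> Hom K A' A" "f' \<cdot> f = Ident K A" "f \<cdot> f' = Ident K A'"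
    using assms(1) by (rule isomorphicE)
  obtain g g' where g: "g \<in> Hom K B B'" "g' \<in> Hom K B' B" "g' \<cdot> g = Ident K B" "g \<cdot> g' = Ident K B'"
    using assms(2) by (rule isomorphicE)
  have Ob: "A \<in> Obj K" "A' \<in> Obj K" "B \<in> Obj K" "B' \<in> Obj K" using Hom_Obj[OF f(1)] Hom_Obj[OF g(1)] by simp_all
  show ?thesis
  proof (rule isomorphicI)
    show "f \<star> g \<in> Hom K (A \<boxdot> B) (A' \<boxdot> B')" "f' \<star> g' \<in> Hom K (A' \<boxdot> B') (A \<boxdot> B)"
      by (rule tens_mor[OF f(1) g(1)] tens_mor[OF f(2) g(2)])+
    show "(f' \<star> g') \<cdot> (f \<star> g) = Ident K (A \<boxdot> B)"
      using tens_comp[OF f(1,2) g(1,2)] f g tens_ident Ob by simp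
    show "(f \<star> g) \<cdot> (f' \<star> g') = Ident K (A' \<boxdot> B')"
      using tens_comp[OF f(2,1) g(2,1)] f g tens_ident Ob by simp
  qed
qed

lemma isomorphic_refl: "A \<in> Obj K \<Longrightarrow> isomorphic K A A"
  using isomorphicI[of "Ident K A" K A A "Ident K A"] ident[of A] comp_ident[of "Ident K A"] by simp

lemma lunit_isomorphic: "A \<in> Obj K \<Longrightarrow> isomorphic K (TUnit K \<boxdot> A) A"
  using natural_iso_isomorphic[OF lunit_natural] by (simp add: tens_left_def id_fctr_def)

lemma runit_isomorphic: "A \<in> Obj K \<Longrightarrow> isomorphic K (A \<boxdot> TUnit K) A"
  using natural_iso_isomorphic[OF runit_natural] by (simp add: tens_right_def id_fctr_def)

end

section \<open>Matrices over the crossed product\<close>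

lemma mat_eqI:
  assumes "\<And>i j. i < length Y \<Longrightarrow> j < length X \<Longrightarrow> M i j = N i j"
  shows "cp_mat X Y M = cp_mat X Y N"
  unfolding cp_mat_def using assms by (auto simp: restrict_def fun_eq_iff)

lemma mat_at: "i < length Y \<Longrightarrow> j < length X \<Longrightarrow> cp_at (cp_mat X Y M) i j = M i j"
  by (simp add: cp_mat_def)

lemma isomorphic_triangles_shift_cat:
  "isomorphic_triangles (cp_shift_cat K G) = isomorphic_triangles (crossed_product K G T \<gamma>)"
  unfolding isomorphic_triangles_def triangle_def is_iso_def inverse_mors_def Hom_def
    crossed_product_def Let_def by simp

lemma dom_diag [simp]: "Dom (crossed_product K G T \<gamma>) (cp_diag K fs) = map (\<lambda>(f, g). (Dom K f, g)) fs"
  by (simp add: cp_diag_def crossed_product_def cp_shift_cat_def Let_def cp_mat_def)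

lemma cod_diag [simp]: "Cod (crossed_product K G T \<gamma>) (cp_diag K fs) = map (\<lambda>(f, g). (Cod K f, g)) fs"
  by (simp add: cp_diag_def crossed_product_def cp_shift_cat_def Let_def cp_mat_def)

lemma Obj_crossed: "Obj (crossed_product K G T \<gamma>) = lists (Obj K \<times> carrier G)"
  by (simp add: crossed_product_def cp_shift_cat_def Let_def)

lemma Sh_crossed: "Sh (crossed_product K G T \<gamma>) X = map (\<lambda>(A, g). (Sh K A, g)) X"
  by (simp add: crossed_product_def cp_shift_cat_def Let_def)

lemma tens_crossed: "TensObj (crossed_product K G T \<gamma>) X Y = cp_tens_obj K G T X Y"
  by (simp add: crossed_product_def Let_def)

lemma set_tens_obj:
  "set (cp_tens_obj K G T X Y) =
    {(A \<boxdot>\<^bsub>K\<^esub> fo (T g) B, g \<otimes>\<^bsub>G\<^esub> h) | A g B h. (A, g) \<in> set X \<and> (B, h) \<in> set Y}"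
  by (fastforce simp: cp_tens_obj_def)

lemma tens_obj_box:
  "cp_tens_obj K G T [(A, g)] [(B, h)] = [(A \<boxdot>\<^bsub>K\<^esub> fo (T g) B, g \<otimes>\<^bsub>G\<^esub> h)]"
  by (simp add: cp_tens_obj_def)

lemma diag_box: "cp_diag K [(f, g)] = cp_mat [(Dom K f, g)] [(Cod K f, g)] (\<lambda>_ _. f)"
  by (simp add: cp_diag_def Let_def) (rule mat_eqI, simp)

context mt_group_action
begin

abbreviation KG where "KG \<equiv> crossed_product K G T \<gamma>"

lemma nth_Obj:
  assumes "X \<in> Obj KG" "i < length X"
  shows "fst (X ! i) \<in> Obj K" "snd (X ! i) \<in> carrier G"
proof -
  have "X ! i \<in> Obj K \<times> carrier G"
    using assms nth_mem[of i X] by (auto simp: Obj_crossed lists_eq_set)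
  then show "fst (X ! i) \<in> Obj K" "snd (X ! i) \<in> carrier G" by auto
qed

lemma entry_hom_Hom:
  assumes "fst a \<in> Obj K" "fst b \<in> Obj K" "m \<in> cp_entry_hom K a b"
  shows "m \<in> Hom K (fst a) (fst b)"
  using assms zero_mor by (auto simp: cp_entry_hom_def split: prod.splits if_splits)

lemma zero_entry:
  assumes "fst a \<in> Obj K" "fst b \<in> Obj K"
  shows "ZeroMor K (fst a) (fst b) \<in> cp_entry_hom K a b"
  using assms zero_mor by (auto simp: cp_entry_hom_def split: prod.splits)

lemma mat_Hom:
  assumes "X \<in> Obj KG" "Y \<in> Obj KG"
    and "\<And>i j. i < length Y \<Longrightarrow> j < length X \<Longrightarrow> M i j \<in> cp_entry_hom K (X ! j) (Y ! i)"
  shows "cp_mat X Y M \<in> Hom KG X Y"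
  using assms unfolding Hom_def crossed_product_def cp_shift_cat_def Let_def cp_mat_def
  by (auto simp: PiE_def)

text \<open>
  The grading of the entries is forgotten here: an entry between summands of different degree is
  the zero morphism of \<open>K\<close>, and membership in \<open>Hom K\<close> is what the later computations use.
\<close>

lemma HomD:
  assumes "f \<in> Hom KG X Y"
  shows "X \<in> Obj KG" "Y \<in> Obj KG" "f = cp_mat X Y (cp_at f)"
    "\<And>i j. i < length Y \<Longrightarrow> j < length X \<Longrightarrow> cp_at f i j \<in> Hom K (fst (X ! j)) (fst (Y ! i))"
proof -
  obtain M where f: "f = (X, Y, M)" and X: "X \<in> Obj KG" and Y: "Y \<in> Obj KG"
    and M: "M \<in> (\<Pi>\<^sub>E (i, j) \<in> {..<length Y} \<times> {..<length X}. cp_entry_hom K (X ! j) (Y ! i))"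
    using assms unfolding Hom_def crossed_product_def cp_shift_cat_def Let_def by auto
  show "X \<in> Obj KG" "Y \<in> Obj KG" using X Y .
  show "cp_at f i j \<in> Hom K (fst (X ! j)) (fst (Y ! i))" if "i < length Y" "j < length X" for i j
    using PiE_mem[OF M, of "(i, j)"] that entry_hom_Hom nth_Obj(1)[OF X that(2)] nth_Obj(1)[OF Y that(1)]
    by (simp add: f)
  have "restrict M ({..<length Y} \<times> {..<length X}) = M" by (rule PiE_restrict[OF M])
  then show "f = cp_mat X Y (cp_at f)" unfolding f cp_mat_def by simp
qed

lemma finprod_hom_single:
  fixes n :: nat
  assumes "k < n" "t k \<in> Hom K A B" "\<And>l. l < n \<Longrightarrow> l \<noteq> k \<Longrightarrow> t l = ZeroMor K A B"
  shows "finprod (hom_group K A B) t {..<n} = t k"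
proof -
  have Ob: "A \<in> Obj K" "B \<in> Obj K" using Hom_Obj[OF assms(2)] by simp_all
  interpret H: comm_group "hom_group K A B" using hom_group Ob by simp
  have c: "carrier (hom_group K A B) = Hom K A B" "one (hom_group K A B) = ZeroMor K A B"
    by (simp_all add: hom_group_def)
  have "t l \<in> Hom K A B" if "l < n" for l
    using assms that zero_mor[OF Ob] by (cases "l = k") simp_all
  then have "finprod (hom_group K A B) t {..<n} = finprod (hom_group K A B) t {k}"
    by (intro H.finprod_mono_neutral_cong_right) (use assms c in auto)
  also have "\<dots> = t k" using H.finprod_insert[of "{}" k t] assms(2) c H.r_one[of "t k"] by simp
  finally show ?thesis .
qed

lemma finprod_hom_zero:
  fixes n :: nat
  assumes "A \<in> Obj K" "B \<in> Obj K" "\<And>l. l < n \<Longrightarrow> t l = ZeroMor K A B"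
  shows "finprod (hom_group K A B) t {..<n} = ZeroMor K A B"
proof -
  interpret H: comm_group "hom_group K A B" using hom_group assms by simp
  have "finprod (hom_group K A B) t {..<n} = one (hom_group K A B)"
    using assms(3) by (intro H.finprod_one_eqI) (simp add: hom_group_def)
  then show ?thesis by (simp add: hom_group_def)
qed

lemma mat_comp:
  assumes X: "X \<in> Obj KG" and Z: "Z \<in> Obj KG"
    and M: "\<And>k j. k < length Y \<Longrightarrow> j < length X \<Longrightarrow> M k j \<in> Hom K (fst (X ! j)) (fst (Y ! k))"
    and N: "\<And>i k. i < length Z \<Longrightarrow> k < length Y \<Longrightarrow> N i k \<in> Hom K (fst (Y ! k)) (fst (Z ! i))"
  shows "cp_mat Y Z N \<cdot>\<^bsub>KG\<^esub> cp_mat X Y M =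
    cp_mat X Z (\<lambda>i j. finprod (hom_group K (fst (X ! j)) (fst (Z ! i)))
      (\<lambda>k. N i k \<cdot>\<^bsub>K\<^esub> M k j) {..<length Y})"
proof -
  have "cp_mat Y Z N \<cdot>\<^bsub>KG\<^esub> cp_mat X Y M =
    cp_mat X Z (\<lambda>i j. finprod (hom_group K (fst (X ! j)) (fst (Z ! i)))
      (\<lambda>k. cp_at (cp_mat Y Z N) i k \<cdot>\<^bsub>K\<^esub> cp_at (cp_mat X Y M) k j) {..<length Y})"
    by (simp add: crossed_product_def cp_shift_cat_def Let_def cp_mat_def)
  also have "\<dots> = cp_mat X Z (\<lambda>i j. finprod (hom_group K (fst (X ! j)) (fst (Z ! i)))
      (\<lambda>k. N i k \<cdot>\<^bsub>K\<^esub> M k j) {..<length Y})"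
  proof (rule mat_eqI)
    fix i j assume ij: "i < length Z" "j < length X"
    interpret H: comm_group "hom_group K (fst (X ! j)) (fst (Z ! i))"
      by (rule hom_group[OF nth_Obj(1)[OF X ij(2)] nth_Obj(1)[OF Z ij(1)]])
    show "finprod (hom_group K (fst (X ! j)) (fst (Z ! i)))
        (\<lambda>k. cp_at (cp_mat Y Z N) i k \<cdot>\<^bsub>K\<^esub> cp_at (cp_mat X Y M) k j) {..<length Y} =
      finprod (hom_group K (fst (X ! j)) (fst (Z ! i))) (\<lambda>k. N i k \<cdot>\<^bsub>K\<^esub> M k j) {..<length Y}"
    proof (rule H.finprod_cong'[OF refl])
      show "(\<lambda>k. N i k \<cdot>\<^bsub>K\<^esub> M k j) \<in> {..<length Y} \<rightarrow> carrier (hom_group K (fst (X ! j)) (fst (Z ! i)))"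
        using comp[OF M N] ij by (simp add: hom_group_def)
    qed (use ij in \<open>simp add: mat_at\<close>)
  qed
  finally show ?thesis .
qed

text \<open>
  The inclusions, projections and isomorphisms of lists that are needed below have only identities
  and zeros as entries; \<open>R j i\<close> says that summand \<open>j\<close> of the source is mapped identically to summand
  \<open>i\<close> of the target. For functional relations composition of matrices becomes composition of relations, and
  for disjoint relations addition becomes union, so that equations between morphisms turn into
  statements about indices.
\<close>

definition match_mat where
  "match_mat X Y R = cp_mat X Y (\<lambda>i j. if R j i then Ident K (fst (X ! j)) else cp_zero K X Y i j)"

lemma ident_eq_match:
  assumes "X \<in> Obj KG"
  shows "Ident KG X = match_mat X X (=)"
proof -
  let ?fs = "map (\<lambda>(A, g). (Ident K A, g)) X"
  have "Dom K (Ident K A) = A \<and> Cod K (Ident K A) = A" if "(A, g) \<in> set X" for A g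
  proof -
    have "A \<in> Obj K" using assms that by (auto simp: Obj_crossed lists_eq_set)
    then show ?thesis using ident[of A] by (simp add: Hom_def)
  qed
  then have d: "map (\<lambda>(f, g). (Dom K f, g)) ?fs = X" "map (\<lambda>(f, g). (Cod K f, g)) ?fs = X"
    unfolding map_map by (auto intro: map_idI)
  have "Ident KG X = cp_diag K ?fs"
    by (simp add: crossed_product_def cp_shift_cat_def Let_def)
  also have "\<dots> = match_mat X X (=)"
    unfolding cp_diag_def d Let_def match_mat_def
    by (rule mat_eqI) (auto simp: case_prod_beta)
  finally show ?thesis .
qed

lemma zero_eq_match: "ZeroMor KG X Y = match_mat X Y (\<lambda>_ _. False)"
  by (simp add: crossed_product_def cp_shift_cat_def Let_def match_mat_def)

lemma match_Hom:
  assumes X: "X \<in> Obj KG" and Y: "Y \<in> Obj KG"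
    and R: "\<And>i j. j < length X \<Longrightarrow> i < length Y \<Longrightarrow> R j i \<Longrightarrow> X ! j = Y ! i"
  shows "match_mat X Y R \<in> Hom KG X Y"
  unfolding match_mat_def
proof (rule mat_Hom[OF X Y])
  fix i j assume ij: "i < length Y" "j < length X"
  note Ob = nth_Obj(1)[OF X ij(2)] nth_Obj(1)[OF Y ij(1)]
  show "(if R j i then Ident K (fst (X ! j)) else cp_zero K X Y i j) \<in> cp_entry_hom K (X ! j) (Y ! i)"
  proof (cases "R j i")
    case True
    then have "X ! j = Y ! i" using R ij by simp
    then show ?thesis using True ident[OF Ob(1)] by (auto simp: cp_entry_hom_def split: prod.splits)
  qed (use zero_entry[OF Ob] in simp)
qed

text \<open>
  Uniqueness of the intermediate index \<open>k\<close> leaves at most one nonzero term in each sum of the matrix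
  product.
\<close>

lemma match_comp:
  assumes X: "X \<in> Obj KG" and Y: "Y \<in> Obj KG" and Z: "Z \<in> Obj KG"
    and R: "\<And>i j. j < length X \<Longrightarrow> i < length Y \<Longrightarrow> R j i \<Longrightarrow> X ! j = Y ! i"
    and S: "\<And>i j. j < length Y \<Longrightarrow> i < length Z \<Longrightarrow> S j i \<Longrightarrow> Y ! j = Z ! i"
    and uniq: "\<And>j k l. R j k \<Longrightarrow> R j l \<Longrightarrow> k = l"
  shows "match_mat Y Z S \<cdot>\<^bsub>KG\<^esub> match_mat X Y R = match_mat X Z (\<lambda>j i. \<exists>k < length Y. R j k \<and> S k i)"
proof -
  let ?M = "\<lambda>i j. if R j i then Ident K (fst (X ! j)) else cp_zero K X Y i j"
  let ?N = "\<lambda>i j. if S j i then Ident K (fst (Y ! j)) else cp_zero K Y Z i j"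
  have M: "?M k j \<in> Hom K (fst (X ! j)) (fst (Y ! k))" if "k < length Y" "j < length X" for k j
    using that ident[OF nth_Obj(1)[OF X that(2)]] R[OF that(2,1)]
      zero_mor[OF nth_Obj(1)[OF X that(2)] nth_Obj(1)[OF Y that(1)]] by auto
  have N: "?N i k \<in> Hom K (fst (Y ! k)) (fst (Z ! i))" if "i < length Z" "k < length Y" for i k
    using that ident[OF nth_Obj(1)[OF Y that(2)]] S[OF that(2,1)]
      zero_mor[OF nth_Obj(1)[OF Y that(2)] nth_Obj(1)[OF Z that(1)]] by auto
  have "match_mat Y Z S \<cdot>\<^bsub>KG\<^esub> match_mat X Y R =
    cp_mat X Z (\<lambda>i j. finprod (hom_group K (fst (X ! j)) (fst (Z ! i)))
      (\<lambda>k. ?N i k \<cdot>\<^bsub>K\<^esub> ?M k j) {..<length Y})"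
    unfolding match_mat_def by (rule mat_comp[OF X Z]) (rule M N; assumption)+
  also have "\<dots> = match_mat X Z (\<lambda>j i. \<exists>k < length Y. R j k \<and> S k i)"
    unfolding match_mat_def
  proof (rule mat_eqI)
    fix i j assume i: "i < length Z" and j: "j < length X"
    let ?A = "fst (X ! j)" and ?B = "fst (Z ! i)"
    note A = nth_Obj(1)[OF X j] and B = nth_Obj(1)[OF Z i]
    have zero: "?N i k \<cdot>\<^bsub>K\<^esub> ?M k j = ZeroMor K ?A ?B" if "k < length Y" "\<not> (R j k \<and> S k i)" for k
    proof (cases "R j k")
      case True
      then show ?thesis using zero_comp[OF M[OF that(1) j] B] that(2) by simp
    next
      case False
      then show ?thesis using comp_zero[OF N[OF i that(1)] A] by simp
    qed
    show "finprod (hom_group K ?A ?B) (\<lambda>k. ?N i k \<cdot>\<^bsub>K\<^esub> ?M k j) {..<length Y} =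
        (if \<exists>k < length Y. R j k \<and> S k i then Ident K ?A else cp_zero K X Z i j)"
    proof (cases "\<exists>k < length Y. R j k \<and> S k i")
      case True
      then obtain k where k: "k < length Y" "R j k" "S k i" by blast
      have "X ! j = Y ! k" "Y ! k = Z ! i" using R[OF j k(1,2)] S[OF k(1) i k(3)] by simp_all
      then have e: "?N i k \<cdot>\<^bsub>K\<^esub> ?M k j = Ident K ?A" "?A = ?B"
        using k comp_ident[OF ident[OF A]] by simp_all
      have "finprod (hom_group K ?A ?B) (\<lambda>k. ?N i k \<cdot>\<^bsub>K\<^esub> ?M k j) {..<length Y} = ?N i k \<cdot>\<^bsub>K\<^esub> ?M k j"
      proof (rule finprod_hom_single[OF k(1)])
        show "?N i k \<cdot>\<^bsub>K\<^esub> ?M k j \<in> Hom K ?A ?B" by (rule comp[OF M[OF k(1) j] N[OF i k(1)]])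
        show "?N i l \<cdot>\<^bsub>K\<^esub> ?M l j = ZeroMor K ?A ?B" if "l < length Y" "l \<noteq> k" for l
          by (rule zero[OF that(1)]) (use that uniq[OF k(2)] in blast)
      qed
      then show ?thesis using True e by simp
    next
      case False
      then have "finprod (hom_group K ?A ?B) (\<lambda>k. ?N i k \<cdot>\<^bsub>K\<^esub> ?M k j) {..<length Y} = ZeroMor K ?A ?B"
        by (intro finprod_hom_zero[OF A B] zero) blast+
      then show ?thesis unfolding if_not_P[OF False] .
    qed
  qed
  finally show ?thesis .
qed

lemma match_add:
  assumes X: "X \<in> Obj KG" and Y: "Y \<in> Obj KG"
    and R: "\<And>i j. j < length X \<Longrightarrow> i < length Y \<Longrightarrow> R j i \<or> S j i \<Longrightarrow> X ! j = Y ! i"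
    and disj: "\<And>i j. j < length X \<Longrightarrow> i < length Y \<Longrightarrow> \<not> (R j i \<and> S j i)"
  shows "AddMor KG (match_mat X Y R) (match_mat X Y S) = match_mat X Y (\<lambda>j i. R j i \<or> S j i)"
proof -
  let ?M = "\<lambda>R i j. if R j i then Ident K (fst (X ! j)) else cp_zero K X Y i j"
  have "AddMor KG (match_mat X Y R) (match_mat X Y S) =
      cp_mat X Y (\<lambda>i j. AddMor K (cp_at (match_mat X Y R) i j) (cp_at (match_mat X Y S) i j))"
    by (simp add: crossed_product_def cp_shift_cat_def Let_def match_mat_def cp_mat_def)
  also have "\<dots> = match_mat X Y (\<lambda>j i. R j i \<or> S j i)"
    unfolding match_mat_def
  proof (rule mat_eqI)
    fix i j assume ij: "i < length Y" "j < length X"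
    have "X ! j = Y ! i \<Longrightarrow> Ident K (fst (X ! j)) \<in> Hom K (fst (X ! j)) (fst (Y ! i))"
      using ident nth_Obj(1)[OF X ij(2)] by simp
    moreover have "cp_zero K X Y i j \<in> Hom K (fst (X ! j)) (fst (Y ! i))"
      by (rule zero_mor[OF nth_Obj(1)[OF X ij(2)] nth_Obj(1)[OF Y ij(1)]])
    ultimately have "AddMor K (?M R i j) (?M S i j) = ?M (\<lambda>j i. R j i \<or> S j i) i j"
      using R[OF ij(2,1)] disj[OF ij(2,1)] add_zero by auto
    then show "AddMor K (cp_at (cp_mat X Y (?M R)) i j) (cp_at (cp_mat X Y (?M S)) i j) =
        ?M (\<lambda>j i. R j i \<or> S j i) i j"
      using ij by (simp add: mat_at)
  qed
  finally show ?thesis .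
qed

lemma match_cong:
  assumes "\<And>i j. j < length X \<Longrightarrow> i < length Y \<Longrightarrow> R j i \<longleftrightarrow> S j i"
  shows "match_mat X Y R = match_mat X Y S"
  unfolding match_mat_def using assms by (intro mat_eqI) simp

lemma crossed_ident: "X \<in> Obj KG \<Longrightarrow> Ident KG X \<in> Hom KG X X"
  by (simp add: ident_eq_match match_Hom)

lemma crossed_comp_ident:
  assumes f: "f \<in> Hom KG X Y" shows "f \<cdot>\<^bsub>KG\<^esub> Ident KG X = f" "Ident KG Y \<cdot>\<^bsub>KG\<^esub> f = f"
proof -
  define M where "M = cp_at f"
  note X = HomD(1)[OF f] and Y = HomD(2)[OF f] and f_eq = HomD(3)[OF f, folded M_def]
  have M: "M i j \<in> Hom K (fst (X ! j)) (fst (Y ! i))" if "i < length Y" "j < length X" for i j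
    unfolding M_def by (rule HomD(4)[OF f that])
  let ?I = "\<lambda>X i j. if j = i then Ident K (fst (X ! j)) else cp_zero K X X i j"
  have I: "?I X i j \<in> Hom K (fst (X ! j)) (fst (X ! i))"
    if "X \<in> Obj KG" "i < length X" "j < length X" for X i j
    using ident zero_mor nth_Obj(1)[OF that(1,2)] nth_Obj(1)[OF that(1,3)] by simp
  have "cp_mat X Y M \<cdot>\<^bsub>KG\<^esub> Ident KG X = cp_mat X Y (\<lambda>i j. finprod (hom_group K (fst (X ! j)) (fst (Y ! i)))
      (\<lambda>k. M i k \<cdot>\<^bsub>K\<^esub> ?I X k j) {..<length X})"
    unfolding ident_eq_match[OF X] match_mat_def
    by (rule mat_comp[OF X Y]) (rule M I[OF X]; assumption)+
  also have "\<dots> = cp_mat X Y M"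
  proof (rule mat_eqI)
    fix i j assume ij: "i < length Y" "j < length X"
    have e: "M i j \<cdot>\<^bsub>K\<^esub> ?I X j j = M i j" using comp_ident[OF M[OF ij]] by simp
    have "finprod (hom_group K (fst (X ! j)) (fst (Y ! i))) (\<lambda>k. M i k \<cdot>\<^bsub>K\<^esub> ?I X k j) {..<length X}
        = M i j \<cdot>\<^bsub>K\<^esub> ?I X j j"
    proof (rule finprod_hom_single[OF ij(2)])
      show "M i j \<cdot>\<^bsub>K\<^esub> ?I X j j \<in> Hom K (fst (X ! j)) (fst (Y ! i))" unfolding e by (rule M[OF ij])
      show "M i l \<cdot>\<^bsub>K\<^esub> ?I X l j = ZeroMor K (fst (X ! j)) (fst (Y ! i))" if "l < length X" "l \<noteq> j" for l
        using comp_zero[OF M[OF ij(1) that(1)] nth_Obj(1)[OF X ij(2)]] that by simp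
    qed
    then show "finprod (hom_group K (fst (X ! j)) (fst (Y ! i))) (\<lambda>k. M i k \<cdot>\<^bsub>K\<^esub> ?I X k j) {..<length X}
        = M i j" unfolding e .
  qed
  finally show "f \<cdot>\<^bsub>KG\<^esub> Ident KG X = f" unfolding f_eq[symmetric] .
  have "Ident KG Y \<cdot>\<^bsub>KG\<^esub> cp_mat X Y M = cp_mat X Y (\<lambda>i j. finprod (hom_group K (fst (X ! j)) (fst (Y ! i)))
      (\<lambda>k. ?I Y i k \<cdot>\<^bsub>K\<^esub> M k j) {..<length Y})"
    unfolding ident_eq_match[OF Y] match_mat_def
    by (rule mat_comp[OF X Y]) (rule M I[OF Y]; assumption)+
  also have "\<dots> = cp_mat X Y M"
  proof (rule mat_eqI)
    fix i j assume ij: "i < length Y" "j < length X"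
    have e: "?I Y i i \<cdot>\<^bsub>K\<^esub> M i j = M i j" using ident_comp[OF M[OF ij]] by simp
    have "finprod (hom_group K (fst (X ! j)) (fst (Y ! i))) (\<lambda>k. ?I Y i k \<cdot>\<^bsub>K\<^esub> M k j) {..<length Y}
        = ?I Y i i \<cdot>\<^bsub>K\<^esub> M i j"
    proof (rule finprod_hom_single[OF ij(1)])
      show "?I Y i i \<cdot>\<^bsub>K\<^esub> M i j \<in> Hom K (fst (X ! j)) (fst (Y ! i))" unfolding e by (rule M[OF ij])
      show "?I Y i l \<cdot>\<^bsub>K\<^esub> M l j = ZeroMor K (fst (X ! j)) (fst (Y ! i))" if "l < length Y" "l \<noteq> i" for l
        using zero_comp[OF M[OF that(1) ij(2)] nth_Obj(1)[OF Y ij(1)]] that by simp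
    qed
    then show "finprod (hom_group K (fst (X ! j)) (fst (Y ! i))) (\<lambda>k. ?I Y i k \<cdot>\<^bsub>K\<^esub> M k j) {..<length Y}
        = M i j" unfolding e .
  qed
  finally show "Ident KG Y \<cdot>\<^bsub>KG\<^esub> f = f" unfolding f_eq[symmetric] .
qed

lemma append_Obj: "X @ Y \<in> Obj KG \<longleftrightarrow> X \<in> Obj KG \<and> Y \<in> Obj KG"
  by (simp add: Obj_crossed)

lemma direct_sum_append:
  assumes X: "X \<in> Obj KG" and Y: "Y \<in> Obj KG"
  shows "is_direct_sum KG X Y (X @ Y)"
proof -
  let ?n = "length X" and ?S = "X @ Y"
  have S: "?S \<in> Obj KG" using X Y append_Obj by simp
  let ?i2 = "\<lambda>j i. i = ?n + j" and ?p2 = "\<lambda>j i. j = ?n + i"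
  have c: "\<And>i j. j < ?n \<Longrightarrow> i < length ?S \<Longrightarrow> j = i \<Longrightarrow> X ! j = ?S ! i"
    "\<And>i j. j < length Y \<Longrightarrow> i < length ?S \<Longrightarrow> ?i2 j i \<Longrightarrow> Y ! j = ?S ! i"
    "\<And>i j. j < length ?S \<Longrightarrow> i < ?n \<Longrightarrow> j = i \<Longrightarrow> ?S ! j = X ! i"
    "\<And>i j. j < length ?S \<Longrightarrow> i < length Y \<Longrightarrow> ?p2 j i \<Longrightarrow> ?S ! j = Y ! i"
    by (simp_all add: nth_append)
  show ?thesis unfolding is_direct_sum_def
  proof (intro bexI conjI)
    show "match_mat X ?S (=) \<in> Hom KG X ?S" by (rule match_Hom[OF X S c(1)])
    show "match_mat Y ?S ?i2 \<in> Hom KG Y ?S" by (rule match_Hom[OF Y S c(2)])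
    show "match_mat ?S X (=) \<in> Hom KG ?S X" by (rule match_Hom[OF S X c(3)])
    show "match_mat ?S Y ?p2 \<in> Hom KG ?S Y" by (rule match_Hom[OF S Y c(4)])
    show "match_mat ?S X (=) \<cdot>\<^bsub>KG\<^esub> match_mat X ?S (=) = Ident KG X"
      unfolding ident_eq_match[OF X]
      by (subst match_comp[OF X S X c(1) c(3)]) (auto intro: match_cong)
    show "match_mat ?S Y ?p2 \<cdot>\<^bsub>KG\<^esub> match_mat Y ?S ?i2 = Ident KG Y"
      unfolding ident_eq_match[OF Y]
      by (subst match_comp[OF Y S Y c(2) c(4)]) (auto intro: match_cong)
    show "match_mat ?S X (=) \<cdot>\<^bsub>KG\<^esub> match_mat Y ?S ?i2 = ZeroMor KG Y X"
      unfolding zero_eq_match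
      by (subst match_comp[OF Y S X c(2) c(3)]) (auto intro: match_cong)
    show "match_mat ?S Y ?p2 \<cdot>\<^bsub>KG\<^esub> match_mat X ?S (=) = ZeroMor KG X Y"
      unfolding zero_eq_match
      by (subst match_comp[OF X S Y c(1) c(4)]) (auto intro: match_cong)
    have "match_mat X ?S (=) \<cdot>\<^bsub>KG\<^esub> match_mat ?S X (=) = match_mat ?S ?S (\<lambda>j i. j = i \<and> i < ?n)"
      by (subst match_comp[OF S X S c(3) c(1)]) (auto intro: match_cong)
    moreover have "match_mat Y ?S ?i2 \<cdot>\<^bsub>KG\<^esub> match_mat ?S Y ?p2 = match_mat ?S ?S (\<lambda>j i. j = i \<and> \<not> i < ?n)"
    proof -
      have "match_mat Y ?S ?i2 \<cdot>\<^bsub>KG\<^esub> match_mat ?S Y ?p2 =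
          match_mat ?S ?S (\<lambda>j i. \<exists>k < length Y. ?p2 j k \<and> ?i2 k i)"
        by (rule match_comp[OF S Y S c(4) c(2)]) auto
      also have "\<dots> = match_mat ?S ?S (\<lambda>j i. j = i \<and> \<not> i < ?n)"
        by (rule match_cong) (simp, presburger)
      finally show ?thesis .
    qed
    moreover have "AddMor KG (match_mat ?S ?S (\<lambda>j i. j = i \<and> i < ?n))
        (match_mat ?S ?S (\<lambda>j i. j = i \<and> \<not> i < ?n)) = Ident KG ?S"
      unfolding ident_eq_match[OF S]
      by (subst match_add[OF S S]) (auto intro: match_cong)
    ultimately show "AddMor KG (match_mat X ?S (=) \<cdot>\<^bsub>KG\<^esub> match_mat ?S X (=))
        (match_mat Y ?S ?i2 \<cdot>\<^bsub>KG\<^esub> match_mat ?S Y ?p2) = Ident KG ?S" by simp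
  qed
qed

lemma zero_object_crossed:
  assumes Z: "\<And>x. x \<in> set Z \<Longrightarrow> zero_object K (fst x) \<and> snd x \<in> carrier G"
  shows "zero_object KG Z"
proof -
  have ZO: "Z \<in> Obj KG" using Z by (force simp: Obj_crossed lists_eq_set zero_object_iff)
  have z: "zero_object K (fst (Z ! i))" if "i < length Z" for i using Z that by simp
  have "ZeroMor KG X Z \<in> Hom KG X Z" "ZeroMor KG Z X \<in> Hom KG Z X" if "X \<in> Obj KG" for X
    unfolding zero_eq_match using match_Hom that ZO by simp_all
  moreover have "f = ZeroMor KG X Z" if h: "f \<in> Hom KG X Z" for f X
    using HomD(3)[OF h] unfolding zero_eq_match match_mat_def
    by (rule ssubst) (rule mat_eqI, simp add: zero_object_mor(1)[OF z HomD(4)[OF h]])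
  moreover have "f = ZeroMor KG Z X" if h: "f \<in> Hom KG Z X" for f X
    using HomD(3)[OF h] unfolding zero_eq_match match_mat_def
    by (rule ssubst) (rule mat_eqI, simp add: zero_object_mor(2)[OF z HomD(4)[OF h]])
  ultimately show ?thesis unfolding zero_object_def using ZO by blast
qed

text \<open>
  The matrices of the direct sum decomposition are mutually inverse here, because an identity of a
  zero object may be replaced by the zero entry.
\<close>

lemma append_zero_isomorphic:
  assumes X: "X \<in> Obj KG" and Z: "\<And>x. x \<in> set Z \<Longrightarrow> zero_object K (fst x) \<and> snd x \<in> carrier G"
  shows "isomorphic KG X (X @ Z)" "isomorphic KG X (Z @ X)"
proof -
  have ZO: "Z \<in> Obj KG" using zero_object_crossed[OF Z] by (simp add: zero_object_def)
  have z: "Ident K (fst (Z ! i)) = cp_zero K Z Z i i" if "i < length Z" for i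
    using Z[OF nth_mem[OF that]] zero_object_iff by blast
  let ?n = "length X" and ?m = "length Z"
  have S: "X @ Z \<in> Obj KG" "Z @ X \<in> Obj KG" using X ZO append_Obj by simp_all
  have c: "\<And>i j. j < ?n \<Longrightarrow> i < length (X @ Z) \<Longrightarrow> j = i \<Longrightarrow> X ! j = (X @ Z) ! i"
    "\<And>i j. j < length (X @ Z) \<Longrightarrow> i < ?n \<Longrightarrow> j = i \<Longrightarrow> (X @ Z) ! j = X ! i"
    "\<And>i j. j < ?n \<Longrightarrow> i < length (Z @ X) \<Longrightarrow> i = ?m + j \<Longrightarrow> X ! j = (Z @ X) ! i"
    "\<And>i j. j < length (Z @ X) \<Longrightarrow> i < ?n \<Longrightarrow> j = ?m + i \<Longrightarrow> (Z @ X) ! j = X ! i"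
    by (simp_all add: nth_append)
  show "isomorphic KG X (X @ Z)"
  proof (rule isomorphicI)
    show "match_mat X (X @ Z) (=) \<in> Hom KG X (X @ Z)" by (rule match_Hom[OF X S(1) c(1)])
    show "match_mat (X @ Z) X (=) \<in> Hom KG (X @ Z) X" by (rule match_Hom[OF S(1) X c(2)])
    show "match_mat (X @ Z) X (=) \<cdot>\<^bsub>KG\<^esub> match_mat X (X @ Z) (=) = Ident KG X"
      unfolding ident_eq_match[OF X]
      by (subst match_comp[OF X S(1) X c(1,2)]) (auto intro: match_cong)
    have "match_mat X (X @ Z) (=) \<cdot>\<^bsub>KG\<^esub> match_mat (X @ Z) X (=) =
        match_mat (X @ Z) (X @ Z) (\<lambda>j i. \<exists>k < ?n. j = k \<and> k = i)"
      by (rule match_comp[OF S(1) X S(1) c(2,1)]) auto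
    also have "\<dots> = Ident KG (X @ Z)" unfolding ident_eq_match[OF S(1)] match_mat_def
      by (rule mat_eqI) (auto simp: nth_append z)
    finally show "match_mat X (X @ Z) (=) \<cdot>\<^bsub>KG\<^esub> match_mat (X @ Z) X (=) = Ident KG (X @ Z)" .
  qed
  let ?i = "\<lambda>j i. i = ?m + j" and ?p = "\<lambda>j i. j = ?m + i"
  show "isomorphic KG X (Z @ X)"
  proof (rule isomorphicI)
    show "match_mat X (Z @ X) ?i \<in> Hom KG X (Z @ X)" by (rule match_Hom[OF X S(2) c(3)])
    show "match_mat (Z @ X) X ?p \<in> Hom KG (Z @ X) X" by (rule match_Hom[OF S(2) X c(4)])
    show "match_mat (Z @ X) X ?p \<cdot>\<^bsub>KG\<^esub> match_mat X (Z @ X) ?i = Ident KG X"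
      unfolding ident_eq_match[OF X]
      by (subst match_comp[OF X S(2) X c(3,4)]) (auto intro: match_cong)
    have "match_mat X (Z @ X) ?i \<cdot>\<^bsub>KG\<^esub> match_mat (Z @ X) X ?p =
        match_mat (Z @ X) (Z @ X) (\<lambda>j i. \<exists>k < ?n. ?p j k \<and> ?i k i)"
      by (rule match_comp[OF S(2) X S(2) c(4,3)]) auto
    also have "\<dots> = match_mat (Z @ X) (Z @ X) (\<lambda>j i. j = i \<and> \<not> i < ?m)"
      by (rule match_cong) (simp, presburger)
    also have "\<dots> = Ident KG (Z @ X)" unfolding ident_eq_match[OF S(2)] match_mat_def
      by (rule mat_eqI) (auto simp: nth_append z)
    finally show "match_mat X (Z @ X) ?i \<cdot>\<^bsub>KG\<^esub> match_mat (Z @ X) X ?p = Ident KG (Z @ X)" .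
  qed
qed

text \<open>
  The next lemmas say that \<open>A \<mapsto> A \<boxtimes> g\<close> is an additive functor, a morphism \<open>f\<close> being sent to the
  \<open>1 \<times> 1\<close> matrix \<open>cp_diag K [(f, g)]\<close>.
\<close>

lemma box_Obj: "[(A, g)] \<in> Obj KG \<longleftrightarrow> A \<in> Obj K \<and> g \<in> carrier G"
  by (simp add: Obj_crossed)

lemma box_Hom:
  assumes f: "f \<in> Hom K A B" and g: "g \<in> carrier G"
  shows "cp_diag K [(f, g)] \<in> Hom KG [(A, g)] [(B, g)]"
    "cp_diag K [(f, g)] = cp_mat [(A, g)] [(B, g)] (\<lambda>_ _. f)"
proof -
  have fm: "f \<in> Mor K" "Dom K f = A" "Cod K f = B" using f by (auto simp: Hom_def)
  then show e: "cp_diag K [(f, g)] = cp_mat [(A, g)] [(B, g)] (\<lambda>_ _. f)" by (simp add: diag_box)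
  show "cp_diag K [(f, g)] \<in> Hom KG [(A, g)] [(B, g)]" unfolding e
    by (rule mat_Hom) (use f g Hom_Obj[OF f] in \<open>simp_all add: box_Obj cp_entry_hom_def\<close>)
qed

lemma box_comp:
  assumes f: "f \<in> Hom K A B" and h: "h \<in> Hom K B D" and g: "g \<in> carrier G"
  shows "cp_diag K [(h, g)] \<cdot>\<^bsub>KG\<^esub> cp_diag K [(f, g)] = cp_diag K [(h \<cdot>\<^bsub>K\<^esub> f, g)]"
proof -
  have hf: "h \<cdot>\<^bsub>K\<^esub> f \<in> Hom K A D" by (rule comp[OF f h])
  have Ob: "[(A, g)] \<in> Obj KG" "[(D, g)] \<in> Obj KG" using Hom_Obj[OF hf] g box_Obj by simp_all
  have "cp_diag K [(h, g)] \<cdot>\<^bsub>KG\<^esub> cp_diag K [(f, g)] =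
      cp_mat [(A, g)] [(D, g)] (\<lambda>i j. finprod (hom_group K (fst ([(A, g)] ! j)) (fst ([(D, g)] ! i)))
      (\<lambda>k. h \<cdot>\<^bsub>K\<^esub> f) {..<length [(B, g)]})"
    unfolding box_Hom(2)[OF f g] box_Hom(2)[OF h g] by (rule mat_comp[OF Ob]) (use f h in simp_all)
  also have "\<dots> = cp_mat [(A, g)] [(D, g)] (\<lambda>i j. h \<cdot>\<^bsub>K\<^esub> f)"
    by (rule mat_eqI) (use hf in \<open>simp add: finprod_hom_single[where k = 0]\<close>)
  also have "\<dots> = cp_diag K [(h \<cdot>\<^bsub>K\<^esub> f, g)]" unfolding box_Hom(2)[OF hf g] ..
  finally show ?thesis .
qed

lemma box_ident: "Ident KG [(A, g)] = cp_diag K [(Ident K A, g)]"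
  by (simp add: crossed_product_def cp_shift_cat_def Let_def)

lemma box_zero:
  assumes "A \<in> Obj K" "B \<in> Obj K" "g \<in> carrier G"
  shows "ZeroMor KG [(A, g)] [(B, g)] = cp_diag K [(ZeroMor K A B, g)]"
  unfolding box_Hom(2)[OF zero_mor[OF assms(1,2)] assms(3)] zero_eq_match match_mat_def
  by (rule mat_eqI) simp

lemma box_add:
  assumes f: "f \<in> Hom K A B" and h: "h \<in> Hom K A B" and g: "g \<in> carrier G"
  shows "AddMor KG (cp_diag K [(f, g)]) (cp_diag K [(h, g)]) = cp_diag K [(AddMor K f h, g)]"
  unfolding box_Hom(2)[OF f g] box_Hom(2)[OF h g] box_Hom(2)[OF add_mor[OF f h] g]
  unfolding crossed_product_def cp_shift_cat_def Let_def cp_mat_def by auto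

lemma box_isomorphic:
  assumes "isomorphic K A B" and g: "g \<in> carrier G"
  shows "isomorphic KG [(A, g)] [(B, g)]"
proof -
  obtain f h where f: "f \<in> Hom K A B" and h: "h \<in> Hom K B A"
    and e: "h \<cdot>\<^bsub>K\<^esub> f = Ident K A" "f \<cdot>\<^bsub>K\<^esub> h = Ident K B"
    using assms(1) by (rule isomorphicE)
  show ?thesis
    by (rule isomorphicI[OF box_Hom(1)[OF f g] box_Hom(1)[OF h g]])
      (simp_all only: box_comp[OF f h g] box_comp[OF h f g] e box_ident)
qed

lemma box_direct_sum:
  assumes sum: "is_direct_sum K A B S" and g: "g \<in> carrier G"
  shows "is_direct_sum KG [(A, g)] [(B, g)] [(S, g)]"
proof -
  obtain i1 i2 p1 p2 where i: "i1 \<in> Hom K A S" "i2 \<in> Hom K B S" and p: "p1 \<in> Hom K S A" "p2 \<in> Hom K S B"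
    and e: "p1 \<cdot>\<^bsub>K\<^esub> i1 = Ident K A" "p2 \<cdot>\<^bsub>K\<^esub> i2 = Ident K B" "p1 \<cdot>\<^bsub>K\<^esub> i2 = ZeroMor K B A"
      "p2 \<cdot>\<^bsub>K\<^esub> i1 = ZeroMor K A B" "AddMor K (i1 \<cdot>\<^bsub>K\<^esub> p1) (i2 \<cdot>\<^bsub>K\<^esub> p2) = Ident K S"
    using sum unfolding is_direct_sum_def by blast
  have Ob: "A \<in> Obj K" "B \<in> Obj K" using Hom_Obj[OF i(1)] Hom_Obj[OF i(2)] by simp_all
  show ?thesis unfolding is_direct_sum_def
  proof (intro bexI conjI)
    show "cp_diag K [(p1, g)] \<cdot>\<^bsub>KG\<^esub> cp_diag K [(i1, g)] = Ident KG [(A, g)]"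
      by (simp only: box_comp[OF i(1) p(1) g] e box_ident)
    show "cp_diag K [(p2, g)] \<cdot>\<^bsub>KG\<^esub> cp_diag K [(i2, g)] = Ident KG [(B, g)]"
      by (simp only: box_comp[OF i(2) p(2) g] e box_ident)
    show "cp_diag K [(p1, g)] \<cdot>\<^bsub>KG\<^esub> cp_diag K [(i2, g)] = ZeroMor KG [(B, g)] [(A, g)]"
      by (simp only: box_comp[OF i(2) p(1) g] e box_zero[OF Ob(2,1) g])
    show "cp_diag K [(p2, g)] \<cdot>\<^bsub>KG\<^esub> cp_diag K [(i1, g)] = ZeroMor KG [(A, g)] [(B, g)]"
      by (simp only: box_comp[OF i(1) p(2) g] e box_zero[OF Ob g])
    show "AddMor KG (cp_diag K [(i1, g)] \<cdot>\<^bsub>KG\<^esub> cp_diag K [(p1, g)])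
        (cp_diag K [(i2, g)] \<cdot>\<^bsub>KG\<^esub> cp_diag K [(p2, g)]) = Ident KG [(S, g)]"
      by (simp only: box_comp[OF p(1) i(1) g] box_comp[OF p(2) i(2) g]
        box_add[OF comp[OF p(1) i(1)] comp[OF p(2) i(2)] g] e box_ident)
  qed (rule box_Hom(1)[OF _ g], rule i p)+
qed

section \<open>Diagonal triangles\<close>

lemma diag_Hom:
  assumes "fs \<in> lists (Mor K \<times> carrier G)"
  shows "cp_diag K fs \<in> Hom KG (map (\<lambda>(f, g). (Dom K f, g)) fs) (map (\<lambda>(f, g). (Cod K f, g)) fs)"
proof -
  let ?X = "map (\<lambda>(f, g). (Dom K f, g)) fs" and ?Y = "map (\<lambda>(f, g). (Cod K f, g)) fs"
  have fs: "fst (fs ! i) \<in> Mor K" "snd (fs ! i) \<in> carrier G" if "i < length fs" for i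
  proof -
    have "fs ! i \<in> Mor K \<times> carrier G" using assms nth_mem[OF that] by (auto simp: lists_eq_set)
    then show "fst (fs ! i) \<in> Mor K" "snd (fs ! i) \<in> carrier G" by auto
  qed
  have X: "?X \<in> Obj KG" and Y: "?Y \<in> Obj KG"
    using assms dom_cod by (fastforce simp: Obj_crossed lists_eq_set)+
  show ?thesis unfolding cp_diag_def Let_def
  proof (rule mat_Hom[OF X Y])
    fix i j assume ij: "i < length ?Y" "j < length ?X"
    show "(if i = j then fst (fs ! i) else cp_zero K ?X ?Y i j) \<in> cp_entry_hom K (?X ! j) (?Y ! i)"
    proof (cases "i = j")
      case True
      then show ?thesis using ij fs[of i] by (simp add: case_prod_beta cp_entry_hom_def Hom_def)
    next
      case False
      then show ?thesis using zero_entry[OF nth_Obj(1)[OF X ij(2)] nth_Obj(1)[OF Y ij(1)]] by simp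
    qed
  qed
qed

lemma crossed_shift_ident:
  assumes X: "X \<in> Obj KG"
  shows "Shm KG (Ident KG X) = Ident KG (Sh KG X)"
proof -
  have SX: "Sh KG X \<in> Obj KG"
    using X shift_obj by (auto simp: Obj_crossed Sh_crossed lists_eq_set)
  have nth: "Sh KG X ! i = (Sh K (fst (X ! i)), snd (X ! i))" if "i < length X" for i
    using that by (simp add: Sh_crossed case_prod_beta)
  have len: "length (Sh KG X) = length X" by (simp add: Sh_crossed)
  have "Shm KG (Ident KG X) = cp_mat (Sh KG X) (Sh KG X) (\<lambda>i j. Shm K (cp_at (match_mat X X (=)) i j))"
    unfolding ident_eq_match[OF X] match_mat_def
    by (simp add: crossed_product_def cp_shift_cat_def Let_def cp_mat_def)
  also have "\<dots> = match_mat (Sh KG X) (Sh KG X) (=)" unfolding match_mat_def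
  proof (rule mat_eqI)
    fix i j assume "i < length (Sh KG X)" "j < length (Sh KG X)"
    then have ij: "i < length X" "j < length X" using len by simp_all
    note Ob = nth_Obj(1)[OF X ij(1)] nth_Obj(1)[OF X ij(2)]
    show "Shm K (cp_at (cp_mat X X (\<lambda>i j. if j = i then Ident K (fst (X ! j)) else cp_zero K X X i j)) i j) =
      (if j = i then Ident K (fst (Sh KG X ! j)) else cp_zero K (Sh KG X) (Sh KG X) i j)"
      using functor_ident[OF shift_functor Ob(1)] additive_functor_zero[OF shift_additive Ob(2,1)] ij
      by (simp add: mat_at nth)
  qed
  finally show ?thesis unfolding ident_eq_match[OF SX] .
qed

lemma crossed_is_iso_ident:
  assumes "X \<in> Obj KG" shows "is_iso KG (Ident KG X)"
proof -
  have i: "Ident KG X \<in> Hom KG X X" using crossed_ident assms .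
  then have "inverse_mors KG (Ident KG X) (Ident KG X)"
    using crossed_comp_ident(1)[OF i] by (simp add: inverse_mors_def Hom_def)
  then show ?thesis unfolding is_iso_def by blast
qed

lemma isomorphic_triangles_refl:
  assumes t: "triangle KG (f, g, h)"
  shows "isomorphic_triangles KG (f, g, h) (f, g, h)"
proof -
  have f: "f \<in> Hom KG (Dom KG f) (Dom KG g)" and g: "g \<in> Hom KG (Dom KG g) (Dom KG h)"
    and h: "h \<in> Hom KG (Dom KG h) (Sh KG (Dom KG f))"
    using t by (auto simp: triangle_def Hom_def)
  note Ob = HomD(1)[OF f] HomD(1)[OF g] HomD(1)[OF h]
  show ?thesis unfolding isomorphic_triangles_def case_prod_conv
  proof (intro conjI bexI)
    show "Ident KG (Dom KG g) \<cdot>\<^bsub>KG\<^esub> f = f \<cdot>\<^bsub>KG\<^esub> Ident KG (Dom KG f)"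
      using crossed_comp_ident[OF f] by simp
    show "Ident KG (Dom KG h) \<cdot>\<^bsub>KG\<^esub> g = g \<cdot>\<^bsub>KG\<^esub> Ident KG (Dom KG g)"
      using crossed_comp_ident[OF g] by simp
    show "Shm KG (Ident KG (Dom KG f)) \<cdot>\<^bsub>KG\<^esub> h = h \<cdot>\<^bsub>KG\<^esub> Ident KG (Dom KG h)"
      using crossed_comp_ident[OF h] crossed_shift_ident[OF Ob(1)] by simp
  qed (use t Ob crossed_ident crossed_is_iso_ident in simp_all)
qed

lemma Dist_crossed: "Dist KG = cp_dist K G"
  by (simp add: crossed_product_def Let_def)

lemma diag_triangle:
  assumes ts: "ts \<in> lists (Dist K \<times> carrier G)"
  shows "triangle KG (cp_diag K (map (\<lambda>((f, g, h), x). (f, x)) ts),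
      cp_diag K (map (\<lambda>((f, g, h), x). (g, x)) ts), cp_diag K (map (\<lambda>((f, g, h), x). (h, x)) ts))"
proof -
  have t: "triangle K (f, g, h) \<and> x \<in> carrier G" if "((f, g, h), x) \<in> set ts" for f g h x
    using ts that dist_triangle by (auto simp: lists_eq_set)
  have "map (\<lambda>((f, g, h), x). (f, x)) ts \<in> lists (Mor K \<times> carrier G)"
    "map (\<lambda>((f, g, h), x). (g, x)) ts \<in> lists (Mor K \<times> carrier G)"
    "map (\<lambda>((f, g, h), x). (h, x)) ts \<in> lists (Mor K \<times> carrier G)"
    using t by (fastforce simp: lists_eq_set triangle_def)+
  note m = this[THEN diag_Hom]
  have Mor: "m \<in> Mor KG" if "m \<in> Hom KG X Y" for m X Y using that by (simp add: Hom_def)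
  show ?thesis unfolding triangle_def case_prod_conv dom_diag cod_diag Sh_crossed map_map
  proof (intro conjI)
    show "map ((\<lambda>(f, g). (Dom K f, g)) \<circ> (\<lambda>((f, g, h), x). (g, x))) ts =
        map ((\<lambda>(f, g). (Cod K f, g)) \<circ> (\<lambda>((f, g, h), x). (f, x))) ts"
      by (rule map_cong[OF refl]) (use t in \<open>auto simp: triangle_def\<close>)
    show "map ((\<lambda>(f, g). (Dom K f, g)) \<circ> (\<lambda>((f, g, h), x). (h, x))) ts =
        map ((\<lambda>(f, g). (Cod K f, g)) \<circ> (\<lambda>((f, g, h), x). (g, x))) ts"
      by (rule map_cong[OF refl]) (use t in \<open>auto simp: triangle_def\<close>)
    show "map ((\<lambda>(f, g). (Cod K f, g)) \<circ> (\<lambda>((f, g, h), x). (h, x))) ts =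
        map ((\<lambda>(A, g). (Sh K A, g)) \<circ> ((\<lambda>(f, g). (Dom K f, g)) \<circ> (\<lambda>((f, g, h), x). (f, x)))) ts"
      by (rule map_cong[OF refl]) (use t in \<open>auto simp: triangle_def\<close>)
  qed (rule Mor[OF m(1)] Mor[OF m(2)] Mor[OF m(3)])+
qed

lemma diag_dist:
  assumes "ts \<in> lists (Dist K \<times> carrier G)"
  shows "(cp_diag K (map (\<lambda>((f, g, h), x). (f, x)) ts),
      cp_diag K (map (\<lambda>((f, g, h), x). (g, x)) ts),
      cp_diag K (map (\<lambda>((f, g, h), x). (h, x)) ts)) \<in> Dist KG"
  unfolding Dist_crossed cp_dist_def isomorphic_triangles_shift_cat[of K G T \<gamma>]
  using isomorphic_triangles_refl[OF diag_triangle[OF assms]] assms by blast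

section \<open>Retracts of lists with entries in an ideal\<close>

text \<open>
  The entry of \<open>h \<cdot> f = 1\<close> at a diagonal place \<open>(i, i)\<close> writes the identity of the \<open>i\<close>-th summand of
  \<open>X\<close> as a sum of composites through the summands of \<open>Y\<close>, all of which lie in \<open>I\<close>.
\<close>

lemma retract_entries:
  assumes I: "thick_ideal K I"
    and f: "f \<in> Hom KG X Y" and h: "h \<in> Hom KG Y X" and hf: "h \<cdot>\<^bsub>KG\<^esub> f = Ident KG X"
    and Y: "Y \<in> lists (I \<times> carrier G)"
  shows "X \<in> lists (I \<times> carrier G)"
proof -
  have X: "X \<in> Obj KG" using HomD(1)[OF f] .
  have "X ! i \<in> I \<times> carrier G" if i: "i < length X" for i
  proof -
    let ?A = "fst (X ! i)"
    note A = nth_Obj[OF X i]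
    have B: "fst (Y ! k) \<in> I" if "k < length Y" for k
      using Y nth_mem[OF that] by (auto simp: lists_eq_set)
    have "h \<cdot>\<^bsub>KG\<^esub> f = cp_mat X X (\<lambda>i j. finprod (hom_group K (fst (X ! j)) (fst (X ! i)))
        (\<lambda>k. cp_at h i k \<cdot>\<^bsub>K\<^esub> cp_at f k j) {..<length Y})"
      using mat_comp[OF X X HomD(4)[OF f] HomD(4)[OF h]] HomD(3)[OF f] HomD(3)[OF h] by simp
    then have "cp_at (h \<cdot>\<^bsub>KG\<^esub> f) i i =
        finprod (hom_group K ?A ?A) (\<lambda>k. cp_at h i k \<cdot>\<^bsub>K\<^esub> cp_at f k i) {..<length Y}"
      using i by (simp only: mat_at)
    moreover have "cp_at (h \<cdot>\<^bsub>KG\<^esub> f) i i = Ident K ?A"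
      unfolding hf ident_eq_match[OF X] match_mat_def using i by (simp add: mat_at)
    ultimately have "?A \<in> I"
      using thick_sum_retract[OF I A(1), where n = "length Y" and B = "\<lambda>k. fst (Y ! k)"
          and r = "\<lambda>k. cp_at f k i" and q = "\<lambda>k. cp_at h i k"] B HomD(4)[OF f _ i] HomD(4)[OF h i]
      by simp
    then show ?thesis using A(2) by (simp add: mem_Times_iff)
  qed
  then show ?thesis by (metis in_set_conv_nth in_listsI)
qed

lemma isomorphic_entries:
  assumes "thick_ideal K I" "isomorphic KG X Y" "Y \<in> lists (I \<times> carrier G)"
  shows "X \<in> lists (I \<times> carrier G)"
  using assms(2) by (rule isomorphicE) (rule retract_entries[OF assms(1) _ _ _ assms(3)])

lemma ideal_crossed_eq:
  assumes I: "thick_ideal K I"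
  shows "ideal_crossed K G T \<gamma> I = lists (I \<times> carrier G)"
proof
  show "ideal_crossed K G T \<gamma> I \<subseteq> lists (I \<times> carrier G)"
    unfolding ideal_crossed_def using isomorphic_entries[OF I] by blast
  show "lists (I \<times> carrier G) \<subseteq> ideal_crossed K G T \<gamma> I"
  proof
    fix X assume X: "X \<in> lists (I \<times> carrier G)"
    then have XO: "X \<in> Obj KG" using thick_idealD(1)[OF I] by (auto simp: Obj_crossed lists_eq_set)
    note i = crossed_ident[OF XO]
    have "isomorphic KG X X"
      by (rule isomorphicI[OF i i]) (simp_all add: crossed_comp_ident[OF i])
    then show "X \<in> ideal_crossed K G T \<gamma> I" unfolding ideal_crossed_def using X XO by blast
  qed
qed

section \<open>The action on objects up to isomorphism\<close>

lemma T_equivalence: "g \<in> carrier G \<Longrightarrow> is_equivalence K K (T g)"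
  and T_functor: "g \<in> carrier G \<Longrightarrow> is_functor K K (T g)"
  and T_monoidal: "g \<in> carrier G \<Longrightarrow> monoidal_functor K K (T g)"
  using autoequivalence by (simp_all add: mt_autoequivalence_def mt_functor_def is_equivalence_def)

lemma T_obj: "g \<in> carrier G \<Longrightarrow> A \<in> Obj K \<Longrightarrow> fo (T g) A \<in> Obj K"
  by (rule functor_obj[OF T_functor])

lemma T_unit_isomorphic:
  assumes "g \<in> carrier G" shows "isomorphic K (fo (T g) (TUnit K)) (TUnit K)"
proof (rule isomorphic_sym)
  have "Funit (T g) \<in> Hom K (TUnit K) (fo (T g) (TUnit K))" "is_iso K (Funit (T g))"
    using T_monoidal[OF assms] unfolding monoidal_functor_def by - (elim conjE, assumption)+
  then show "isomorphic K (TUnit K) (fo (T g) (TUnit K))" unfolding isomorphic_def by blast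
qed

lemma equivalence_reflects_isomorphic:
  assumes F: "is_equivalence K K F" and A: "A \<in> Obj K" and B: "B \<in> Obj K"
    and iso: "isomorphic K (fo F A) (fo F B)"
  shows "isomorphic K A B"
proof -
  obtain H :: "('o, 'm, 'o, 'm) fctr" and \<eta> where H: "is_functor K K H"
    and \<eta>: "natural_iso K K id_fctr (comp_fctr H F) \<eta>"
    using F unfolding is_equivalence_def by blast
  have e: "isomorphic K X (fo H (fo F X))" if "X \<in> Obj K" for X
    using natural_iso_isomorphic[OF \<eta> that] by (simp add: id_fctr_def comp_fctr_def)
  show ?thesis
    using isomorphic_trans[OF e[OF A] isomorphic_trans[OF functor_isomorphic[OF H iso] isomorphic_sym[OF e[OF B]]]] .
qed

text \<open>
  Only \<open>T\<^sub>e T\<^sub>e \<cong> T\<^sub>e\<close> is given; \<open>T\<^sub>e\<close> reflects isomorphy, being an equivalence.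
\<close>

lemma T_one_isomorphic:
  assumes A: "A \<in> Obj K" shows "isomorphic K (fo (T \<one>\<^bsub>G\<^esub>) A) A"
proof (rule equivalence_reflects_isomorphic[OF T_equivalence[OF one_closed] T_obj[OF one_closed A] A])
  have "natural_iso K K (comp_mt_fctr K (T \<one>\<^bsub>G\<^esub>) (T \<one>\<^bsub>G\<^esub>)) (T \<one>\<^bsub>G\<^esub>) (\<gamma> \<one>\<^bsub>G\<^esub> \<one>\<^bsub>G\<^esub>)"
    using gamma_iso[OF one_closed one_closed] by (simp add: mt_natural_iso_def)
  from natural_iso_isomorphic[OF this A]
  show "isomorphic K (fo (T \<one>\<^bsub>G\<^esub>) (fo (T \<one>\<^bsub>G\<^esub>) A)) (fo (T \<one>\<^bsub>G\<^esub>) A)"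
    by (simp add: comp_mt_fctr_def)
qed

section \<open>Extending a G-ideal to the crossed product\<close>

text \<open>
  Closure under isomorphism and direct summands is \<open>retract_entries\<close>. A zero object is a retract of
  the empty list. A distinguished triangle is isomorphic to a diagonal one, whose third object has
  its entries in \<open>I\<close> because the first two do, each diagonal component being distinguished in \<open>K\<close>.
\<close>

lemma thick_ideal_crossed:
  assumes GI: "G_ideal K G T I"
  shows "thick_ideal KG (lists (I \<times> carrier G))"
proof -
  have I: "thick_ideal K I" and TI: "\<And>g A. g \<in> carrier G \<Longrightarrow> A \<in> I \<Longrightarrow> fo (T g) A \<in> I"
    using GI unfolding G_ideal_def by auto
  let ?J = "lists (I \<times> carrier G)"
  have IO: "A \<in> Obj K" if "A \<in> I" for A using thick_idealD(1)[OF I] that by blast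
  show ?thesis
  proof (rule thick_idealI)
    show "?J \<subseteq> Obj KG" unfolding Obj_crossed using IO by (intro lists_mono) blast
    show "B \<in> ?J" if "A \<in> ?J" "isomorphic KG A B" for A B
      using isomorphic_entries[OF I isomorphic_sym[OF that(2)] that(1)] .
    show "Z \<in> ?J" if Z: "zero_object KG Z" for Z
    proof -
      have ZO: "Z \<in> Obj KG" using Z unfolding zero_object_def by simp
      have z: "ZeroMor KG Z [] \<in> Hom KG Z []" "ZeroMor KG [] Z \<in> Hom KG [] Z"
        unfolding zero_eq_match using ZO by (auto intro!: match_Hom simp: Obj_crossed)
      have n: "[] \<in> Obj KG" by (simp add: Obj_crossed)
      have "match_mat [] Z (\<lambda>_ _. False) \<cdot>\<^bsub>KG\<^esub> match_mat Z [] (\<lambda>_ _. False) \<in> Hom KG Z Z"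
        by (subst match_comp[OF ZO n ZO]) (auto intro!: match_Hom simp: ZO)
      then have "ZeroMor KG [] Z \<cdot>\<^bsub>KG\<^esub> ZeroMor KG Z [] = Ident KG Z"
        using Z crossed_ident[OF ZO] ZO unfolding zero_object_def zero_eq_match by blast
      from retract_entries[OF I z this] show ?thesis by simp
    qed
    show "Sh KG A \<in> ?J \<longleftrightarrow> A \<in> ?J" if "A \<in> Obj KG" for A
    proof -
      have "Sh K B \<in> I \<longleftrightarrow> B \<in> I" if "(B, g) \<in> set A" for B g
        using thick_idealD(4)[OF I] \<open>A \<in> Obj KG\<close> that by (auto simp: Obj_crossed lists_eq_set)
      then show ?thesis by (fastforce simp: Sh_crossed lists_eq_set)
    qed
    show "A \<in> ?J \<and> B \<in> ?J" if sum: "is_direct_sum KG A B S" and S: "S \<in> ?J" for A B S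
    proof -
      obtain i1 i2 p1 p2 where i: "i1 \<in> Hom KG A S" "i2 \<in> Hom KG B S"
        and p: "p1 \<in> Hom KG S A" "p2 \<in> Hom KG S B"
        and e: "p1 \<cdot>\<^bsub>KG\<^esub> i1 = Ident KG A" "p2 \<cdot>\<^bsub>KG\<^esub> i2 = Ident KG B"
        using sum unfolding is_direct_sum_def by blast
      show ?thesis
        using retract_entries[OF I i(1) p(1) e(1) S] retract_entries[OF I i(2) p(2) e(2) S] by simp
    qed
    show "A \<boxdot>\<^bsub>KG\<^esub> B \<in> ?J \<and> B \<boxdot>\<^bsub>KG\<^esub> A \<in> ?J" if A: "A \<in> ?J" and B: "B \<in> Obj KG" for A B
    proof
      show "A \<boxdot>\<^bsub>KG\<^esub> B \<in> ?J"
        using A B thick_idealD(7)[OF I _ T_obj]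
        by (auto simp: tens_crossed lists_eq_set set_tens_obj Obj_crossed) blast
      show "B \<boxdot>\<^bsub>KG\<^esub> A \<in> ?J"
        using A B thick_idealD(8)[OF I TI]
        by (auto simp: tens_crossed lists_eq_set set_tens_obj Obj_crossed) blast
    qed
    show "Cod KG g \<in> ?J" if t: "(f, g, h) \<in> Dist KG" and f: "Dom KG f \<in> ?J" "Cod KG f \<in> ?J" for f g h
    proof -
      obtain ts where ts: "ts \<in> lists (Dist K \<times> carrier G)"
        and iso: "isomorphic_triangles KG (f, g, h)
          (cp_diag K (map (\<lambda>((f, g, h), x). (f, x)) ts),
           cp_diag K (map (\<lambda>((f, g, h), x). (g, x)) ts),
           cp_diag K (map (\<lambda>((f, g, h), x). (h, x)) ts))"
        using t unfolding Dist_crossed cp_dist_def isomorphic_triangles_shift_cat[of K G T \<gamma>] by blast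
      have d: "Dom KG g = Cod KG f" "Dom KG h = Cod KG g"
        using iso unfolding isomorphic_triangles_def triangle_def by auto
      have isos: "isomorphic KG (Dom KG f) (Dom KG (cp_diag K (map (\<lambda>((f, g, h), x). (f, x)) ts)))"
        "isomorphic KG (Dom KG g) (Dom KG (cp_diag K (map (\<lambda>((f, g, h), x). (g, x)) ts)))"
        "isomorphic KG (Dom KG h) (Dom KG (cp_diag K (map (\<lambda>((f, g, h), x). (h, x)) ts)))"
        using iso unfolding isomorphic_triangles_def isomorphic_def case_prod_conv by blast+
      have a: "map ((\<lambda>(f, g). (Dom K f, g)) \<circ> (\<lambda>((f, g, h), x). (f, x))) ts \<in> ?J"
        "map ((\<lambda>(f, g). (Dom K f, g)) \<circ> (\<lambda>((f, g, h), x). (g, x))) ts \<in> ?J"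
        using isomorphic_entries[OF I isomorphic_sym[OF isos(1)] f(1)]
          isomorphic_entries[OF I isomorphic_sym[OF isos(2)] f(2)[folded d(1)]]
        unfolding dom_diag map_map by simp_all
      have "Dom K h' \<in> I \<and> x \<in> carrier G" if m: "((f', g', h'), x) \<in> set ts" for f' g' h' x
      proof -
        have D: "(f', g', h') \<in> Dist K" and x: "x \<in> carrier G" using ts m by (auto simp: lists_eq_set)
        have "Dom K f' \<in> I" "Dom K g' \<in> I" using a m by (force simp: lists_eq_set)+
        moreover have "Dom K g' = Cod K f'" "Dom K h' = Cod K g'"
          using dist_triangle[OF D] by (auto simp: triangle_def)
        ultimately show ?thesis using thick_idealD(5)[OF I D] x by simp
      qed
      then have "Dom KG (cp_diag K (map (\<lambda>((f, g, h), x). (h, x)) ts)) \<in> ?J"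
        unfolding dom_diag map_map by (force simp: lists_eq_set)
      then show ?thesis using isomorphic_entries[OF I isos(3)] d(2) by simp
    qed
  qed
qed

section \<open>Restricting a thick ideal of the crossed product\<close>

text \<open>
  Tensoring \<open>A \<boxtimes> g\<close> on the right with \<open>1 \<boxtimes> g\<^sup>-\<^sup>1 h\<close> gives \<open>(A \<otimes> T\<^sub>g 1) \<boxtimes> h \<cong> A \<boxtimes> h\<close>.
\<close>

lemma box_regrade:
  assumes J: "thick_ideal KG J" and A: "[(A, g)] \<in> J" and h: "h \<in> carrier G"
  shows "[(A, h)] \<in> J"
proof -
  have Ag: "A \<in> Obj K" "g \<in> carrier G" using thick_idealD(1)[OF J] A box_Obj by blast+
  let ?k = "inv\<^bsub>G\<^esub> g \<otimes>\<^bsub>G\<^esub> h"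
  have k: "?k \<in> carrier G" using Ag h by simp
  have "[(A, g)] \<boxdot>\<^bsub>KG\<^esub> [(TUnit K, ?k)] \<in> J"
    using thick_idealD(7)[OF J A] k unit_obj box_Obj by simp
  then have m: "[(A \<boxdot>\<^bsub>K\<^esub> fo (T g) (TUnit K), h)] \<in> J"
    using Ag h by (simp add: tens_crossed tens_obj_box m_assoc[symmetric])
  have "isomorphic K (A \<boxdot>\<^bsub>K\<^esub> fo (T g) (TUnit K)) A"
    using isomorphic_trans[OF tens_isomorphic[OF isomorphic_refl[OF Ag(1)] T_unit_isomorphic[OF Ag(2)]]
        runit_isomorphic[OF Ag(1)]] .
  from thick_idealD(2)[OF J m _ box_isomorphic[OF this h]] show ?thesis
    using Ag h box_Obj by simp
qed

text \<open>
  Distinguished triangles of the crossed product are diagonal up to isomorphism, so the sum is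
  realised by a diagonal triangle: \<open>Z \<rightarrow> \<Sigma> A = \<Sigma> A\<close> in the place of \<open>A\<close>, and \<open>B \<rightarrow> Z \<rightarrow> \<Sigma> B\<close> in the place
  of each entry \<open>B\<close> of \<open>X\<close>, where \<open>Z\<close> is zero. Up to zero summands its first two objects are \<open>X\<close> and
  \<open>\<Sigma> A \<boxtimes> g\<close>, and its third is the shift of the list in question.
\<close>

lemma thick_sum_mem:
  assumes J: "thick_ideal KG J" and A: "[(A, g)] \<in> J" and X: "X \<in> J"
  shows "(A, g) # X \<in> J"
proof -
  have Ag: "A \<in> Obj K" "g \<in> carrier G" using thick_idealD(1)[OF J] A box_Obj by blast+
  have XO: "X \<in> Obj KG" using thick_idealD(1)[OF J] X by blast
  obtain Z where Z: "zero_object K Z" using zero_object_exists by blast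
  have ZO: "Z \<in> Obj K" using Z zero_object_iff by blast
  have SA: "Sh K A \<in> Obj K" using shift_obj[OF Ag(1)] .
  have SgA: "[(Sh K A, g)] \<in> J"
    using thick_idealD(4)[OF J, of "[(A, g)]"] A Ag box_Obj by (simp add: Sh_crossed)
  define t0 where "t0 = (ZeroMor K Z (Sh K A), Ident K (Sh K A), ZeroMor K (Sh K A) (Sh K Z))"
  define t where "t B = (ZeroMor K B Z, ZeroMor K Z (Sh K B), NegMor K (Shm K (Ident K B)))" for B
  have t0: "t0 \<in> Dist K" unfolding t0_def by (rule dist_zero_ident[OF SA Z])
  have t: "t B \<in> Dist K" if "B \<in> Obj K" for B
    unfolding t_def by (rule dist_rotated[OF dist_ident[OF that Z]])
  have Ob: "B \<in> Obj K \<and> x \<in> carrier G" if "(B, x) \<in> set X" for B x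
    using XO that by (auto simp: Obj_crossed lists_eq_set)
  define ts where "ts = (t0, g) # map (\<lambda>(B, x). (t B, x)) X"
  have ts: "ts \<in> lists (Dist K \<times> carrier G)"
    using t0 t Ob Ag by (auto simp: ts_def lists_eq_set)
  let ?f = "cp_diag K (map (\<lambda>((f, g, h), x). (f, x)) ts)"
  let ?g = "cp_diag K (map (\<lambda>((f, g, h), x). (g, x)) ts)"
  let ?Zs = "map (\<lambda>(B, x). (Z, x)) X"
  have dz: "Dom K (ZeroMor K C D) = C \<and> Cod K (ZeroMor K C D) = D" if "C \<in> Obj K" "D \<in> Obj K" for C D
    using zero_mor[OF that] by (simp add: Hom_def)
  have "Dom KG ?f = [(Z, g)] @ X"
    unfolding dom_diag map_map using Ob dz ZO SA by (auto simp: ts_def t0_def t_def intro!: map_idI)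
  moreover have "Cod KG ?f = [(Sh K A, g)] @ ?Zs"
    unfolding cod_diag map_map using Ob dz ZO SA by (auto simp: ts_def t0_def t_def)
  moreover have "Cod KG ?g = Sh KG ((A, g) # X)"
    unfolding cod_diag map_map Sh_crossed
    using Ob dz[OF ZO] shift_obj ident[OF SA] by (auto simp: ts_def t0_def t_def Hom_def)
  moreover have "[(Z, g)] @ X \<in> J"
    using thick_idealD(2)[OF J X _ append_zero_isomorphic(2)[OF XO, of "[(Z, g)]"]] Z ZO Ag XO
    by (simp add: append_Obj box_Obj Obj_crossed)
  moreover have "[(Sh K A, g)] @ ?Zs \<in> J"
  proof (rule thick_idealD(2)[OF J SgA])
    show "isomorphic KG [(Sh K A, g)] ([(Sh K A, g)] @ ?Zs)"
      by (rule append_zero_isomorphic(1)) (use SA Ag Ob Z in \<open>auto simp: box_Obj\<close>)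
    show "[(Sh K A, g)] @ ?Zs \<in> Obj KG"
      using SA Ag Ob ZO by (auto simp: Obj_crossed lists_eq_set)
  qed
  ultimately have "Sh KG ((A, g) # X) \<in> J"
    using thick_idealD(5)[OF J diag_dist[OF ts]] by simp
  moreover have "(A, g) # X \<in> Obj KG" using Ag XO by (simp add: Obj_crossed)
  ultimately show ?thesis using thick_idealD(4)[OF J] by blast
qed

lemma thick_mem_iff:
  assumes J: "thick_ideal KG J" and X: "X \<in> Obj KG"
  shows "X \<in> J \<longleftrightarrow> (\<forall>x \<in> set X. [x] \<in> J)"
  using X
proof (induction X)
  case Nil
  have "[] \<in> J" by (rule thick_idealD(3)[OF J zero_object_crossed]) simp_all
  then show ?case by simp
next
  case (Cons x X)
  then have X: "X \<in> Obj KG" and x: "[x] \<in> Obj KG" by (simp_all add: Obj_crossed)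
  have "x # X \<in> J \<longrightarrow> [x] \<in> J \<and> X \<in> J"
    using thick_idealD(6)[OF J direct_sum_append[OF x X] x X] by simp
  moreover have "[x] \<in> J \<and> X \<in> J \<longrightarrow> x # X \<in> J"
    using thick_sum_mem[OF J, of "fst x" "snd x" X] by simp
  ultimately have "x # X \<in> J \<longleftrightarrow> [x] \<in> J \<and> X \<in> J" by blast
  then show ?case by (simp only: Cons.IH[OF X] list.set ball_simps)
qed

lemma crossed_restrict:
  assumes J: "thick_ideal KG J"
  shows "lists (ideal_restrict K G J \<times> carrier G) = J"
proof -
  have "X \<in> lists (ideal_restrict K G J \<times> carrier G) \<longleftrightarrow> X \<in> J" if X: "X \<in> Obj KG" for X
  proof -
    have "A \<in> ideal_restrict K G J \<and> g \<in> carrier G \<longleftrightarrow> [(A, g)] \<in> J" if "(A, g) \<in> set X" for A g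
    proof -
      have "A \<in> Obj K" "g \<in> carrier G" using X that by (auto simp: Obj_crossed lists_eq_set)
      then show ?thesis
        using box_regrade[OF J, of A g "\<one>\<^bsub>G\<^esub>"] box_regrade[OF J, of A "\<one>\<^bsub>G\<^esub>" g]
        by (auto simp: ideal_restrict_def box_def)
    qed
    then show ?thesis unfolding thick_mem_iff[OF J X] by (auto simp: lists_eq_set)
  qed
  moreover have "lists (ideal_restrict K G J \<times> carrier G) \<subseteq> Obj KG"
    unfolding Obj_crossed ideal_restrict_def by (intro lists_mono) blast
  ultimately show ?thesis using thick_idealD(1)[OF J] by blast
qed

lemma restrict_mem: "A \<in> ideal_restrict K G J \<longleftrightarrow> A \<in> Obj K \<and> [(A, \<one>\<^bsub>G\<^esub>)] \<in> J"
  by (simp add: ideal_restrict_def box_def)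

text \<open>
  The functor \<open>A \<mapsto> A \<boxtimes> e\<close> transports each closure property from \<open>J\<close>; for the tensor product
  it is multiplicative up to the isomorphism \<open>T\<^sub>e B \<cong> B\<close>.
\<close>

lemma restrict_thick:
  assumes J: "thick_ideal KG J"
  shows "thick_ideal K (ideal_restrict K G J)"
proof (rule thick_idealI)
  note one = one_closed
  let ?e = "\<one>\<^bsub>G\<^esub>"
  show "ideal_restrict K G J \<subseteq> Obj K" by (auto simp: restrict_mem)
  show iso: "B \<in> ideal_restrict K G J"
    if "A \<in> ideal_restrict K G J" "B \<in> Obj K" "isomorphic K A B" for A B
    using thick_idealD(2)[OF J _ _ box_isomorphic[OF that(3) one]] that by (simp add: restrict_mem box_Obj)
  show "Z \<in> ideal_restrict K G J" if "zero_object K Z" for Z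
    using thick_idealD(3)[OF J zero_object_crossed[of "[(Z, ?e)]"]] that
    by (simp add: restrict_mem zero_object_iff)
  show "Sh K A \<in> ideal_restrict K G J \<longleftrightarrow> A \<in> ideal_restrict K G J" if "A \<in> Obj K" for A
    using thick_idealD(4)[OF J, of "[(A, ?e)]"] that shift_obj
    by (simp add: restrict_mem box_Obj Sh_crossed)
  show "Cod K g \<in> ideal_restrict K G J" if t: "(f, g, h) \<in> Dist K"
    and "Dom K f \<in> ideal_restrict K G J" "Cod K f \<in> ideal_restrict K G J" for f g h
  proof -
    have "(cp_diag K [(f, ?e)], cp_diag K [(g, ?e)], cp_diag K [(h, ?e)]) \<in> Dist KG"
      using diag_dist[of "[((f, g, h), ?e)]"] t by simp
    from thick_idealD(5)[OF J this] show ?thesis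
      using that Hom_Obj[OF dist_homs(2)[OF t]] by (simp add: restrict_mem)
  qed
  show "A \<in> ideal_restrict K G J \<and> B \<in> ideal_restrict K G J"
    if "is_direct_sum K A B S" "A \<in> Obj K" "B \<in> Obj K" "S \<in> ideal_restrict K G J" for A B S
    using thick_idealD(6)[OF J box_direct_sum[OF that(1) one]] that by (simp add: restrict_mem box_Obj)
  show "A \<boxdot>\<^bsub>K\<^esub> B \<in> ideal_restrict K G J \<and> B \<boxdot>\<^bsub>K\<^esub> A \<in> ideal_restrict K G J"
    if "A \<in> ideal_restrict K G J" "B \<in> Obj K" for A B
  proof -
    have A: "A \<in> Obj K" "[(A, ?e)] \<in> J" using that restrict_mem by simp_all
    have tens: "Y \<boxdot>\<^bsub>K\<^esub> X \<in> ideal_restrict K G J"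
      if X: "X \<in> Obj K" and Y: "Y \<in> Obj K" and m: "[(Y, ?e)] \<boxdot>\<^bsub>KG\<^esub> [(X, ?e)] \<in> J" for X Y
    proof (rule iso)
      show "Y \<boxdot>\<^bsub>K\<^esub> fo (T ?e) X \<in> ideal_restrict K G J"
        using m tens_obj[OF Y T_obj[OF one X]] by (simp add: restrict_mem tens_crossed tens_obj_box)
      show "Y \<boxdot>\<^bsub>K\<^esub> X \<in> Obj K" by (rule tens_obj[OF Y X])
      show "isomorphic K (Y \<boxdot>\<^bsub>K\<^esub> fo (T ?e) X) (Y \<boxdot>\<^bsub>K\<^esub> X)"
        by (rule tens_isomorphic[OF isomorphic_refl[OF Y] T_one_isomorphic[OF X]])
    qed
    show ?thesis
      using tens[OF that(2) A(1)] tens[OF A(1) that(2)] thick_idealD(7,8)[OF J A(2)] that(2) box_Obj by simp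
  qed
qed

text \<open>
  For invariance under the action: \<open>(1 \<boxtimes> g) \<otimes> (A \<boxtimes> e) \<cong> T\<^sub>g A \<boxtimes> g\<close>, which may be moved to degree \<open>e\<close>.
\<close>

lemma restrict_G_ideal:
  assumes J: "thick_ideal KG J"
  shows "G_ideal K G T (ideal_restrict K G J)"
  unfolding G_ideal_def
proof (intro conjI ballI subsetI)
  show thick: "thick_ideal K (ideal_restrict K G J)" by (rule restrict_thick[OF J])
  fix g B assume g: "g \<in> carrier G" and "B \<in> fo (T g) ` ideal_restrict K G J"
  then obtain A where A: "A \<in> Obj K" "[(A, \<one>\<^bsub>G\<^esub>)] \<in> J" and B: "B = fo (T g) A"
    by (auto simp: restrict_mem)
  have TA: "fo (T g) A \<in> Obj K" by (rule T_obj[OF g A(1)])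
  have "[(TUnit K, g)] \<boxdot>\<^bsub>KG\<^esub> [(A, \<one>\<^bsub>G\<^esub>)] \<in> J"
    using thick_idealD(8)[OF J A(2)] g unit_obj box_Obj by simp
  then have "[(TUnit K \<boxdot>\<^bsub>K\<^esub> fo (T g) A, g)] \<in> J" using g by (simp add: tens_crossed tens_obj_box)
  from box_regrade[OF J this one_closed]
  have "TUnit K \<boxdot>\<^bsub>K\<^esub> fo (T g) A \<in> ideal_restrict K G J"
    using tens_obj[OF unit_obj TA] by (simp add: restrict_mem)
  from thick_idealD(2)[OF thick this TA lunit_isomorphic[OF TA]]
  show "B \<in> ideal_restrict K G J" unfolding B .
qed

lemma restrict_crossed:
  assumes "I \<subseteq> Obj K" shows "ideal_restrict K G (lists (I \<times> carrier G)) = I"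
  using assms by (auto simp: restrict_mem)

section \<open>Primes and spectra\<close>

text \<open>
  Passing to degree \<open>e\<close> and using \<open>T\<^sub>e B \<cong> B\<close> gives one direction; the other needs that \<open>J\<close> absorbs the
  twist in \<open>A \<otimes> T\<^sub>g B\<close>.
\<close>

lemma tens_set_crossed:
  assumes I: "I \<subseteq> Obj K" and GJ: "G_ideal K G T J" and GQ: "G_ideal K G T Q"
  shows "tens_set KG (lists (I \<times> carrier G)) (lists (J \<times> carrier G)) \<subseteq> lists (Q \<times> carrier G)
    \<longleftrightarrow> tens_set K I J \<subseteq> Q"
proof
  have J: "J \<subseteq> Obj K" and TJ: "\<And>g A. g \<in> carrier G \<Longrightarrow> A \<in> J \<Longrightarrow> fo (T g) A \<in> J"
    and Q: "thick_ideal K Q"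
    using GJ GQ thick_idealD(1) unfolding G_ideal_def by blast+
  show "tens_set K I J \<subseteq> Q"
    if h: "tens_set KG (lists (I \<times> carrier G)) (lists (J \<times> carrier G)) \<subseteq> lists (Q \<times> carrier G)"
  proof
    fix D assume "D \<in> tens_set K I J"
    then obtain A B where A: "A \<in> I" and B: "B \<in> J" and D: "D = A \<boxdot>\<^bsub>K\<^esub> B" by (auto simp: tens_set_def)
    have Ob: "A \<in> Obj K" "B \<in> Obj K" using A B I J by blast+
    have "[(A, \<one>\<^bsub>G\<^esub>)] \<boxdot>\<^bsub>KG\<^esub> [(B, \<one>\<^bsub>G\<^esub>)] \<in> tens_set KG (lists (I \<times> carrier G)) (lists (J \<times> carrier G))"
      unfolding tens_set_def using A B by (fastforce intro: lists.intros)
    then have "A \<boxdot>\<^bsub>K\<^esub> fo (T \<one>\<^bsub>G\<^esub>) B \<in> Q"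
      using h by (auto simp: tens_crossed tens_obj_box)
    from thick_idealD(2)[OF Q this tens_obj[OF Ob]
        tens_isomorphic[OF isomorphic_refl[OF Ob(1)] T_one_isomorphic[OF Ob(2)]]]
    show "D \<in> Q" unfolding D .
  qed
  show "tens_set KG (lists (I \<times> carrier G)) (lists (J \<times> carrier G)) \<subseteq> lists (Q \<times> carrier G)"
    if h: "tens_set K I J \<subseteq> Q"
  proof -
    have m: "A \<boxdot>\<^bsub>K\<^esub> fo (T g) B \<in> Q" if "A \<in> I" "B \<in> J" "g \<in> carrier G" for A B g
      using h that TJ unfolding tens_set_def by blast
    have "X \<boxdot>\<^bsub>KG\<^esub> Y \<in> lists (Q \<times> carrier G)"
      if X: "X \<in> lists (I \<times> carrier G)" and Y: "Y \<in> lists (J \<times> carrier G)" for X Y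
    proof -
      have "z \<in> Q \<times> carrier G" if mem: "z \<in> set (cp_tens_obj K G T X Y)" for z
      proof -
        obtain A g B h where "(A, g) \<in> set X" "(B, h) \<in> set Y"
          and z: "z = (A \<boxdot>\<^bsub>K\<^esub> fo (T g) B, g \<otimes>\<^bsub>G\<^esub> h)"
          using mem unfolding set_tens_obj by blast
        then have "A \<in> I" "g \<in> carrier G" "B \<in> J" "h \<in> carrier G"
          using X Y unfolding lists_eq_set by blast+
        then show ?thesis unfolding z using m by simp
      qed
      then show ?thesis unfolding tens_crossed lists_eq_set by blast
    qed
    then show ?thesis unfolding tens_set_def by blast
  qed
qed

lemma G_ideal_sub: "G_ideal K G T I \<Longrightarrow> I \<subseteq> Obj K"
  unfolding G_ideal_def by (blast dest: thick_idealD(1))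

lemma crossed_mono_iff:
  assumes "I \<subseteq> Obj K"
  shows "lists (I \<times> carrier G) \<subseteq> lists (J \<times> carrier G) \<longleftrightarrow> I \<subseteq> J"
proof
  assume h: "lists (I \<times> carrier G) \<subseteq> lists (J \<times> carrier G)"
  show "I \<subseteq> J"
  proof
    fix A assume "A \<in> I"
    then have "[(A, \<one>\<^bsub>G\<^esub>)] \<in> lists (J \<times> carrier G)" using h by (intro subsetD[OF h]) simp
    then show "A \<in> J" by simp
  qed
qed (intro lists_mono, blast)

lemma crossed_eq_Obj:
  assumes "Q \<subseteq> Obj K"
  shows "lists (Q \<times> carrier G) = Obj KG \<longleftrightarrow> Q = Obj K"
  unfolding Obj_crossed using crossed_mono_iff[of Q "Obj K"] crossed_mono_iff[of "Obj K" Q] assms by auto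

lemma prime_crossed_iff:
  assumes Q: "G_ideal K G T Q"
  shows "prime_ideal KG (lists (Q \<times> carrier G)) \<longleftrightarrow> G_prime K G T Q"
proof
  assume P: "prime_ideal KG (lists (Q \<times> carrier G))"
  show "G_prime K G T Q" unfolding G_prime_def
  proof (intro conjI allI impI)
    show "Q \<noteq> Obj K" using P crossed_eq_Obj[OF G_ideal_sub[OF Q]] unfolding prime_ideal_def by blast
    fix I J assume h: "G_ideal K G T I \<and> G_ideal K G T J \<and> tens_set K I J \<subseteq> Q"
    then have I: "G_ideal K G T I" and J: "G_ideal K G T J" by simp_all
    have "tens_set KG (lists (I \<times> carrier G)) (lists (J \<times> carrier G)) \<subseteq> lists (Q \<times> carrier G)"
      using h tens_set_crossed[OF G_ideal_sub[OF I] J Q] by simp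
    then have "lists (I \<times> carrier G) \<subseteq> lists (Q \<times> carrier G) \<or> lists (J \<times> carrier G) \<subseteq> lists (Q \<times> carrier G)"
      using P thick_ideal_crossed[OF I] thick_ideal_crossed[OF J] unfolding prime_ideal_def by blast
    then show "I \<subseteq> Q \<or> J \<subseteq> Q"
      unfolding crossed_mono_iff[OF G_ideal_sub[OF I]] crossed_mono_iff[OF G_ideal_sub[OF J]] .
  qed (rule Q)
next
  assume P: "G_prime K G T Q"
  show "prime_ideal KG (lists (Q \<times> carrier G))" unfolding prime_ideal_def
  proof (intro conjI allI impI)
    show "thick_ideal KG (lists (Q \<times> carrier G))" by (rule thick_ideal_crossed[OF Q])
    show "lists (Q \<times> carrier G) \<noteq> Obj KG"
      using P crossed_eq_Obj[OF G_ideal_sub[OF Q]] unfolding G_prime_def by blast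
    fix I J assume h: "thick_ideal KG I \<and> thick_ideal KG J \<and> tens_set KG I J \<subseteq> lists (Q \<times> carrier G)"
    let ?I = "ideal_restrict K G I" and ?J = "ideal_restrict K G J"
    have e: "I = lists (?I \<times> carrier G)" "J = lists (?J \<times> carrier G)"
      using h crossed_restrict by blast+
    have GI: "G_ideal K G T ?I" and GJ: "G_ideal K G T ?J" using h restrict_G_ideal by blast+
    have "tens_set KG (lists (?I \<times> carrier G)) (lists (?J \<times> carrier G)) \<subseteq> lists (Q \<times> carrier G)"
      using h e by simp
    then have "tens_set K ?I ?J \<subseteq> Q" using tens_set_crossed[OF G_ideal_sub[OF GI] GJ Q] by simp
    then have "?I \<subseteq> Q \<or> ?J \<subseteq> Q" using P GI GJ unfolding G_prime_def by blast
    then have "lists (?I \<times> carrier G) \<subseteq> lists (Q \<times> carrier G) \<or> lists (?J \<times> carrier G) \<subseteq> lists (Q \<times> carrier G)"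
      unfolding crossed_mono_iff[OF G_ideal_sub[OF GI]] crossed_mono_iff[OF G_ideal_sub[OF GJ]] .
    then show "I \<subseteq> lists (Q \<times> carrier G) \<or> J \<subseteq> lists (Q \<times> carrier G)" using e by simp
  qed
qed

text \<open>
  The direct sum in \<open>K\<close> of the entries of \<open>X\<close>, with degrees forgotten. It turns the closed
  sets of \<open>Spc\<close>, cut out by lists, into closed sets cut out by objects of \<open>K\<close>.
\<close>

lemma total_sum_exists:
  assumes "X \<in> Obj KG"
  shows "\<exists>S \<in> Obj K. \<forall>Q. thick_ideal K Q \<longrightarrow> (S \<in> Q \<longleftrightarrow> X \<in> lists (Q \<times> carrier G))"
  using assms
proof (induction X)
  case Nil
  obtain Z where Z: "zero_object K Z" using zero_object_exists by blast
  then show ?case using thick_idealD(3)[OF _ Z] by (intro bexI[of _ Z]) (auto simp: zero_object_iff)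
next
  case (Cons x X)
  obtain A g where x: "x = (A, g)" by (cases x)
  have A: "A \<in> Obj K" "g \<in> carrier G" and X: "X \<in> Obj KG" using Cons.prems x by (simp_all add: Obj_crossed)
  obtain S where S: "S \<in> Obj K" "\<forall>Q. thick_ideal K Q \<longrightarrow> (S \<in> Q \<longleftrightarrow> X \<in> lists (Q \<times> carrier G))"
    using Cons.IH[OF X] by blast
  obtain S' where S': "S' \<in> Obj K" "is_direct_sum K A S S'" using direct_sum_exists[OF A(1) S(1)] by blast
  have "S' \<in> Q \<longleftrightarrow> x # X \<in> lists (Q \<times> carrier G)" if "thick_ideal K Q" for Q
    using thick_direct_sum_iff[OF that S'(2) A(1) S(1)] S(2) that x A by simp
  then show ?case using S'(1) by blast
qed

text \<open>
  The hypotheses of \<open>istopology_ideals\<close> are met: all members of the space contain the zero object,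
  and two objects lie in a thick ideal iff their direct sum does.
\<close>

lemma G_Spc_topology:
  shows "topspace (G_Spc K G T) = {Q. G_prime K G T Q}"
    and "closedin (G_Spc K G T) Z \<longleftrightarrow> (\<exists>S \<subseteq> Obj K. Z = {P \<in> {Q. G_prime K G T Q}. S \<inter> P = {}})"
proof -
  let ?X = "{Q. G_prime K G T Q}"
  have thick: "thick_ideal K P" if "P \<in> ?X" for P using that by (simp add: G_prime_def G_ideal_def)
  obtain N where N: "zero_object K N" using zero_object_exists by blast
  have z: "\<exists>z \<in> Obj K. \<forall>P \<in> ?X. z \<in> P"
    using N thick_idealD(3)[OF thick N] zero_object_iff by blast
  have s: "\<exists>s \<in> Obj K. \<forall>P \<in> ?X. s \<in> P \<longleftrightarrow> a \<in> P \<and> b \<in> P" if "a \<in> Obj K" "b \<in> Obj K" for a b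
  proof -
    obtain s where "s \<in> Obj K" "is_direct_sum K a b s" using direct_sum_exists[OF \<open>a \<in> Obj K\<close> \<open>b \<in> Obj K\<close>] by blast
    then show ?thesis using thick_direct_sum_iff[OF thick] that by blast
  qed
  show "topspace (G_Spc K G T) = ?X"
    and "closedin (G_Spc K G T) Z \<longleftrightarrow> (\<exists>S \<subseteq> Obj K. Z = {P \<in> ?X. S \<inter> P = {}})" for Z
    unfolding G_Spc_def using istopology_ideals(2,3)[OF z s] by simp_all
qed

lemma Spc_topology:
  shows "topspace (Spc KG) = {P. prime_ideal KG P}"
    and "closedin (Spc KG) Z \<longleftrightarrow> (\<exists>S \<subseteq> Obj KG. Z = {P \<in> {P. prime_ideal KG P}. S \<inter> P = {}})"
proof -
  let ?X = "{P. prime_ideal KG P}"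
  have thick: "thick_ideal KG P" if "P \<in> ?X" for P using that by (simp add: prime_ideal_def)
  have z: "\<exists>z \<in> Obj KG. \<forall>P \<in> ?X. z \<in> P"
    using thick_mem_iff[OF thick, of _ "[]"] by (intro bexI[of _ "[]"]) (simp_all add: Obj_crossed)
  have s: "\<exists>s \<in> Obj KG. \<forall>P \<in> ?X. s \<in> P \<longleftrightarrow> a \<in> P \<and> b \<in> P" if "a \<in> Obj KG" "b \<in> Obj KG" for a b
  proof (intro bexI[of _ "a @ b"] ballI)
    show ab: "a @ b \<in> Obj KG" using that append_Obj by simp
    fix P assume "P \<in> ?X"
    from thick_mem_iff[OF thick[OF this]] show "a @ b \<in> P \<longleftrightarrow> a \<in> P \<and> b \<in> P"
      using that ab by auto
  qed
  show "topspace (Spc KG) = ?X"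
    and "closedin (Spc KG) Z \<longleftrightarrow> (\<exists>S \<subseteq> Obj KG. Z = {P \<in> ?X. S \<inter> P = {}})" for Z
    unfolding Spc_def using istopology_ideals(2,3)[OF z s] by simp_all
qed

lemma G_primeD: "G_prime K G T Q \<Longrightarrow> G_ideal K G T Q" "G_prime K G T Q \<Longrightarrow> thick_ideal K Q"
  by (simp_all add: G_prime_def G_ideal_def)

lemma restrict_prime:
  assumes P: "prime_ideal KG P" shows "G_prime K G T (ideal_restrict K G P)"
proof -
  have thick: "thick_ideal KG P" using P by (simp add: prime_ideal_def)
  then show ?thesis
    using prime_crossed_iff[OF restrict_G_ideal[OF thick]] crossed_restrict[OF thick] P by simp
qed

lemma crossed_prime: "G_prime K G T Q \<Longrightarrow> prime_ideal KG (lists (Q \<times> carrier G))"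
  using prime_crossed_iff G_primeD(1) by blast

lemma continuous_restrict: "continuous_map (Spc KG) (G_Spc K G T) (ideal_restrict K G)"
  unfolding continuous_map_closedin Spc_topology(1) G_Spc_topology(1)
proof (intro conjI allI impI)
  show "ideal_restrict K G \<in> {P. prime_ideal KG P} \<rightarrow> {Q. G_prime K G T Q}"
    using restrict_prime by blast
  fix C assume "closedin (G_Spc K G T) C"
  then obtain S where S: "S \<subseteq> Obj K" and C: "C = {P \<in> {Q. G_prime K G T Q}. S \<inter> P = {}}"
    unfolding G_Spc_topology(2) by blast
  let ?S = "(\<lambda>A. [(A, \<one>\<^bsub>G\<^esub>)]) ` S"
  have "?S \<subseteq> Obj KG" using S by (auto simp: Obj_crossed)
  moreover have "{P \<in> {P. prime_ideal KG P}. ideal_restrict K G P \<in> C} =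
      {P \<in> {P. prime_ideal KG P}. ?S \<inter> P = {}}"
    unfolding C using S restrict_prime by (auto simp: restrict_mem disjoint_iff)
  ultimately show "closedin (Spc KG) {P \<in> {P. prime_ideal KG P}. ideal_restrict K G P \<in> C}"
    unfolding Spc_topology(2) by blast
qed

lemma continuous_crossed: "continuous_map (G_Spc K G T) (Spc KG) (\<lambda>Q. lists (Q \<times> carrier G))"
  unfolding continuous_map_closedin Spc_topology(1) G_Spc_topology(1)
proof (intro conjI allI impI)
  show "(\<lambda>Q. lists (Q \<times> carrier G)) \<in> {Q. G_prime K G T Q} \<rightarrow> {P. prime_ideal KG P}"
    using crossed_prime by blast
  fix C assume "closedin (Spc KG) C"
  then obtain S where S: "S \<subseteq> Obj KG" and C: "C = {P \<in> {P. prime_ideal KG P}. S \<inter> P = {}}"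
    unfolding Spc_topology(2) by blast
  let ?S = "{s \<in> Obj K. \<exists>X \<in> S. \<forall>Q. thick_ideal K Q \<longrightarrow> (s \<in> Q \<longleftrightarrow> X \<in> lists (Q \<times> carrier G))}"
  have "S \<inter> lists (Q \<times> carrier G) = {} \<longleftrightarrow> ?S \<inter> Q = {}" if Q: "G_prime K G T Q" for Q
  proof
    show "?S \<inter> Q = {}" if "S \<inter> lists (Q \<times> carrier G) = {}"
      using that G_primeD(2)[OF Q] by blast
    show "S \<inter> lists (Q \<times> carrier G) = {}" if "?S \<inter> Q = {}"
    proof (rule ccontr)
      assume "S \<inter> lists (Q \<times> carrier G) \<noteq> {}"
      then obtain X where X: "X \<in> S" "X \<in> lists (Q \<times> carrier G)" by blast
      then obtain s where "s \<in> Obj K" "\<forall>Q. thick_ideal K Q \<longrightarrow> (s \<in> Q \<longleftrightarrow> X \<in> lists (Q \<times> carrier G))"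
        using total_sum_exists S by blast
      then have "s \<in> ?S \<inter> Q" using X G_primeD(2)[OF Q] by blast
      then show False using that by blast
    qed
  qed
  then have "{Q \<in> {Q. G_prime K G T Q}. lists (Q \<times> carrier G) \<in> C} = {Q \<in> {Q. G_prime K G T Q}. ?S \<inter> Q = {}}"
    unfolding C using crossed_prime by blast
  moreover have "?S \<subseteq> Obj K" by blast
  ultimately show "closedin (G_Spc K G T) {Q \<in> {Q. G_prime K G T Q}. lists (Q \<times> carrier G) \<in> C}"
    unfolding G_Spc_topology(2) by blast
qed

end

theorem proposition5p4:
  fixes K :: "('o, 'm) mt_cat" and G :: "('g, 'w) monoid_scheme"
    and T :: "'g \<Rightarrow> ('o, 'm, 'o, 'm) mt_fctr" and \<gamma> :: "'g \<Rightarrow> 'g \<Rightarrow> 'o \<Rightarrow> 'm"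
  assumes "mt_group_action K G T \<gamma>"
  shows
    "let KG = crossed_product K G T \<gamma>; ext = ideal_crossed K G T \<gamma>; res = ideal_restrict K G in
       (\<forall>I. G_ideal K G T I \<longrightarrow> thick_ideal KG (ext I)) \<and>
       (\<forall>J. thick_ideal KG J \<longrightarrow> G_ideal K G T (res J)) \<and>
       (bij_betw ext {I. G_ideal K G T I} {J. thick_ideal KG J} \<and>
        (\<forall>I. G_ideal K G T I \<longrightarrow> res (ext I) = I) \<and>
        (\<forall>J. thick_ideal KG J \<longrightarrow> ext (res J) = J)) \<and>
       (\<forall>Q. G_ideal K G T Q \<longrightarrow> (G_prime K G T Q \<longleftrightarrow> prime_ideal KG (ext Q))) \<and>
       homeomorphic_maps (Spc KG) (G_Spc K G T) res ext"
proof -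
  interpret mt_group_action K G T \<gamma> by (rule assms)
  let ?ext = "ideal_crossed K G T \<gamma>" and ?res = "ideal_restrict K G"
  have ext: "?ext I = lists (I \<times> carrier G)" if "G_ideal K G T I" for I
    using that by (intro ideal_crossed_eq) (simp add: G_ideal_def)
  have ext_thick: "thick_ideal KG (?ext I)" if "G_ideal K G T I" for I
    unfolding ext[OF that] by (rule thick_ideal_crossed[OF that])
  have res_ext: "?res (?ext I) = I" if "G_ideal K G T I" for I
    unfolding ext[OF that] by (rule restrict_crossed[OF G_ideal_sub[OF that]])
  have ext_res: "?ext (?res J) = J" if "thick_ideal KG J" for J
    unfolding ext[OF restrict_G_ideal[OF that]] by (rule crossed_restrict[OF that])
  have bij: "bij_betw ?ext {I. G_ideal K G T I} {J. thick_ideal KG J}"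
    by (rule bij_betw_byWitness[where f' = ?res])
      (use ext_thick res_ext ext_res restrict_G_ideal in auto)
  have cont: "continuous_map (G_Spc K G T) (Spc KG) ?ext"
    by (rule continuous_map_eq[OF continuous_crossed])
      (simp add: G_Spc_topology(1) ext G_primeD(1))
  have "homeomorphic_maps (Spc KG) (G_Spc K G T) ?res ?ext"
    unfolding homeomorphic_maps_def
  proof (intro conjI ballI)
    fix P assume "P \<in> topspace (Spc KG)"
    then have "thick_ideal KG P" unfolding Spc_topology(1) prime_ideal_def by simp
    then show "?ext (?res P) = P" by (rule ext_res)
  next
    fix Q assume "Q \<in> topspace (G_Spc K G T)"
    then have "G_ideal K G T Q" unfolding G_Spc_topology(1) G_prime_def by simp
    then show "?res (?ext Q) = Q" by (rule res_ext)
  qed (rule continuous_restrict cont)+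
  then show ?thesis
    unfolding Let_def
    using ext_thick restrict_G_ideal bij res_ext ext_res prime_crossed_iff ext by simp
qed

end
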